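(* Let $\alpha\in(0,2]$, $\alpha+\gamma\in[0,2]$, $\beta\in(0,1]$, $H\in[1/2,1)$, $\psi(s)=s^{\alpha/2}(1+s)^{\gamma/2}$, $\tau:=\max\{\frac2\beta(1-\beta-H),0\}$, and suppose $\sum_{\ell\ge1}(2\ell+1)(\psi(\lambda_\ell))^\tau A^i_\ell<\infty$ for $i=1,2$. Let $$\mathbf X(t,\mathbf x)=\sum_{\ell=1}^\infty\sum_{m=-\ell}^{\ell}\Big(\int_0^t(t-s)^{\beta-1}E_{\beta,\beta}\big(-(t-s)^\beta\psi(\lambda_\ell)\big)\,\mathrm d\hat B_{\ell m}(s)\,\mathbf y_{\ell,m}(\mathbf x)+\int_0^t(t-s)^{\beta-1}E_{\beta,\beta}\big(-(t-s)^\beta\psi(\lambda_\ell)\big)\,\mathrm d\tilde B_{\ell m}(s)\,\mathbf z_{\ell,m}(\mathbf x)\Big)$$ (the solution of $\frac{\partial^\beta}{\partial t^\beta}\mathbf X=-\psi(-\Delta^* )\mathbf X+\mathrm d\mathbf B^H$), and for $L\in\mathbb N$ let $\mathbf X_L(t,\mathbf x)$ be the same expression with the sum over $\ell$ restricted to $1\le\ell\le L$. Let $t>0$. Below, $C>0$ denotes constants (possibly different from place to place) not depending on $L$. Then: (i) $$\|\mathbf X(t,\cdot)-\mathbf X_L(t,\cdot)\|_{\mathbf L_2(\Omega\times\mathbb S^2)}\le C\Big(\sum_{\ell=L+1}^\infty(2\ell+1)(A^1_\ell+A^2_\ell)(\psi(\lambda_\ell))^\tau\Big)^{1/2}.$$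 (ii) If for some $\nu>2$ there exist constants $C_0>0$ and $\ell_0\in\mathbb N$ such that $(A^1_\ell+A^2_\ell)(\psi(\lambda_\ell))^\tau\le C_0\,\ell^{-\nu}$ for all $\ell\ge\ell_0$, then $$\|\mathbf X(t,\cdot)-\mathbf X_L(t,\cdot)\|_{\mathbf L_2(\Omega\times\mathbb S^2)}\le C L^{-\frac{\nu-2}2}.$$ (iii) The estimates in (i) and (ii) (the latter under its decay hypothesis) also hold, uniformly over $\mathbf x\in\mathbb S^2$ (i.e. with $C$ independent of $\mathbf x$), with the left-hand side replaced by the root mean squared truncation error $\big(\mathbb E|\mathbf X(t,\mathbf x)-\mathbf X_L(t,\mathbf x)|^2\big)^{1/2}$. (iv) Under the decay hypothesis in (ii), for any $\varepsilon>0$, $$\mathbf P\big(|\mathbf X(t,\mathbf x)-\mathbf X_L(t,\mathbf x)|\ge\varepsilon\big)\le\frac{C}{L^{\nu-2}\varepsilon^2},$$ with $C$ independent of $\varepsilon$ and $\mathbf x$.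
   Context: Vector spherical harmonics. $\mathbb S^2\subset\mathbb R^3$ is the unit sphere with surface measure, $\Delta^*$ its Laplace–Beltrami operator, $\{Y_{\ell,m}\}$ an orthonormal basis of complex spherical harmonics, $\Delta^*Y_{\ell,m}=-\lambda_\ell Y_{\ell,m}$, $\lambda_\ell=\ell(\ell+1)$. For column vectors in $\mathbb C^3$, $\mathbf a\cdot\mathbf b=\mathbf a^T\overline{\mathbf b}$, $|\mathbf a|=\sqrt{\mathbf a\cdot\mathbf a}$. A field $\mathbf f:\mathbb S^2\to\mathbb C^3$ is tangent if $\mathbf f(\mathbf x)\cdot\mathbf x=0$. The surface gradient is $\nabla^*=(I-\mathbf x\mathbf x^T)\nabla$ and the surface curl is $\mathbf L=Q_{\mathbf x}\nabla$, $Q_{\mathbf x}=\begin{pmatrix}0&-x_3&x_2\\ x_3&0&-x_1\\ -x_2&x_1&0\end{pmatrix}$. For $\ell\ge1$, $|m|\le\ell$: $\mathbf y_{\ell,m}=\mathbf L Y_{\ell,m}/\sqrt{\lambda_\ell}$ and $\mathbf z_{\ell,m}=\nabla^*Y_{\ell,m}/\sqrt{\lambda_\ell}$; together they form an orthonormal basis of the space of square-integrable tangent fields with $\langle\mathbf f,\mathbf g\rangle=\int_{\mathbb S^2}\mathbf f\cdot\mathbf g$. On a probability space $(\Omega,\mathcal F,\mathbf P)$, $\mathbf L_2(\Omega\times\mathbb S^2)$ is the space of random tangent fields with $\|\mathbf f\|^2_{\mathbf L_2(\Omega\times\mathbb S^2)}=\mathbb E\int_{\mathbb S^2}|\mathbf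 f(\cdot,\mathbf x)|^2<\infty$. Noise. A real fractional Brownian motion with Hurst index $H$ and variance $A$ at $t=1$ is a centred Gaussian process with value $0$ at $t=0$ and $\mathbb E|B(t)-B(s)|^2=A|t-s|^{2H}$; a complex one is $B^1+\mathrm iB^2$ with $B^1,B^2$ independent real ones of Hurst index $H$ and variance $A$ at $t=1$. $\hat B_{\ell m},\tilde B_{\ell m}$ are independent centred complex fractional Brownian motions with Hurst index $H$ and variances $A^1_\ell$, $A^2_\ell$ at $t=1$ respectively, with $\sum_\ell(2\ell+1)A^i_\ell<\infty$, $i=1,2$, and $\mathbf B^H(t,\mathbf x)=\sum_{\ell\ge1}\sum_{|m|\le\ell}(\hat B_{\ell m}(t)\mathbf y_{\ell,m}(\mathbf x)+\tilde B_{\ell m}(t)\mathbf z_{\ell,m}(\mathbf x))$. For deterministic $g$, $\int_0^tg\,\mathrm dB=\int_0^tg\,\mathrm dB^1+\mathrm i\int_0^tg\,\mathrm dB^2$ (Riemann–Stieltjes integrals). $E_{a,b}(z)=\sum_{k\ge0}z^k/\Gamma(ak+b)$ is the generalized Mittag-Leffler function. $\psi(-\Delta^* )$ acts on tangent fields by $\psi(-\Delta^* )\mathbf y_{\ell,m}=\psi(\lambda_\ell)\mathbf y_{\ell,m}$, $\psi(-\Delta^* )\mathbf z_{\ell,m}=\psi(\lambda_\ell)\mathbf z_{\ell,m}$, and $\frac{\partial^\beta}{\partial t^\beta}$ is the Caputo–Djrbashian derivative ($\partial/\partial t$ if $\beta=1$).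
   Formalization: The stochastic integrals are read as improper (at s=t) mean-square Riemann–Stieltjes integrals and are assumed to exist; for β+H≤1 their variance diverges unless all A_ℓ vanish, so there (in particular whenever τ>0) the claim covers only zero noise. *)

theory Defs
  imports "HOL-Probability.Probability"
begin

section \<open>The unit sphere, spherical harmonics and vector spherical harmonics\<close>

abbreviation S2 :: "(real^3) set" where
  "S2 \<equiv> sphere 0 1"

text \<open>Surface measure as the cone measure: for Borel \<open>A \<subseteq> S2\<close> its value is
  \<open>3 * vol {r *\<^sub>R a | r a. 0 < r \<and> r \<le> 1 \<and> a \<in> A}\<close>, which is the polar-coordinates
  characterisation of the area; the total mass is \<open>4 * pi\<close> (lemma below).\<close>

definition sphere_measure :: "(real^3) measure" where
  "sphere_measure =
     scale_measure 3
       (distr (restrict_space lborel (cball 0 1 - {0})) (restrict_space borel S2)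
              (\<lambda>x. x /\<^sub>R norm x))"

definition partial_deriv :: "3 \<Rightarrow> (real^3 \<Rightarrow> complex) \<Rightarrow> real^3 \<Rightarrow> complex" where
  "partial_deriv i f x = frechet_derivative f (at x) (axis i 1)"

definition gradient :: "(real^3 \<Rightarrow> complex) \<Rightarrow> real^3 \<Rightarrow> complex^3" where
  "gradient f x = (\<chi> i. partial_deriv i f x)"

definition laplacian :: "(real^3 \<Rightarrow> complex) \<Rightarrow> real^3 \<Rightarrow> complex" where
  "laplacian f x = (\<Sum>i\<in>UNIV. partial_deriv i (partial_deriv i f) x)"

text \<open>Only the values on the sphere of a function on the sphere are used below: before taking
  Euclidean derivatives it is extended to \<open>x \<noteq> 0\<close> as a function that is constant along rays.
  After multiplication by \<open>I - x x\<^sup>T\<close> or \<open>Q\<^sub>x\<close> the result is the same for every differentiable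
  extension, since both matrices annihilate \<open>x\<close>.\<close>

definition radial_extension :: "(real^3 \<Rightarrow> complex) \<Rightarrow> real^3 \<Rightarrow> complex" where
  "radial_extension f x = f (x /\<^sub>R norm x)"

definition tangent_projection :: "real^3 \<Rightarrow> real^3^3" where
  "tangent_projection x = mat 1 - (\<chi> i j. x$i * x$j)"

definition cross_matrix :: "real^3 \<Rightarrow> real^3^3" where
  "cross_matrix x =
     vector [vector [0, - x$3, x$2],
             vector [x$3, 0, - x$1],
             vector [- x$2, x$1, 0]]"

definition surface_gradient :: "(real^3 \<Rightarrow> complex) \<Rightarrow> real^3 \<Rightarrow> complex^3" where
  "surface_gradient f x =
     map_matrix complex_of_real (tangent_projection x) *v gradient (radial_extension f) x"

definition surface_curl :: "(real^3 \<Rightarrow> complex) \<Rightarrow> real^3 \<Rightarrow> complex^3" where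
  "surface_curl f x =
     map_matrix complex_of_real (cross_matrix x) *v gradient (radial_extension f) x"

text \<open>Complex spherical harmonics of degree \<open>\<ell>\<close>: restrictions to the sphere of harmonic
  homogeneous polynomials of degree \<open>\<ell>\<close>.  They are the eigenfunctions of the Laplace-Beltrami
  operator for the eigenvalue \<open>- eigval \<ell>\<close>.\<close>

definition spherical_harmonic :: "nat \<Rightarrow> (real^3 \<Rightarrow> complex) \<Rightarrow> bool" where
  "spherical_harmonic l f \<longleftrightarrow>
     (\<exists>p. polynomial_function p \<and>
          (\<forall>c x. p (c *\<^sub>R x) = c ^ l *\<^sub>R p x) \<and>
          (\<forall>x. laplacian p x = 0) \<and>
          (\<forall>x\<in>S2. f x = p x))"

definition eigval :: "nat \<Rightarrow> real" where
  "eigval l = real l * (real l + 1)"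

definition square_integrable ::
  "'a measure \<Rightarrow> ('a \<Rightarrow> 'b::{second_countable_topology,banach}) \<Rightarrow> bool" where
  "square_integrable M f \<longleftrightarrow>
     f \<in> borel_measurable M \<and> integrable M (\<lambda>x. (norm (f x))\<^sup>2)"

definition L2_inner_S2 :: "(real^3 \<Rightarrow> complex) \<Rightarrow> (real^3 \<Rightarrow> complex) \<Rightarrow> complex" where
  "L2_inner_S2 f g = (\<integral>x. f x * cnj (g x) \<partial>sphere_measure)"

text \<open>\<open>Y l m\<close> is only relevant for \<open>\<bar>m\<bar> \<le> l\<close>.\<close>

definition spherical_harmonic_basis :: "(nat \<Rightarrow> int \<Rightarrow> real^3 \<Rightarrow> complex) \<Rightarrow> bool" where
  "spherical_harmonic_basis Y \<longleftrightarrow>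
     (\<forall>l m. \<bar>m\<bar> \<le> int l \<longrightarrow> spherical_harmonic l (Y l m)) \<and>
     (\<forall>l m l' m'. \<bar>m\<bar> \<le> int l \<longrightarrow> \<bar>m'\<bar> \<le> int l' \<longrightarrow>
        L2_inner_S2 (Y l m) (Y l' m') = (if l = l' \<and> m = m' then 1 else 0)) \<and>
     (\<forall>f. square_integrable sphere_measure f \<longrightarrow>
        (\<lambda>N. \<integral>x. (norm (f x - (\<Sum>l\<le>N. \<Sum>m=-int l..int l.
                           L2_inner_S2 f (Y l m) * Y l m x)))\<^sup>2 \<partial>sphere_measure) \<longlonglongrightarrow> 0)"

definition vsh_y :: "(nat \<Rightarrow> int \<Rightarrow> real^3 \<Rightarrow> complex) \<Rightarrow> nat \<Rightarrow> int \<Rightarrow> real^3 \<Rightarrow> complex^3" where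
  "vsh_y Y l m x = surface_curl (Y l m) x /\<^sub>R sqrt (eigval l)"

definition vsh_z :: "(nat \<Rightarrow> int \<Rightarrow> real^3 \<Rightarrow> complex) \<Rightarrow> nat \<Rightarrow> int \<Rightarrow> real^3 \<Rightarrow> complex^3" where
  "vsh_z Y l m x = surface_gradient (Y l m) x /\<^sub>R sqrt (eigval l)"


section \<open>Fractional Brownian motions\<close>

text \<open>Degenerate Gaussian variables are allowed, so that the variances \<open>A\<close> may vanish.\<close>

definition centred_gaussian_rv :: "'w measure \<Rightarrow> ('w \<Rightarrow> real) \<Rightarrow> bool" where
  "centred_gaussian_rv P X \<longleftrightarrow>
     X \<in> borel_measurable P \<and>
     ((AE \<omega> in P. X \<omega> = 0) \<or>
      (\<exists>\<sigma>>0. distributed P lborel X (\<lambda>x. ennreal (normal_density 0 \<sigma> x))))"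

definition centred_gaussian_process :: "'w measure \<Rightarrow> (real \<Rightarrow> 'w \<Rightarrow> real) \<Rightarrow> bool" where
  "centred_gaussian_process P B \<longleftrightarrow>
     (\<forall>F c. finite F \<longrightarrow> F \<subseteq> {0..} \<longrightarrow> centred_gaussian_rv P (\<lambda>\<omega>. \<Sum>s\<in>F. c s * B s \<omega>))"

definition real_fBm :: "'w measure \<Rightarrow> real \<Rightarrow> real \<Rightarrow> (real \<Rightarrow> 'w \<Rightarrow> real) \<Rightarrow> bool" where
  "real_fBm P H A B \<longleftrightarrow>
     centred_gaussian_process P B \<and>
     (AE \<omega> in P. B 0 \<omega> = 0) \<and>
     (\<forall>s\<ge>0. \<forall>t\<ge>0. (\<integral>\<omega>. (B t \<omega> - B s \<omega>)\<^sup>2 \<partial>P) = A * \<bar>t - s\<bar> powr (2 * H))"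

definition sample_path :: "(real \<Rightarrow> 'w \<Rightarrow> 'b) \<Rightarrow> 'w \<Rightarrow> real \<Rightarrow> 'b" where
  "sample_path B \<omega> = (\<lambda>t\<in>{0..}. B t \<omega>)"

abbreviation path_space :: "(real \<Rightarrow> 'b::topological_space) measure" where
  "path_space \<equiv> Pi\<^sub>M {0..} (\<lambda>_. borel)"

definition complex_fBm :: "'w measure \<Rightarrow> real \<Rightarrow> real \<Rightarrow> (real \<Rightarrow> 'w \<Rightarrow> complex) \<Rightarrow> bool" where
  "complex_fBm P H A B \<longleftrightarrow>
     real_fBm P H A (\<lambda>t \<omega>. Re (B t \<omega>)) \<and>
     real_fBm P H A (\<lambda>t \<omega>. Im (B t \<omega>)) \<and>
     prob_space.indep_var P path_space (sample_path (\<lambda>t \<omega>. Re (B t \<omega>)))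
                            path_space (sample_path (\<lambda>t \<omega>. Im (B t \<omega>)))"

text \<open>The two families are jointly independent, as processes.\<close>

definition fBm_families ::
  "'w measure \<Rightarrow> real \<Rightarrow> (nat \<Rightarrow> real) \<Rightarrow> (nat \<Rightarrow> real) \<Rightarrow>
   (nat \<Rightarrow> int \<Rightarrow> real \<Rightarrow> 'w \<Rightarrow> complex) \<Rightarrow> (nat \<Rightarrow> int \<Rightarrow> real \<Rightarrow> 'w \<Rightarrow> complex) \<Rightarrow> bool" where
  "fBm_families P H A1 A2 Bh Bt \<longleftrightarrow>
     (\<forall>l\<ge>1. \<forall>m. \<bar>m\<bar> \<le> int l \<longrightarrow>
        complex_fBm P H (A1 l) (Bh l m) \<and> complex_fBm P H (A2 l) (Bt l m)) \<and>
     prob_space.indep_vars P (\<lambda>_. path_space)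
       (case_sum (\<lambda>(l, m). sample_path (Bh l m)) (\<lambda>(l, m). sample_path (Bt l m)))
       ({(l, m). 1 \<le> l \<and> \<bar>m\<bar> \<le> int l} <+> {(l, m). 1 \<le> l \<and> \<bar>m\<bar> \<le> int l})"


section \<open>Stochastic integrals of deterministic functions\<close>

text \<open>Riemann-Stieltjes integral over \<open>{a..b}\<close>: the limit in mean square of the
  Riemann-Stieltjes sums as the mesh tends to 0, over all tagged partitions.  Mean-square limits
  are used because a process given by its finite-dimensional distributions need not have
  continuous paths.\<close>

definition has_RS_integral ::
  "'w measure \<Rightarrow> (real \<Rightarrow> real) \<Rightarrow> (real \<Rightarrow> 'w \<Rightarrow> real) \<Rightarrow> real \<Rightarrow> real \<Rightarrow> ('w \<Rightarrow> real) \<Rightarrow> bool" where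
  "has_RS_integral P g B a b J \<longleftrightarrow>
     square_integrable P J \<and>
     (\<forall>e>0. \<exists>d>0. \<forall>p. p tagged_division_of {a..b} \<and> (\<lambda>x. ball x d) fine p \<longrightarrow>
        (\<integral>\<omega>. ((\<Sum>(x, K)\<in>p. g x * (B (Sup K) \<omega> - B (Inf K) \<omega>)) - J \<omega>)\<^sup>2 \<partial>P) < e)"

text \<open>Integral over \<open>{0..t}\<close> of an integrand that may be unbounded at \<open>t\<close>: the kernel
  \<open>(t - s) powr (\<beta> - 1) * \<dots>\<close> is, for \<open>\<beta> < 1\<close>, and then the Riemann-Stieltjes sums over
  \<open>{0..t}\<close> themselves have no limit.  If the integral over \<open>{0..t}\<close> is proper and \<open>B\<close> is a
  fractional Brownian motion, both notions agree.\<close>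

definition has_improper_RS_integral ::
  "'w measure \<Rightarrow> (real \<Rightarrow> real) \<Rightarrow> (real \<Rightarrow> 'w \<Rightarrow> real) \<Rightarrow> real \<Rightarrow> ('w \<Rightarrow> real) \<Rightarrow> bool" where
  "has_improper_RS_integral P g B t I \<longleftrightarrow>
     square_integrable P I \<and>
     (\<exists>J. (\<forall>u\<in>{0..<t}. has_RS_integral P g B 0 u (J u)) \<and>
          ((\<lambda>u. \<integral>\<omega>. (J u \<omega> - I \<omega>)\<^sup>2 \<partial>P) \<longlongrightarrow> 0) (at_left t))"

definition has_stochastic_integral ::
  "'w measure \<Rightarrow> (real \<Rightarrow> real) \<Rightarrow> (real \<Rightarrow> 'w \<Rightarrow> complex) \<Rightarrow> real \<Rightarrow> ('w \<Rightarrow> complex) \<Rightarrow> bool" where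
  "has_stochastic_integral P g B t I \<longleftrightarrow>
     has_improper_RS_integral P g (\<lambda>s \<omega>. Re (B s \<omega>)) t (\<lambda>\<omega>. Re (I \<omega>)) \<and>
     has_improper_RS_integral P g (\<lambda>s \<omega>. Im (B s \<omega>)) t (\<lambda>\<omega>. Im (I \<omega>))"

definition mittag_leffler :: "real \<Rightarrow> real \<Rightarrow> real \<Rightarrow> real" where
  "mittag_leffler a b z = (\<Sum>k. z ^ k / Gamma (a * real k + b))"

definition psi :: "real \<Rightarrow> real \<Rightarrow> real \<Rightarrow> real" where
  "psi \<alpha> \<gamma> s = s powr (\<alpha> / 2) * (1 + s) powr (\<gamma> / 2)"

definition ml_kernel :: "real \<Rightarrow> real \<Rightarrow> real \<Rightarrow> real \<Rightarrow> real" where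
  "ml_kernel \<beta> c t s =
     (t - s) powr (\<beta> - 1) * mittag_leffler \<beta> \<beta> (- ((t - s) powr \<beta> * c))"


section \<open>Random tangent fields\<close>

definition dotc :: "complex^3 \<Rightarrow> complex^3 \<Rightarrow> complex" where
  "dotc a b = (\<Sum>i\<in>UNIV. a$i * cnj (b$i))"

text \<open>The modulus \<open>sqrt (dotc a a)\<close> of a vector in \<open>complex^3\<close> is its library \<open>norm\<close>.\<close>

definition L2_random_tangent_field :: "'w measure \<Rightarrow> ('w \<Rightarrow> real^3 \<Rightarrow> complex^3) \<Rightarrow> bool" where
  "L2_random_tangent_field P f \<longleftrightarrow>
     square_integrable (P \<Otimes>\<^sub>M sphere_measure) (\<lambda>(\<omega>, x). f \<omega> x) \<and>
     (AE \<omega> in P. AE x in sphere_measure. dotc (f \<omega> x) (\<chi> i. complex_of_real (x$i)) = 0)"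

definition L2_field_norm :: "'w measure \<Rightarrow> ('w \<Rightarrow> real^3 \<Rightarrow> complex^3) \<Rightarrow> real" where
  "L2_field_norm P f = sqrt (\<integral>\<omega>. (\<integral>x. (norm (f \<omega> x))\<^sup>2 \<partial>sphere_measure) \<partial>P)"

definition truncated_field ::
  "(nat \<Rightarrow> int \<Rightarrow> real^3 \<Rightarrow> complex) \<Rightarrow>
   (nat \<Rightarrow> int \<Rightarrow> 'w \<Rightarrow> complex) \<Rightarrow> (nat \<Rightarrow> int \<Rightarrow> 'w \<Rightarrow> complex) \<Rightarrow>
   nat \<Rightarrow> 'w \<Rightarrow> real^3 \<Rightarrow> complex^3" where
  "truncated_field Y Ih It L \<omega> x =
     (\<Sum>l=1..L. \<Sum>m=-int l..int l. Ih l m \<omega> *s vsh_y Y l m x + It l m \<omega> *s vsh_z Y l m x)"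

text \<open>\<open>X\<close> is the sum of the series with partial sums \<open>S L\<close>, with convergence in
  \<open>L\<^sub>2(\<Omega> \<times> S2)\<close> and, at every single point of the sphere, in \<open>L\<^sub>2(\<Omega>)\<close>.  The second clause selects
  the version of the field for which \<open>X \<omega> x\<close> is meaningful at a fixed \<open>x\<close>.\<close>

definition is_field_sum ::
  "'w measure \<Rightarrow> (nat \<Rightarrow> 'w \<Rightarrow> real^3 \<Rightarrow> complex^3) \<Rightarrow> ('w \<Rightarrow> real^3 \<Rightarrow> complex^3) \<Rightarrow> bool" where
  "is_field_sum P S X \<longleftrightarrow>
     L2_random_tangent_field P X \<and>
     (\<lambda>L. L2_field_norm P (\<lambda>\<omega> x. X \<omega> x - S L \<omega> x)) \<longlonglongrightarrow> 0 \<and>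
     (\<forall>x\<in>S2. square_integrable P (\<lambda>\<omega>. X \<omega> x) \<and>
        (\<lambda>L. \<integral>\<omega>. (norm (X \<omega> x - S L \<omega> x))\<^sup>2 \<partial>P) \<longlonglongrightarrow> 0)"


section \<open>Checks of the conventions\<close>

lemma emeasure_sphere_measure: "emeasure sphere_measure S2 = ennreal (4 * pi)"
proof -
  let ?M = "restrict_space lborel (cball 0 1 - {0}) :: (real^3) measure"
  let ?f = "\<lambda>x::real^3. x /\<^sub>R norm x"
  have m: "?f \<in> ?M \<rightarrow>\<^sub>M restrict_space borel S2"
    by (rule measurable_restrict_space2)
       (auto simp: space_restrict_space intro!: measurable_restrict_space1)
  have pre: "?f -` S2 \<inter> (cball 0 1 - {0}) = cball 0 1 - {0}"
    by auto
  have S: "S2 \<in> sets (restrict_space borel S2)"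
    using sets.top[of "restrict_space borel S2"] by (simp add: space_restrict_space)
  have "emeasure ?M (cball 0 1 - {0}) = emeasure lborel (cball (0::real^3) 1 - {0})"
    by (subst emeasure_restrict_space) auto
  also have "\<dots> = emeasure lborel (cball (0::real^3) 1) - emeasure lborel {0::real^3}"
    by (rule emeasure_Diff) auto
  also have "\<dots> = ennreal (4 / 3 * pi)"
    by (simp add: emeasure_cball unit_ball_vol_3)
  finally show ?thesis
    unfolding sphere_measure_def
    by (simp add: emeasure_distr[OF m S] space_restrict_space pre flip: ennreal_numeral ennreal_mult)
qed

lemma norm_eq_sqrt_dotc: "complex_of_real ((norm a)\<^sup>2) = dotc a a"
  unfolding dotc_def norm_vec_def L2_set_def
  by (simp add: sum_nonneg flip: complex_norm_square)

end

theory Submission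
  imports Defs
begin

text \<open>Everything reduces to a pointwise estimate of the second moment of
  \<open>X\<^sub>N(t, x) - X\<^sub>L(t, x)\<close>, uniform in \<open>x\<close> and \<open>N\<close>. Different coefficients are orthogonal in
  \<open>L\<^sub>2(\<Omega>)\<close>, so two bounds are needed.

  The variance of a coefficient is at most a constant times \<open>A\<^sub>\<ell>\<close>. Since \<open>H \<ge> 1/2\<close>, increments of
  a fractional Brownian motion are nonnegatively correlated, so the variance is monotone in the
  modulus of the integrand. Positivity of \<open>E\<^sub>\<beta>\<^sub>,\<^sub>\<beta>\<close> on the negative axis gives
  \<open>0 \<le> E\<^sub>\<beta>\<^sub>,\<^sub>\<beta> \<le> 1 / \<Gamma>(\<beta>)\<close> there, which leaves the kernel \<open>(t - s)\<^sup>\<beta>\<^sup>-\<^sup>1\<close>. Over the dyadic blocks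
  approaching \<open>t\<close> it yields a geometric series that converges for \<open>\<beta> + H > 1\<close>, and then \<open>\<tau> = 0\<close>.
  For \<open>\<beta> + H \<le> 1\<close> the same blocks bound the variance from below by a divergent series, so that the
  integral can exist only if \<open>A\<^sub>\<ell> = 0\<close>.

  The sums of \<open>|\<^bold>y\<^sub>\<ell>\<^sub>,\<^sub>m(x)|\<^sup>2\<close> and of \<open>|\<^bold>z\<^sub>\<ell>\<^sub>,\<^sub>m(x)|\<^sup>2\<close> over \<open>m\<close> are at most a constant times
  \<open>2\<ell> + 1\<close>. By completeness of the basis and orthogonality of different degrees, the \<open>Y\<^sub>\<ell>\<^sub>,\<^sub>m\<close>
  span the whole rotation-invariant space of harmonics of degree \<open>\<ell>\<close>, so the sum of
  \<open>|Y\<^sub>\<ell>\<^sub>,\<^sub>m|\<^sup>2\<close> is constant on the sphere. Applying the Euclidean Laplacian to its homogeneous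
  extension gives the sum of the squared gradients.\<close>

text \<open>The estimates carry the weight
  \<open>psi \<alpha> \<gamma> (eigval l) powr \<tau>\<close>, whereas the variance bound is free of
  \<psi>. The two meet because \<tau> = 0 when \<beta> + H > 1, while for \<beta> + H \<le> 1 both
  the variances and the weighted variances vanish. In either case A_l \<le> w(l), so a single tail
  of \<open>w\<close> controls every error.

  The integrals are known only as mean-square limits of Riemann-Stieltjes sums. What passes to such
  limits is an inequality between second moments of sums, and these second moments are quadratic
  forms whose coefficients are covariances of increments. For H \<ge> 1/2 convexity of the power 2H
  makes all coefficients nonnegative, which gives upper and lower bounds alike.

  On the sphere the obstacle is that \<open>Y\<close> is an arbitrary basis, without formulas, and
  prescribed only on the sphere. It is replaced by polynomial representatives, so that an identity
  valid on all of space can be differentiated.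

  The error in L2 over the sphere is the pointwise one integrated over area 4 pi; the probability
  bound is Markov's inequality for the squared error.\<close>

section \<open>The Mittag-Leffler kernel\<close>

text \<open>Only the part of Euler's integral over [T, T + 1] is kept. Since T is free, Gamma
  outgrows every geometric sequence, which makes the Mittag-Leffler series converge
  everywhere.\<close>

lemma Gamma_lower_bound:
  fixes a T :: real
  assumes "a \<ge> 1" "T > 0"
  shows "T powr (a - 1) * exp (- (T + 1)) \<le> Gamma a"
proof -
  have 1: "((\<lambda>t. t powr (a - 1) / exp t) has_integral Gamma a) {0..}"
    using assms by (intro Gamma_integral_real) auto
  have 2: "((\<lambda>t. T powr (a - 1) / exp (T + 1)) has_integral (T powr (a - 1) / exp (T + 1))) {T..T+1}"
    using has_integral_const_real[of "T powr (a - 1) / exp (T + 1)" T "T+1"] by simp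
  have 3: "((\<lambda>t. if t \<in> {T..T+1} then T powr (a - 1) / exp (T + 1) else 0) has_integral (T powr (a - 1) / exp (T + 1))) {0..}"
    using 2 assms by (subst has_integral_restrict) auto
  have "T powr (a - 1) / exp (T + 1) \<le> Gamma a"
  proof (rule has_integral_le[OF 3 1])
    fix t :: real assume "t \<in> {0..}"
    show "(if t \<in> {T..T+1} then T powr (a - 1) / exp (T + 1) else 0) \<le> t powr (a - 1) / exp t"
      using assms by (auto intro!: frac_le powr_mono2)
  qed
  then show ?thesis by (simp only: exp_minus divide_inverse)
qed

lemma summable_mittag_leffler:
  fixes \<beta> x :: real
  assumes \<beta>: "0 < \<beta>"
  shows "summable (\<lambda>k. x ^ k / Gamma (\<beta> * real k + \<beta>))"
proof -
  \<comment> \<open>T is chosen with \<open>T powr \<beta> = q\<close>, so that the k-th denominator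
    is at least a fixed multiple of \<open>q ^ k\<close> and the terms decay with ratio |x| / q <
    1/2; the summand 1 keeps q positive at x = 0.\<close>
  define q where "q = 2 * \<bar>x\<bar> + 1"
  define T where "T = q powr (1 / \<beta>)"
  have q: "q > 0" "\<bar>x\<bar> / q < 1" unfolding q_def by (auto simp: field_simps)
  have T: "T > 0" using q by (simp add: T_def)
  have Tk: "T powr (\<beta> * real k) = q ^ k" for k
    using q \<beta> by (simp add: T_def powr_powr powr_realpow)
  obtain K :: nat where K: "1 / \<beta> \<le> real K" using real_arch_simple by blast
  have "norm (x ^ k / Gamma (\<beta> * real k + \<beta>)) \<le> exp (T + 1) * T powr (1 - \<beta>) * (\<bar>x\<bar> / q) ^ k"
    if "k \<ge> K" for k
  proof -
    have "1 / \<beta> \<le> real k" using K that by linarith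
    then have "1 \<le> \<beta> * real k" using \<beta> by (simp add: field_simps)
    then have a: "\<beta> * real k + \<beta> \<ge> 1" using \<beta> by linarith
    have lb: "q ^ k * T powr (\<beta> - 1) * exp (- (T + 1)) \<le> Gamma (\<beta> * real k + \<beta>)"
      using Gamma_lower_bound[OF a T] by (simp add: powr_add add_diff_eq[symmetric] Tk)
    have pos: "0 < q ^ k * T powr (\<beta> - 1) * exp (- (T + 1))" using q T by auto
    have "norm (x ^ k / Gamma (\<beta> * real k + \<beta>)) = \<bar>x\<bar> ^ k / Gamma (\<beta> * real k + \<beta>)"
      using Gamma_real_pos[of "\<beta> * real k + \<beta>"] a by (simp add: power_abs)
    also have "\<dots> \<le> \<bar>x\<bar> ^ k / (q ^ k * T powr (\<beta> - 1) * exp (- (T + 1)))"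
      using lb pos by (intro divide_left_mono) (auto intro!: mult_pos_pos)
    also have "\<dots> = exp (T + 1) * T powr (1 - \<beta>) * (\<bar>x\<bar> / q) ^ k"
      using q T by (simp add: power_divide powr_diff exp_minus exp_diff exp_add field_simps)
    finally show ?thesis .
  qed
  then have "\<forall>\<^sub>F k in sequentially. norm (x ^ k / Gamma (\<beta> * real k + \<beta>)) \<le> exp (T + 1) * T powr (1 - \<beta>) * (\<bar>x\<bar> / q) ^ k"
    unfolding eventually_sequentially by blast
  moreover have "summable (\<lambda>k. exp (T + 1) * T powr (1 - \<beta>) * (\<bar>x\<bar> / q) ^ k)"
    using q by (intro summable_mult summable_geometric) auto
  ultimately show ?thesis
    by (rule summable_comparison_test_ev)
qed

lemma isCont_mittag_leffler:
  assumes "0 < \<beta>"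
  shows "isCont (mittag_leffler \<beta> \<beta>) z"
proof -
  have "summable (\<lambda>k. inverse (Gamma (\<beta> * real k + \<beta>)) * y ^ k)" for y
    using summable_mittag_leffler[OF assms, of y] by (simp add: divide_inverse mult.commute)
  then have "isCont (\<lambda>z. \<Sum>k. inverse (Gamma (\<beta> * real k + \<beta>)) * z ^ k) z"
    by (rule isCont_powser_converges_everywhere)
  then show ?thesis
    by (simp add: mittag_leffler_def[abs_def] divide_inverse mult.commute)
qed

lemma mittag_leffler_0: "mittag_leffler \<beta> b 0 = 1 / Gamma b"
  unfolding mittag_leffler_def by (subst suminf_finite[of "{0}"]) auto

section \<open>The Volterra equation of the kernel, its positivity and two-sided bounds\<close>

lemma has_integral_Beta_scaled:
  fixes a b r :: real
  assumes "a > 0" "b > 0" "r > 0"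
  shows "((\<lambda>s. (r - s) powr (a - 1) * s powr (b - 1)) has_integral Beta a b * r powr (a + b - 1)) {0..r}"
proof -
  have "((\<lambda>t. t powr (b - 1) * (1 - t) powr (a - 1)) has_integral Beta b a) (cbox 0 1)"
    using has_integral_Beta_real[of b a] assms by simp
  from has_integral_affinity[OF this, of "1/r" 0] assms
  have "((\<lambda>s. (s / r) powr (b - 1) * (1 - s / r) powr (a - 1)) has_integral r * Beta b a) ((\<lambda>x. r * x) ` {0..1})"
    by (simp add: divide_inverse mult.commute)
  also have "(\<lambda>x. r * x) ` {0..1} = {0..r}"
    using assms by (auto simp: image_iff field_simps intro!: bexI[of _ "_ / r"])
  finally have "((\<lambda>s. r powr (a + b - 2) * ((s / r) powr (b - 1) * (1 - s / r) powr (a - 1))) has_integral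
      r powr (a + b - 2) * (r * Beta b a)) {0..r}"
    by (rule has_integral_mult_right)
  also have "r powr (a + b - 2) * (r * Beta b a) = Beta a b * r powr (a + b - 1)"
    using assms powr_add[of r "a+b-2" 1] by (simp add: Beta_commute)
  finally show ?thesis
  proof (rule has_integral_eq[rotated])
    fix s assume s: "s \<in> {0..r}"
    have 1: "1 - s / r = (r - s) / r" using assms by (simp add: field_simps)
    have 2: "r powr (a + b - 2) = r powr (a - 1) * r powr (b - 1)" by (simp flip: powr_add)
    show "r powr (a + b - 2) * ((s / r) powr (b - 1) * (1 - s / r) powr (a - 1)) = (r - s) powr (a - 1) * s powr (b - 1)"
      unfolding 1 2 using assms s by (subst (1 2) powr_divide) auto
  qed
qed

text \<open>The resolvent equation: \<open>v s = s powr (\<beta> - 1) * mittag_leffler \<beta> \<beta> (- (s powr \<beta>))\<close> solves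
  \<open>v + k * v = k\<close> for the kernel \<open>k s = s powr (\<beta> - 1) / Gamma \<beta>\<close>.\<close>

lemma mittag_leffler_Volterra:
  fixes \<beta> r :: real
  assumes \<beta>: "0 < \<beta>" and r: "0 < r"
  shows "((\<lambda>s. (r - s) powr (\<beta> - 1) * (s powr (\<beta> - 1) * mittag_leffler \<beta> \<beta> (- (s powr \<beta>))))
    has_integral r powr (\<beta> - 1) * (1 - Gamma \<beta> * mittag_leffler \<beta> \<beta> (- (r powr \<beta>)))) {0..r}"
proof -
  define K where "K = (\<lambda>s. (r - s) powr (\<beta> - 1) * s powr (\<beta> - 1))"
  define G where "G = (\<lambda>k. Gamma (\<beta> * real k + \<beta>))"
  have Gpos: "G k > 0" for k unfolding G_def using \<beta> by (intro Gamma_real_pos) (simp add: add_nonneg_pos)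
  define f where "f = (\<lambda>N s. K s * (\<Sum>k<N. (- (s powr \<beta>)) ^ k / G k))"
  define M where "M = (\<Sum>k. (r powr \<beta>) ^ k / G k)"
  have sM: "summable (\<lambda>k. x ^ k / G k)" for x
    unfolding G_def by (rule summable_mittag_leffler[OF \<beta>])
  \<comment> \<open>The Beta function trades \<open>G k\<close> for \<open>G (Suc k)\<close>:
    convolution turns each term of the series into a fixed multiple of the next one, so the integral
    is the series without its head.\<close>
  have summand: "((\<lambda>s. K s * ((- (s powr \<beta>)) ^ k / G k)) has_integral
      - Gamma \<beta> * r powr (\<beta> - 1) * ((- (r powr \<beta>)) ^ Suc k / G (Suc k))) {0..r}" for k
  proof -
    have p: "\<beta> * real k + \<beta> > 0" using \<beta> by (simp add: add_nonneg_pos)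
    have "((\<lambda>s. ((-1) ^ k / G k) * ((r - s) powr (\<beta> - 1) * s powr (\<beta> * real k + \<beta> - 1))) has_integral
        ((-1) ^ k / G k) * (Beta \<beta> (\<beta> * real k + \<beta>) * r powr (\<beta> + (\<beta> * real k + \<beta>) - 1))) {0..r}"
      by (rule has_integral_mult_right, rule has_integral_Beta_scaled[OF \<beta> p r])
    also have "((-1) ^ k / G k) * (Beta \<beta> (\<beta> * real k + \<beta>) * r powr (\<beta> + (\<beta> * real k + \<beta>) - 1)) =
       - Gamma \<beta> * r powr (\<beta> - 1) * ((- (r powr \<beta>)) ^ Suc k / G (Suc k))"
    proof -
      have "(r powr \<beta>) ^ Suc k = r powr (\<beta> * real k + \<beta>)"
        using r by (simp add: powr_realpow[symmetric] powr_powr powr_add)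
      then have A: "r powr (\<beta> + (\<beta> * real k + \<beta>) - 1) = r powr (\<beta> - 1) * (r powr \<beta>) ^ Suc k"
        using powr_add[of r "\<beta> - 1" "\<beta> * real k + \<beta>"] by (simp add: algebra_simps)
      have "Beta \<beta> (\<beta> * real k + \<beta>) = Gamma \<beta> * G k / G (Suc k)"
        unfolding Beta_def G_def by (simp add: algebra_simps)
      then show ?thesis unfolding A power_minus[of "r powr \<beta>"] using Gpos[of k] by simp
    qed
    finally show ?thesis
    proof (rule has_integral_eq[rotated])
      fix s assume "s \<in> {0..r}"
      have "s powr (\<beta> - 1) * (s powr \<beta>) ^ k = s powr (\<beta> * real k + \<beta> - 1)"
      proof (cases "s = 0")
        case False
        then have "s > 0" using \<open>s \<in> {0..r}\<close> by auto
        then show ?thesis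
          using powr_add[of s "\<beta> - 1" "\<beta> * real k"]
          by (simp add: powr_realpow[symmetric] powr_powr algebra_simps)
      qed auto
      then show "((-1) ^ k / G k) * ((r - s) powr (\<beta> - 1) * s powr (\<beta> * real k + \<beta> - 1)) = K s * ((- (s powr \<beta>)) ^ k / G k)"
        
        unfolding K_def power_minus[of "s powr \<beta>"] by (simp flip: \<open>s powr (\<beta> - 1) * (s powr \<beta>) ^ k = s powr (\<beta> * real k + \<beta> - 1)\<close>)
    qed
  qed
  have fN: "(f N has_integral (\<Sum>k<N. - Gamma \<beta> * r powr (\<beta> - 1) * ((- (r powr \<beta>)) ^ Suc k / G (Suc k)))) {0..r}" for N
    unfolding f_def sum_distrib_left by (intro has_integral_sum summand) auto
  have Kint: "K integrable_on {0..r}"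
    unfolding K_def using has_integral_Beta_scaled[OF \<beta> \<beta> r] by blast
  have K0: "K s \<ge> 0" for s unfolding K_def by simp
  \<comment> \<open>The terms alternate in sign, so the exchange of sum and integral rests on a
    majorant: the series of absolute values at r times the integrable Beta kernel.\<close>
  have dom: "norm (f N s) \<le> M * K s" if "s \<in> {0..r}" for N s
  proof -
    have "s powr \<beta> \<le> r powr \<beta>" using that \<beta> by (intro powr_mono2) auto
    then have "\<bar>\<Sum>k<N. (- (s powr \<beta>)) ^ k / G k\<bar> \<le> (\<Sum>k<N. (r powr \<beta>) ^ k / G k)"
      using Gpos by (intro order.trans[OF sum_abs] sum_mono)
        (auto simp: power_abs less_imp_le[OF Gpos] intro!: divide_right_mono power_mono)
    also have "\<dots> \<le> M"
      unfolding M_def by (rule sum_le_suminf[OF sM]) (auto simp: less_imp_le[OF Gpos])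
    finally show ?thesis unfolding f_def using K0[of s] by (simp add: abs_mult mult.commute[of M] mult_left_mono)
  qed
  define g where "g = (\<lambda>s. K s * mittag_leffler \<beta> \<beta> (- (s powr \<beta>)))"
  have lim: "(\<lambda>N. f N s) \<longlonglongrightarrow> g s" for s
    unfolding f_def g_def mittag_leffler_def G_def
    by (intro tendsto_mult_left summable_LIMSEQ summable_mittag_leffler[OF \<beta>])
  have dc: "g integrable_on {0..r}" "(\<lambda>N. integral {0..r} (f N)) \<longlonglongrightarrow> integral {0..r} g"
    using dominated_convergence[of f "{0..r}" "\<lambda>s. M * K s" g] fN dom lim integrable_on_mult_right[OF Kint]
    by (auto simp: has_integral_integrable_integral)
  have "(\<lambda>N. integral {0..r} (f N)) \<longlonglongrightarrow> (\<Sum>k. - Gamma \<beta> * r powr (\<beta> - 1) * ((- (r powr \<beta>)) ^ Suc k / G (Suc k)))"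
    unfolding fN[THEN integral_unique]
    by (intro summable_LIMSEQ summable_mult) (use sM[of "- (r powr \<beta>)"] in \<open>simp only: summable_Suc_iff[of "\<lambda>k. (- (r powr \<beta>)) ^ k / G k"]\<close>)
  then have "integral {0..r} g = (\<Sum>k. - Gamma \<beta> * r powr (\<beta> - 1) * ((- (r powr \<beta>)) ^ Suc k / G (Suc k)))"
    using dc(2) LIMSEQ_unique by blast
  also have "\<dots> = - Gamma \<beta> * r powr (\<beta> - 1) * (\<Sum>k. (- (r powr \<beta>)) ^ Suc k / G (Suc k))"
    by (rule suminf_mult) (use sM[of "- (r powr \<beta>)"] in \<open>simp only: summable_Suc_iff[of "\<lambda>k. (- (r powr \<beta>)) ^ k / G k"]\<close>)
  also have "(\<Sum>k. (- (r powr \<beta>)) ^ Suc k / G (Suc k)) = mittag_leffler \<beta> \<beta> (- (r powr \<beta>)) - 1 / Gamma \<beta>"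
    using suminf_split_head[OF sM[of "- (r powr \<beta>)"]] by (simp add: mittag_leffler_def G_def)
  also have "- Gamma \<beta> * r powr (\<beta> - 1) * (mittag_leffler \<beta> \<beta> (- (r powr \<beta>)) - 1 / Gamma \<beta>) =
      r powr (\<beta> - 1) * (1 - Gamma \<beta> * mittag_leffler \<beta> \<beta> (- (r powr \<beta>)))"
    using Gamma_real_pos[OF \<beta>] by (simp add: field_simps)
  finally have "(g has_integral r powr (\<beta> - 1) * (1 - Gamma \<beta> * mittag_leffler \<beta> \<beta> (- (r powr \<beta>)))) {0..r}"
    using dc(1) by (simp add: has_integral_integrable_integral)
  then show ?thesis unfolding g_def K_def by (simp add: mult.assoc)
qed

lemma continuous_on_mittag_leffler_powr:
  assumes "0 < \<beta>"
  shows "continuous_on {0..} (\<lambda>r. mittag_leffler \<beta> \<beta> (- (r powr \<beta>)))"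
proof (rule continuous_on_compose2[where g="mittag_leffler \<beta> \<beta>" and t=UNIV])
  show "continuous_on UNIV (mittag_leffler \<beta> \<beta>)"
    using isCont_mittag_leffler[OF assms] by (simp add: continuous_at_imp_continuous_on)
  show "continuous_on {0..} (\<lambda>r. - (r powr \<beta>))"
    by (intro continuous_intros continuous_on_powr') (use assms in auto)
qed auto

text \<open>At a first zero \<open>r0\<close> of \<open>v\<close>, log-convexity of the kernel makes the resolvent equation at
  \<open>r0\<close> incompatible with the one at a maximum point of \<open>v\<close> slightly to the left of \<open>r0\<close>.\<close>

lemma mittag_leffler_pos:
  fixes \<beta> x :: real
  assumes \<beta>: "0 < \<beta>" "\<beta> \<le> 1" and x: "0 \<le> x"
  shows "0 < mittag_leffler \<beta> \<beta> (- x)"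
proof (rule ccontr)
  assume neg: "\<not> 0 < mittag_leffler \<beta> \<beta> (- x)"
  define F where "F = (\<lambda>r. mittag_leffler \<beta> \<beta> (- (r powr \<beta>)))"
  define r1 where "r1 = x powr (1 / \<beta>)"
  have r1: "F r1 \<le> 0" "0 \<le> r1" using neg x \<beta> by (auto simp: F_def r1_def powr_powr)
  have contF: "continuous_on {0..} F"
    unfolding F_def by (rule continuous_on_mittag_leffler_powr[OF \<beta>(1)])
  have G: "Gamma \<beta> > 0" using \<beta> by (intro Gamma_real_pos)
  have F0: "F 0 > 0" using G by (simp add: F_def mittag_leffler_0)
  define S where "S = {r \<in> {0..r1}. F r \<le> 0}"
  have "closed ({0..r1} \<inter> F -` {..0})"
    by (rule continuous_closed_preimage) (auto intro: continuous_on_subset[OF contF])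
  then have "compact ({0..r1} \<inter> F -` {..0})"
    by (simp add: compact_eq_bounded_closed bounded_Int)
  moreover have "S = {0..r1} \<inter> F -` {..0}" by (auto simp: S_def)
  ultimately have "compact S" by simp
  moreover have "S \<noteq> {}" using r1 by (auto simp: S_def)
  ultimately obtain r0 where r0S: "r0 \<in> S" and r0min: "\<And>s. s \<in> S \<Longrightarrow> r0 \<le> s"
    using compact_attains_inf[of S] by auto
  have r0: "F r0 \<le> 0" "0 \<le> r0" "r0 \<le> r1" using r0S by (auto simp: S_def)
  have "r0 \<noteq> 0" using F0 r0 by auto
  then have r0p: "r0 > 0" using r0 by simp
  have Fpos: "F s > 0" if "0 \<le> s" "s < r0" for s
    using r0min[of s] that r0 by (force simp: S_def)
  \<comment> \<open>\<open>q\<close> is read off from the final inequality: the contradiction needs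
    exactly \<open>\<delta> powr \<beta> < q\<close>. The bound \<delta> \<le> r0 / 2 keeps t \<ge>
    r0 / 2, so that the negative power of t is controlled.\<close>
  define q where "q = r0 powr (\<beta> - 1) * Gamma \<beta> * \<beta> / ((r0 / 2) powr (\<beta> - 1))"
  have q: "q > 0" using r0p G \<beta> by (simp add: q_def)
  define \<delta> where "\<delta> = min (r0 / 2) ((q / 2) powr (1 / \<beta>))"
  have \<delta>: "\<delta> > 0" "\<delta> \<le> r0 / 2" using q r0p by (auto simp: \<delta>_def)
  have "\<delta> powr \<beta> \<le> ((q / 2) powr (1 / \<beta>)) powr \<beta>"
    using \<delta> \<beta> by (intro powr_mono2) (auto simp: \<delta>_def)
  then have \<delta>q: "\<delta> powr \<beta> < q" using q \<beta> by (simp add: powr_powr)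
  define v where "v = (\<lambda>s. s powr (\<beta> - 1) * F s)"
  have "continuous_on {r0 - \<delta>..r0} v" unfolding v_def
    by (intro continuous_intros continuous_on_subset[OF contF] continuous_on_powr) (use \<delta> r0p in auto)
  then obtain t where t: "t \<in> {r0 - \<delta>..r0}" and tmax: "\<And>s. s \<in> {r0 - \<delta>..r0} \<Longrightarrow> v s \<le> v t"
    using continuous_attains_sup[of "{r0 - \<delta>..r0}" v] \<delta> by auto
  have "0 < v (r0 - \<delta>)" using Fpos[of "r0 - \<delta>"] \<delta> r0p by (simp add: v_def)
  then have vt: "v t > 0" using tmax[of "r0 - \<delta>"] \<delta> by auto
  have "v r0 \<le> 0" using r0 by (simp add: v_def mult_nonneg_nonpos)
  then have tr: "t < r0" using vt t by (cases "t = r0") auto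
  have tp: "t > 0" "t \<ge> r0 / 2" using t \<delta> r0p by auto
  have Ft: "F t > 0" using Fpos tp tr by auto
  define h where "h = (\<lambda>s. (r0 - s) powr (\<beta> - 1) * v s)"
  have h: "(h has_integral r0 powr (\<beta> - 1) * (1 - Gamma \<beta> * F r0)) {0..r0}"
    unfolding h_def v_def F_def by (rule mittag_leffler_Volterra[OF \<beta>(1) r0p])
  then have hi: "h integrable_on {0..r0}" by blast
  have hint: "(h has_integral integral {0..t} h) {0..t}" "(h has_integral integral {t..r0} h) {t..r0}"
    using integrable_subinterval_real[OF hi, of 0 t] integrable_subinterval_real[OF hi, of t r0] tp tr
    by (auto simp: has_integral_integrable_integral)
  have "integral {0..t} h + integral {t..r0} h = integral {0..r0} h"
    using tp tr hi by (intro Henstock_Kurzweil_Integration.integral_combine) auto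
  also have "\<dots> = r0 powr (\<beta> - 1) * (1 - Gamma \<beta> * F r0)" using h by (rule integral_unique)
  also have "\<dots> \<ge> r0 powr (\<beta> - 1)"
  proof -
    have "0 \<le> r0 powr (\<beta> - 1) * (Gamma \<beta> * (- F r0))" using r0 G by (intro mult_nonneg_nonneg) auto
    then show ?thesis by (simp add: algebra_simps)
  qed
  finally have sum: "r0 powr (\<beta> - 1) \<le> integral {0..t} h + integral {t..r0} h" .
  \<comment> \<open>Since (r0 - s) / (t - s) is at least r0 / t, the kernel based at r0 is at most
    (r0 / t)^(\<beta> - 1) times the one based at t, and the resolvent equation at t evaluates the
    comparison integral.\<close>
  have i1: "integral {0..t} h \<le> r0 powr (\<beta> - 1) * (1 - Gamma \<beta> * F t)"
  proof -
    have "((\<lambda>s. (r0 / t) powr (\<beta> - 1) * ((t - s) powr (\<beta> - 1) * v s)) has_integral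
        (r0 / t) powr (\<beta> - 1) * (t powr (\<beta> - 1) * (1 - Gamma \<beta> * F t))) {0..t}"
      unfolding v_def F_def by (intro has_integral_mult_right mittag_leffler_Volterra[OF \<beta>(1) tp(1)])
    also have "(r0 / t) powr (\<beta> - 1) * (t powr (\<beta> - 1) * (1 - Gamma \<beta> * F t)) = r0 powr (\<beta> - 1) * (1 - Gamma \<beta> * F t)"
      using tp r0p by (simp add: powr_divide)
    finally have "((\<lambda>s. (r0 / t) powr (\<beta> - 1) * ((t - s) powr (\<beta> - 1) * v s)) has_integral
        r0 powr (\<beta> - 1) * (1 - Gamma \<beta> * F t)) {0..t}" .
    \<comment> \<open>At s = t the comparison function is 0 because of
      \<open>0 powr (\<beta> - 1) = 0\<close>, which would break the pointwise bound; hence the open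
      interval.\<close>
    with hint(1) show ?thesis unfolding has_integral_Icc_iff_Ioo
    proof (rule has_integral_le)
      fix s assume s: "s \<in> {0<..<t}"
      have "(r0 / t) * (t - s) \<le> r0 - s" using s tp tr by (simp add: field_simps)
      moreover have "0 < (r0 / t) * (t - s)" using s tp r0p by auto
      ultimately have "(r0 - s) powr (\<beta> - 1) \<le> ((r0 / t) * (t - s)) powr (\<beta> - 1)"
        using \<beta> by (intro powr_mono2') auto
      also have "\<dots> = (r0 / t) powr (\<beta> - 1) * (t - s) powr (\<beta> - 1)"
        using s tp r0p by (intro powr_mult)
      finally show "h s \<le> (r0 / t) powr (\<beta> - 1) * ((t - s) powr (\<beta> - 1) * v s)"
        unfolding h_def mult.assoc[symmetric] using Fpos[of s] s tr
        by (intro mult_right_mono) (auto simp: v_def)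
    qed
  qed
  \<comment> \<open>Maximality of v at t replaces v by a constant on the short interval.\<close>
  have i2: "integral {t..r0} h \<le> v t * ((r0 - t) powr \<beta> / \<beta>)"
  proof -
    have "((\<lambda>s. s powr (\<beta> - 1)) has_integral ((r0 - t) powr \<beta> / \<beta>)) (cbox 0 (r0 - t))"
      using has_integral_powr_from_0[of "\<beta> - 1" "r0 - t"] \<beta> tr by simp
    from has_integral_affinity[OF this, of "-1" r0]
    have "((\<lambda>s. (r0 - s) powr (\<beta> - 1)) has_integral ((r0 - t) powr \<beta> / \<beta>)) ((\<lambda>x. r0 - x) ` {0..r0 - t})"
      by simp
    also have "(\<lambda>x. r0 - x) ` {0..r0 - t} = {t..r0}" using tr by auto
    finally have "((\<lambda>s. v t * (r0 - s) powr (\<beta> - 1)) has_integral v t * ((r0 - t) powr \<beta> / \<beta>)) {t..r0}"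
      by (rule has_integral_mult_right)
    with hint(2) show ?thesis
    proof (rule has_integral_le)
      fix s assume s: "s \<in> {t..r0}"
      then have "v s \<le> v t" using t by (intro tmax) auto
      then show "h s \<le> v t * (r0 - s) powr (\<beta> - 1)"
        unfolding h_def by (simp add: mult.commute[of _ "v _"] mult_right_mono)
    qed
  qed
  \<comment> \<open>The terms free of F t cancel. Both remaining sides are multiples of F t > 0, and
    the one on the right is small because r0 - t \<le> \<delta>.\<close>
  have "r0 powr (\<beta> - 1) * Gamma \<beta> * F t \<le> v t * ((r0 - t) powr \<beta> / \<beta>)"
    using sum i1 i2 by (simp add: algebra_simps)
  then have "F t * (r0 powr (\<beta> - 1) * Gamma \<beta> * \<beta>) \<le> F t * (t powr (\<beta> - 1) * (r0 - t) powr \<beta>)"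
    using \<beta> by (simp add: v_def field_simps)
  then have "r0 powr (\<beta> - 1) * Gamma \<beta> * \<beta> \<le> t powr (\<beta> - 1) * (r0 - t) powr \<beta>"
    using Ft by (simp add: mult_le_cancel_left_pos)
  also have "\<dots> \<le> (r0 / 2) powr (\<beta> - 1) * \<delta> powr \<beta>"
    using tp r0p \<beta> t tr by (intro mult_mono powr_mono2 powr_mono2') auto
  also have "\<dots> < (r0 / 2) powr (\<beta> - 1) * q"
    using \<delta>q r0p by (intro mult_strict_left_mono) auto
  also have "\<dots> = r0 powr (\<beta> - 1) * Gamma \<beta> * \<beta>" using r0p by (simp add: q_def)
  finally show False by simp
qed

text \<open>By positivity the integrand of the resolvent equation is nonnegative, and its integral
  is a positive factor times 1 - Gamma(\<beta>) E(-x).\<close>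

lemma mittag_leffler_le:
  fixes \<beta> x :: real
  assumes \<beta>: "0 < \<beta>" "\<beta> \<le> 1" and x: "0 \<le> x"
  shows "mittag_leffler \<beta> \<beta> (- x) \<le> 1 / Gamma \<beta>"
proof (cases "x = 0")
  case False
  define r where "r = x powr (1 / \<beta>)"
  have r: "r > 0" "r powr \<beta> = x" using x False \<beta> by (auto simp: r_def powr_powr)
  have "0 \<le> r powr (\<beta> - 1) * (1 - Gamma \<beta> * mittag_leffler \<beta> \<beta> (- (r powr \<beta>)))"
    by (rule has_integral_nonneg[OF mittag_leffler_Volterra[OF \<beta>(1) r(1)]])
      (auto intro!: mult_nonneg_nonneg less_imp_le[OF mittag_leffler_pos[OF \<beta>]])
  then have "Gamma \<beta> * mittag_leffler \<beta> \<beta> (- x) \<le> 1"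
    using r by (simp add: zero_le_mult_iff)
  then show ?thesis using Gamma_real_pos[OF \<beta>(1)] by (simp add: field_simps)
qed (simp add: mittag_leffler_0)

lemma ml_kernel_bounds:
  assumes \<beta>: "0 < \<beta>" "\<beta> \<le> 1" and c: "0 \<le> c"
  shows "0 \<le> ml_kernel \<beta> c t s" "ml_kernel \<beta> c t s \<le> (t - s) powr (\<beta> - 1) / Gamma \<beta>"
  using mittag_leffler_pos[OF \<beta>, of "(t - s) powr \<beta> * c"] mittag_leffler_le[OF \<beta>, of "(t - s) powr \<beta> * c"] c
  unfolding ml_kernel_def by (auto simp: less_imp_le divide_inverse intro: mult_left_mono)

text \<open>E is continuous at 0 with value 1 / Gamma(\<beta>), half of which survives near t. This
  shows that the singularity of the kernel at t is genuine, which the degenerate case \<beta> + H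
  \<le> 1 exploits.\<close>

lemma ml_kernel_lower_bound:
  assumes \<beta>: "0 < \<beta>" and t: "0 < t"
  obtains \<delta> where "0 < \<delta>" "\<delta> \<le> t"
    "\<And>s. t - \<delta> \<le> s \<Longrightarrow> s < t \<Longrightarrow> (t - s) powr (\<beta> - 1) / (2 * Gamma \<beta>) \<le> ml_kernel \<beta> c t s"
proof -
  have G: "Gamma \<beta> > 0" using \<beta> by (intro Gamma_real_pos)
  have "((\<lambda>r::real. r powr \<beta>) \<longlongrightarrow> 0 powr \<beta>) (at_right 0)"
    using \<beta> eventually_mono[OF eventually_at_right_less[of "0::real"], of "\<lambda>x. 0 \<le> x"]
    by (intro tendsto_powr' tendsto_ident_at tendsto_const) auto
  then have "((\<lambda>r. - (r powr \<beta> * c)) \<longlongrightarrow> - (0 powr \<beta> * c)) (at_right 0)"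
    by (intro tendsto_minus tendsto_mult_right)
  then have "((\<lambda>r. - (r powr \<beta> * c)) \<longlongrightarrow> 0) (at_right 0)" by simp
  then have "((\<lambda>r. mittag_leffler \<beta> \<beta> (- (r powr \<beta> * c))) \<longlongrightarrow> mittag_leffler \<beta> \<beta> 0) (at_right 0)"
    by (rule isCont_tendsto_compose[OF isCont_mittag_leffler[OF \<beta>]])
  moreover have "1 / (2 * Gamma \<beta>) < mittag_leffler \<beta> \<beta> 0"
    using G by (simp add: mittag_leffler_0 field_simps)
  ultimately have "\<forall>\<^sub>F r in at_right 0. 1 / (2 * Gamma \<beta>) < mittag_leffler \<beta> \<beta> (- (r powr \<beta> * c))"
    by (rule order_tendstoD)
  then obtain b where b: "b > 0" "\<And>r. 0 < r \<Longrightarrow> r < b \<Longrightarrow> 1 / (2 * Gamma \<beta>) < mittag_leffler \<beta> \<beta> (- (r powr \<beta> * c))"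
    unfolding eventually_at_right_field by auto
  show thesis
  proof (rule that[of "min t (b / 2)"])
    fix s assume s: "t - min t (b / 2) \<le> s" "s < t"
    then have "1 / (2 * Gamma \<beta>) < mittag_leffler \<beta> \<beta> (- ((t - s) powr \<beta> * c))"
      using b by (intro b(2)) (auto simp: min_def split: if_splits)
    then have "(t - s) powr (\<beta> - 1) * (1 / (2 * Gamma \<beta>)) \<le> ml_kernel \<beta> c t s"
      unfolding ml_kernel_def by (intro mult_left_mono) auto
    then show "(t - s) powr (\<beta> - 1) / (2 * Gamma \<beta>) \<le> ml_kernel \<beta> c t s" by simp
  qed (use t b in auto)
qed

section \<open>Square-integrable functions\<close>

lemma square_integrable_add:
  fixes f g :: "'a \<Rightarrow> 'b::{second_countable_topology,banach}"
  assumes "square_integrable M f" "square_integrable M g"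
  shows "square_integrable M (\<lambda>x. f x + g x)"
proof -
  have [measurable]: "f \<in> borel_measurable M" "g \<in> borel_measurable M"
    using assms by (auto simp: square_integrable_def)
  have i: "integrable M (\<lambda>x. 2 * (norm (f x))\<^sup>2 + 2 * (norm (g x))\<^sup>2)"
    using assms by (auto simp: square_integrable_def)
  have "integrable M (\<lambda>x. (norm (f x + g x))\<^sup>2)"
  proof (rule Bochner_Integration.integrable_bound[OF i])
    show "AE x in M. norm ((norm (f x + g x))\<^sup>2) \<le> norm (2 * (norm (f x))\<^sup>2 + 2 * (norm (g x))\<^sup>2)"
    proof (rule AE_I2)
      fix x
      have "(norm (f x + g x))\<^sup>2 \<le> (norm (f x) + norm (g x))\<^sup>2"
        by (intro power_mono norm_triangle_ineq) auto
      also have "\<dots> \<le> 2 * (norm (f x))\<^sup>2 + 2 * (norm (g x))\<^sup>2"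
        using sum_squares_bound[of "norm (f x)" "norm (g x)"] by (simp add: power2_sum)
      finally show "norm ((norm (f x + g x))\<^sup>2) \<le> norm (2 * (norm (f x))\<^sup>2 + 2 * (norm (g x))\<^sup>2)"
        by simp
    qed
  qed simp
  then show ?thesis by (simp add: square_integrable_def)
qed

lemma square_integrable_scaleR:
  fixes f :: "'a \<Rightarrow> 'b::{second_countable_topology,banach}"
  assumes "square_integrable M f"
  shows "square_integrable M (\<lambda>x. c *\<^sub>R f x)"
  using assms by (auto simp: square_integrable_def power_mult_distrib)

lemma square_integrable_cmult:
  fixes f :: "'a \<Rightarrow> real"
  shows "square_integrable M f \<Longrightarrow> square_integrable M (\<lambda>x. c * f x)"
  using square_integrable_scaleR[of M f c] by simp

lemma square_integrable_diff:
  fixes f g :: "'a \<Rightarrow> 'b::{second_countable_topology,banach}"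
  assumes "square_integrable M f" "square_integrable M g"
  shows "square_integrable M (\<lambda>x. f x - g x)"
  using square_integrable_add[OF assms(1) square_integrable_scaleR[OF assms(2), of "-1"]] by simp

lemma square_integrable_zero:
  "square_integrable M (\<lambda>x. 0 :: 'b::{second_countable_topology,banach})"
  by (simp add: square_integrable_def)

lemma square_integrable_sum:
  fixes f :: "'i \<Rightarrow> 'a \<Rightarrow> 'b::{second_countable_topology,banach}"
  assumes "\<And>i. i \<in> I \<Longrightarrow> square_integrable M (f i)"
  shows "square_integrable M (\<lambda>x. \<Sum>i\<in>I. f i x)"
  using assms
  by (induction I rule: infinite_finite_induct) (auto simp: square_integrable_zero intro: square_integrable_add)

lemma square_integrable_norm:
  fixes f :: "'a \<Rightarrow> 'b::{second_countable_topology,banach}"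
  shows "square_integrable M f \<Longrightarrow> square_integrable M (\<lambda>x. norm (f x))"
  by (auto simp: square_integrable_def)

lemma square_integrable_real_iff:
  fixes f :: "'a \<Rightarrow> real"
  shows "square_integrable M f \<longleftrightarrow> f \<in> borel_measurable M \<and> integrable M (\<lambda>x. (f x)\<^sup>2)"
  by (simp add: square_integrable_def)

lemma integrable_mult_square_integrable:
  fixes f g :: "'a \<Rightarrow> real"
  assumes "square_integrable M f" "square_integrable M g"
  shows "integrable M (\<lambda>x. f x * g x)"
proof -
  have "integrable M (\<lambda>x. ((f x + g x)\<^sup>2 - (f x)\<^sup>2 - (g x)\<^sup>2) / 2)"
    using square_integrable_add[OF assms] assms by (auto simp: square_integrable_real_iff)
  also have "(\<lambda>x. ((f x + g x)\<^sup>2 - (f x)\<^sup>2 - (g x)\<^sup>2) / 2) = (\<lambda>x. f x * g x)"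
    by (simp add: power2_sum)
  finally show ?thesis .
qed

lemma Cauchy_Schwarz_integral:
  fixes f g :: "'a \<Rightarrow> real"
  assumes f: "square_integrable M f" and g: "square_integrable M g"
  shows "\<bar>\<integral>x. f x * g x \<partial>M\<bar> \<le> sqrt (\<integral>x. (f x)\<^sup>2 \<partial>M) * sqrt (\<integral>x. (g x)\<^sup>2 \<partial>M)"
proof -
  define a b c where "a = (\<integral>x. (g x)\<^sup>2 \<partial>M)" and "b = (\<integral>x. f x * g x \<partial>M)" and "c = (\<integral>x. (f x)\<^sup>2 \<partial>M)"
  note fi = f[unfolded square_integrable_real_iff, THEN conjunct2]
  note gi = g[unfolded square_integrable_real_iff, THEN conjunct2]
  note fg = integrable_mult_square_integrable[OF f g]
  have quad: "0 \<le> c - 2 * s * b + s\<^sup>2 * a" for s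
  proof -
    have "0 \<le> (\<integral>x. (f x - s * g x)\<^sup>2 \<partial>M)" by simp
    also have "(\<lambda>x. (f x - s * g x)\<^sup>2) = (\<lambda>x. ((f x)\<^sup>2 - (2 * s) * (f x * g x)) + s\<^sup>2 * (g x)\<^sup>2)"
      by (simp add: power2_diff power_mult_distrib algebra_simps)
    also have "(\<integral>x. ((f x)\<^sup>2 - (2 * s) * (f x * g x)) + s\<^sup>2 * (g x)\<^sup>2 \<partial>M) = c - 2 * s * b + s\<^sup>2 * a"
      unfolding a_def b_def c_def using fi gi fg by simp
    finally show ?thesis .
  qed
  have a0: "a \<ge> 0" "c \<ge> 0" unfolding a_def c_def by simp_all
  have "b\<^sup>2 \<le> c * a"
  proof (cases "a = 0")
    case True
    have "b = 0"
    proof (rule ccontr)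
      assume "b \<noteq> 0"
      \<comment> \<open>With a = 0 the quadratic is affine in s, and at this s it takes the value
        -1.\<close>
      then show False using quad[of "(c + 1) / (2 * b)"] True by (simp add: field_simps)
    qed
    then show ?thesis using True by simp
  next
    case False
    then have "a > 0" using a0 by simp
    then show ?thesis using quad[of "b / a"] by (simp add: field_simps power2_eq_square)
  qed
  then have "sqrt (b\<^sup>2) \<le> sqrt (c * a)" by (rule real_sqrt_le_mono)
  then show ?thesis by (simp add: real_sqrt_mult a_def b_def c_def)
qed

lemma Minkowski_integral:
  fixes f g :: "'a \<Rightarrow> 'b::{second_countable_topology,banach}"
  assumes f: "square_integrable M f" and g: "square_integrable M g"
  shows "sqrt (\<integral>x. (norm (f x + g x))\<^sup>2 \<partial>M) \<le> sqrt (\<integral>x. (norm (f x))\<^sup>2 \<partial>M) + sqrt (\<integral>x. (norm (g x))\<^sup>2 \<partial>M)"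
proof -
  define a c where "a = (\<integral>x. (norm (g x))\<^sup>2 \<partial>M)" and "c = (\<integral>x. (norm (f x))\<^sup>2 \<partial>M)"
  have a0: "a \<ge> 0" "c \<ge> 0" unfolding a_def c_def by simp_all
  have fi: "integrable M (\<lambda>x. (norm (f x))\<^sup>2)" "integrable M (\<lambda>x. (norm (g x))\<^sup>2)"
    "integrable M (\<lambda>x. (norm (f x + g x))\<^sup>2)"
    using f g square_integrable_add[OF f g] by (auto simp: square_integrable_def)
  note fg = integrable_mult_square_integrable[OF square_integrable_norm[OF f] square_integrable_norm[OF g]]
  have "(\<integral>x. (norm (f x + g x))\<^sup>2 \<partial>M) \<le> (\<integral>x. ((norm (f x))\<^sup>2 + 2 * (norm (f x) * norm (g x))) + (norm (g x))\<^sup>2 \<partial>M)"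
  proof (rule integral_mono)
    fix x
    have "(norm (f x + g x))\<^sup>2 \<le> (norm (f x) + norm (g x))\<^sup>2"
      by (intro power_mono norm_triangle_ineq) auto
    then show "(norm (f x + g x))\<^sup>2 \<le> ((norm (f x))\<^sup>2 + 2 * (norm (f x) * norm (g x))) + (norm (g x))\<^sup>2"
      by (simp add: power2_sum)
  qed (use fi fg in auto)
  also have "\<dots> = c + 2 * (\<integral>x. norm (f x) * norm (g x) \<partial>M) + a"
    unfolding a_def c_def using fi fg by simp
  also have "\<dots> \<le> c + 2 * (sqrt c * sqrt a) + a"
    using Cauchy_Schwarz_integral[OF square_integrable_norm[OF f] square_integrable_norm[OF g]]
    unfolding a_def c_def by simp
  also have "\<dots> = (sqrt c + sqrt a)\<^sup>2" using a0 by (simp add: power2_sum)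
  finally show ?thesis
    using a0 unfolding a_def c_def by (intro real_le_lsqrt) auto
qed

text \<open>Joint continuity of the inner product of L2. The filter is arbitrary because both
  sequences of divisions and the one-sided limit u to t occur; square integrability is required only
  eventually because the integrals over [0, u] are constrained only for 0 \<le> u < t.\<close>

lemma tendsto_integral_mult:
  fixes S S' :: "'n \<Rightarrow> 'a \<Rightarrow> real"
  assumes S: "\<forall>\<^sub>F n in F. square_integrable M (S n)" "\<forall>\<^sub>F n in F. square_integrable M (S' n)"
    and J: "square_integrable M J" "square_integrable M J'"
    and lim: "((\<lambda>n. \<integral>x. (S n x - J x)\<^sup>2 \<partial>M) \<longlongrightarrow> 0) F" "((\<lambda>n. \<integral>x. (S' n x - J' x)\<^sup>2 \<partial>M) \<longlongrightarrow> 0) F"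
  shows "((\<lambda>n. \<integral>x. S n x * S' n x \<partial>M) \<longlongrightarrow> (\<integral>x. J x * J' x \<partial>M)) F"
proof -
  define e e' where "e n = sqrt (\<integral>x. (S n x - J x)\<^sup>2 \<partial>M)" and "e' n = sqrt (\<integral>x. (S' n x - J' x)\<^sup>2 \<partial>M)" for n
  define j j' where "j = sqrt (\<integral>x. (J x)\<^sup>2 \<partial>M)" and "j' = sqrt (\<integral>x. (J' x)\<^sup>2 \<partial>M)"
  have e: "(e \<longlongrightarrow> 0) F" "(e' \<longlongrightarrow> 0) F"
    unfolding e_def[abs_def] e'_def[abs_def] using tendsto_real_sqrt[OF lim(1)] tendsto_real_sqrt[OF lim(2)] by simp_all
  have "((\<lambda>n. e n * e' n + e n * j' + j * e' n) \<longlongrightarrow> 0 * 0 + 0 * j' + j * 0) F"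
    by (intro tendsto_intros e)
  then have bound: "((\<lambda>n. e n * e' n + e n * j' + j * e' n) \<longlongrightarrow> 0) F" by simp
  have "((\<lambda>n. (\<integral>x. S n x * S' n x \<partial>M) - (\<integral>x. J x * J' x \<partial>M)) \<longlongrightarrow> 0) F"
  proof (rule Lim_null_comparison[OF _ bound])
    show "\<forall>\<^sub>F n in F. norm ((\<integral>x. S n x * S' n x \<partial>M) - (\<integral>x. J x * J' x \<partial>M)) \<le> e n * e' n + e n * j' + j * e' n"
      using S
    proof eventually_elim
      case (elim n)
      note d = square_integrable_diff[OF elim(1) J(1)] square_integrable_diff[OF elim(2) J(2)]
      note i = integrable_mult_square_integrable
      have eq: "(\<lambda>x. S n x * S' n x) = (\<lambda>x. (S n x - J x) * (S' n x - J' x) + (S n x - J x) * J' x + J x * (S' n x - J' x) + J x * J' x)"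
        by (auto simp: algebra_simps)
      have "(\<integral>x. S n x * S' n x \<partial>M) - (\<integral>x. J x * J' x \<partial>M) =
        (\<integral>x. (S n x - J x) * (S' n x - J' x) \<partial>M) + (\<integral>x. (S n x - J x) * J' x \<partial>M) + (\<integral>x. J x * (S' n x - J' x) \<partial>M)"
        unfolding eq using i[OF d] i[OF d(1) J(2)] i[OF J(1) d(2)] i[OF J] by simp
      also have "norm \<dots> \<le> e n * e' n + e n * j' + j * e' n"
        using Cauchy_Schwarz_integral[OF d] Cauchy_Schwarz_integral[OF d(1) J(2)] Cauchy_Schwarz_integral[OF J(1) d(2)]
        unfolding e_def e'_def j_def j'_def by simp
      finally show ?case .
    qed
  qed
  then show ?thesis by (simp add: LIM_zero_iff)
qed

section \<open>Riemann-Stieltjes sums of fractional Brownian motion\<close>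

lemma (in prob_space) centred_gaussian_rv_moments:
  assumes "centred_gaussian_rv M X"
  shows "square_integrable M X" "expectation X = 0"
proof -
  have [measurable]: "X \<in> borel_measurable M" using assms by (simp add: centred_gaussian_rv_def)
  have "square_integrable M X \<and> expectation X = 0"
  proof (cases "AE \<omega> in M. X \<omega> = 0")
    case True
    have "integrable M (\<lambda>x. (X x)\<^sup>2) \<longleftrightarrow> integrable M (\<lambda>x. 0::real)"
      by (rule integrable_cong_AE) (use True in auto)
    moreover have "expectation X = (\<integral>x. 0 \<partial>M)"
      by (rule integral_cong_AE) (use True in auto)
    ultimately show ?thesis by (simp add: square_integrable_real_iff)
  next
    case False
    then obtain \<sigma> where \<sigma>: "\<sigma> > 0" and D: "distributed M lborel X (\<lambda>x. ennreal (normal_density 0 \<sigma> x))"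
      using assms by (auto simp: centred_gaussian_rv_def)
    have "integrable lborel (\<lambda>x. normal_density 0 \<sigma> x * x\<^sup>2)"
      using integrable_normal_moment[OF \<sigma>, of 0 2] by simp
    then have "integrable M (\<lambda>x. (X x)\<^sup>2)"
      using distributed_integrable[OF D, of "\<lambda>x. x\<^sup>2"] by simp
    moreover have "expectation X = (\<integral>x. normal_density 0 \<sigma> x * x \<partial>lborel)"
      using distributed_integral[OF D, of "\<lambda>x. x"] by simp
    ultimately show ?thesis using integral_normal_moment_nz_1[OF \<sigma>, of 0] by (simp add: square_integrable_real_iff)
  qed
  then show "square_integrable M X" "expectation X = 0" by auto
qed

lemma (in prob_space) real_fBm_increment:
  assumes B: "real_fBm M H A B" and st: "0 \<le> s" "0 \<le> t"
  shows "square_integrable M (\<lambda>\<omega>. B t \<omega> - B s \<omega>)"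
    "expectation (\<lambda>\<omega>. B t \<omega> - B s \<omega>) = 0"
    "expectation (\<lambda>\<omega>. (B t \<omega> - B s \<omega>)\<^sup>2) = A * \<bar>t - s\<bar> powr (2 * H)"
proof -
  \<comment> \<open>A difference of two indicators, so that the coefficient is 0 when s = t and the
    set \<open>{s, t}\<close> collapses.\<close>
  define c where "c = (\<lambda>u. (if u = t then 1 else 0) - (if u = s then 1 else 0 :: real))"
  have "centred_gaussian_rv M (\<lambda>\<omega>. \<Sum>u\<in>{s, t}. c u * B u \<omega>)"
    using B st unfolding real_fBm_def centred_gaussian_process_def by auto
  also have "(\<lambda>\<omega>. \<Sum>u\<in>{s, t}. c u * B u \<omega>) = (\<lambda>\<omega>. B t \<omega> - B s \<omega>)"
    by (cases "s = t") (auto simp: c_def)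
  finally have G: "centred_gaussian_rv M (\<lambda>\<omega>. B t \<omega> - B s \<omega>)" .
  show "square_integrable M (\<lambda>\<omega>. B t \<omega> - B s \<omega>)" "expectation (\<lambda>\<omega>. B t \<omega> - B s \<omega>) = 0"
    by (rule centred_gaussian_rv_moments[OF G])+
  show "expectation (\<lambda>\<omega>. (B t \<omega> - B s \<omega>)\<^sup>2) = A * \<bar>t - s\<bar> powr (2 * H)"
    using B st by (auto simp: real_fBm_def)
qed

lemma (in prob_space) real_fBm_variance_nonneg:
  assumes "real_fBm M H A B"
  shows "0 \<le> A"
proof -
  have "0 \<le> expectation (\<lambda>\<omega>. (B 1 \<omega> - B 0 \<omega>)\<^sup>2)" by simp
  then show ?thesis using real_fBm_increment(3)[OF assms, of 0 1] by simp
qed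

text \<open>For p = 2H this is the sign of the covariance of the increments over [a, b] and [c, d].
  The lengths c - a and d - b lie between c - b and d - a and have the same sum, so convexity
  applies. Convexity is used on the positive reals; when b = c the shortest length is 0 and the
  claim is superadditivity of the power.\<close>

lemma powr_convex_increment:
  fixes a b c d p :: real
  assumes p: "1 \<le> p" and "a \<le> b" "b \<le> c" "c \<le> d"
  shows "(c - a) powr p + (d - b) powr p \<le> (d - a) powr p + (c - b) powr p"
proof (cases "d - a = c - b")
  case True
  then have "a = b" "c = d" using assms by linarith+
  then show ?thesis by simp
next
  case neq: False
  show ?thesis
  proof (cases "b = c")
    case True
    have superadd: "x powr p \<le> x * (d - a) powr (p - 1)" if "0 \<le> x" "x \<le> d - a" for x
    proof -
      have "x powr p = x * x powr (p - 1)" using that p by (cases "x = 0") (auto simp: powr_diff)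
      also have "\<dots> \<le> x * (d - a) powr (p - 1)" using that p by (intro mult_left_mono powr_mono2) auto
      finally show ?thesis .
    qed
    have "(c - a) powr p + (d - b) powr p \<le> (c - a) * (d - a) powr (p - 1) + (d - b) * (d - a) powr (p - 1)"
      by (intro add_mono superadd) (use assms True in auto)
    also have "\<dots> = (d - a) * (d - a) powr (p - 1)" using True by (simp add: algebra_simps)
    also have "\<dots> = (d - a) powr p" using neq True assms by (auto simp: powr_diff)
    finally show ?thesis using True by simp
  next
    case False
    define w where "w = (d - a) - (c - b)"
    have w: "w > 0" using neq assms by (simp add: w_def)
    have conv: "convex_on {0<..} (\<lambda>x::real. x powr p)" by (rule powr_convex[OF p])
    \<comment> \<open>The fraction at which c - a divides the segment from d - a to c - b; d - b
      lies at the complementary fraction.\<close>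
    define s where "s = (d - c) / w"
    have s: "0 \<le> s" "s \<le> 1" "1 - s = (b - a) / w" using assms w by (auto simp: s_def w_def field_simps)
    have sw: "s * w = d - c" using w by (simp add: s_def)
    have 1: "(1 - s) *\<^sub>R (d - a) + s *\<^sub>R (c - b) = c - a"
    proof -
      have "(1 - s) *\<^sub>R (d - a) + s *\<^sub>R (c - b) = (d - a) - s * w" by (simp add: w_def algebra_simps)
      then show ?thesis using sw by simp
    qed
    have 2: "(1 - s) *\<^sub>R (c - b) + s *\<^sub>R (d - a) = d - b"
    proof -
      have "(1 - s) *\<^sub>R (c - b) + s *\<^sub>R (d - a) = (c - b) + s * w" by (simp add: w_def algebra_simps)
      then show ?thesis using sw by simp
    qed
    have "((1 - s) *\<^sub>R (d - a) + s *\<^sub>R (c - b)) powr p \<le> (1 - s) * (d - a) powr p + s * (c - b) powr p"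
      by (rule convex_onD[OF conv]) (use s assms False in auto)
    moreover have "((1 - s) *\<^sub>R (c - b) + s *\<^sub>R (d - a)) powr p \<le> (1 - s) * (c - b) powr p + s * (d - a) powr p"
      by (rule convex_onD[OF conv]) (use s assms False in auto)
    ultimately show ?thesis unfolding 1 2 by (simp add: algebra_simps)
  qed
qed

text \<open>Polarisation: twice the product of the increments is a signed sum of four squared
  increments, whose means are known powers of lengths. The sign is then the convexity inequality
  with exponent 2H \<ge> 1.\<close>

lemma (in prob_space) real_fBm_cov_increments_nonneg:
  assumes B: "real_fBm M H A B" and H: "1 / 2 \<le> H"
    and abcd: "0 \<le> a" "a \<le> b" "b \<le> c" "c \<le> d"
  shows "0 \<le> expectation (\<lambda>\<omega>. (B b \<omega> - B a \<omega>) * (B d \<omega> - B c \<omega>))"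
proof -
  have si: "integrable M (\<lambda>\<omega>. (B t \<omega> - B s \<omega>)\<^sup>2)" if "0 \<le> s" "0 \<le> t" for s t
    using real_fBm_increment(1)[OF B that] by (simp add: square_integrable_real_iff)
  have "(\<lambda>\<omega>. (B b \<omega> - B a \<omega>) * (B d \<omega> - B c \<omega>)) =
      (\<lambda>\<omega>. ((B d \<omega> - B a \<omega>)\<^sup>2 + (B c \<omega> - B b \<omega>)\<^sup>2 - (B c \<omega> - B a \<omega>)\<^sup>2 - (B d \<omega> - B b \<omega>)\<^sup>2) / 2)"
    by (auto simp: power2_eq_square algebra_simps)
  then have "expectation (\<lambda>\<omega>. (B b \<omega> - B a \<omega>) * (B d \<omega> - B c \<omega>)) =
     A * ((d - a) powr (2 * H) + (c - b) powr (2 * H) - (c - a) powr (2 * H) - (d - b) powr (2 * H)) / 2"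
    using abcd real_fBm_increment(3)[OF B] si by (simp add: algebra_simps)
  moreover have "0 \<le> A * ((d - a) powr (2 * H) + (c - b) powr (2 * H) - (c - a) powr (2 * H) - (d - b) powr (2 * H))"
    using powr_convex_increment[of "2 * H" a b c d] H abcd
    by (intro mult_nonneg_nonneg real_fBm_variance_nonneg[OF B]) auto
  ultimately show ?thesis by simp
qed

section \<open>Second moments of Riemann-Stieltjes sums as quadratic forms\<close>

definition RS_sum :: "(real \<Rightarrow> real) \<Rightarrow> (real \<Rightarrow> 'w \<Rightarrow> real) \<Rightarrow> (real \<times> real set) set \<Rightarrow> 'w \<Rightarrow> real" where
  "RS_sum g B p \<omega> = (\<Sum>(x, K)\<in>p. g x * (B (Sup K) \<omega> - B (Inf K) \<omega>))"

lemma tagged_division_of_real_cases: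
  fixes a b :: real
  assumes "p tagged_division_of {a..b}" "(x, K) \<in> p"
  obtains u v where "K = {u..v}" "a \<le> u" "u \<le> v" "v \<le> b" "x \<in> {u..v}" "Inf K = u" "Sup K = v"
proof -
  have xK: "x \<in> K" "K \<subseteq> {a..b}" using tagged_division_ofD(2,3)[OF assms] by auto
  obtain u v where K: "K = {u..v}" using tagged_division_ofD(4)[OF assms] by (auto simp: box_real)
  then show thesis using that[of u v] xK by auto
qed

lemma (in prob_space) RS_sum_square_integrable:
  assumes B: "real_fBm M H A B" and p: "p tagged_division_of {a..b}" and a: "0 \<le> a"
  shows "square_integrable M (RS_sum g B p)"
proof -
  have "square_integrable M (\<lambda>\<omega>. \<Sum>y\<in>p. (case y of (x, K) \<Rightarrow> g x * (B (Sup K) \<omega> - B (Inf K) \<omega>)))"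
  proof (rule square_integrable_sum, clarify)
    fix x K assume "(x, K) \<in> p"
    from tagged_division_of_real_cases[OF p this] obtain u v where
      "K = {u..v}" "a \<le> u" "u \<le> v" "Inf K = u" "Sup K = v" by metis
    then show "square_integrable M (\<lambda>\<omega>. g x * (B (Sup K) \<omega> - B (Inf K) \<omega>))"
      using a by (auto intro!: square_integrable_cmult real_fBm_increment[OF B])
  qed
  then show ?thesis by (simp add: RS_sum_def[abs_def])
qed

lemma (in prob_space) RS_sum_mult_expectation:
  assumes B: "real_fBm M H A B" and p: "p tagged_division_of {a..b}" and a: "0 \<le> a"
    and B': "real_fBm M H' A' B'" and q: "q tagged_division_of {c..d}" and c: "0 \<le> c"
  shows "expectation (\<lambda>\<omega>. RS_sum g B p \<omega> * RS_sum h B' q \<omega>) =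
    (\<Sum>(x, K)\<in>p. \<Sum>(y, L)\<in>q. g x * h y *
       expectation (\<lambda>\<omega>. (B (Sup K) \<omega> - B (Inf K) \<omega>) * (B' (Sup L) \<omega> - B' (Inf L) \<omega>)))"
proof -
  have i: "integrable M (\<lambda>\<omega>. (B (Sup K) \<omega> - B (Inf K) \<omega>) * (B' (Sup L) \<omega> - B' (Inf L) \<omega>))"
    if K: "(x, K) \<in> p" and L: "(y, L) \<in> q" for x K y L
  proof -
    from tagged_division_of_real_cases[OF p K] obtain u v where
      1: "K = {u..v}" "a \<le> u" "u \<le> v" "Inf K = u" "Sup K = v" by metis
    from tagged_division_of_real_cases[OF q L] obtain u' v' where
      2: "L = {u'..v'}" "c \<le> u'" "u' \<le> v'" "Inf L = u'" "Sup L = v'" by metis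
    show ?thesis unfolding 1(4,5) 2(4,5)
      by (intro integrable_mult_square_integrable real_fBm_increment(1)[OF B] real_fBm_increment(1)[OF B'])
        (use 1 2 a c in auto)
  qed
  have "(\<lambda>\<omega>. RS_sum g B p \<omega> * RS_sum h B' q \<omega>) =
    (\<lambda>\<omega>. \<Sum>z\<in>p. \<Sum>z'\<in>q. (g (fst z) * h (fst z')) *
       ((B (Sup (snd z)) \<omega> - B (Inf (snd z)) \<omega>) * (B' (Sup (snd z')) \<omega> - B' (Inf (snd z')) \<omega>)))"
    unfolding RS_sum_def sum_product by (auto simp: case_prod_beta mult_ac)
  moreover have "integrable M (\<lambda>\<omega>. (B (Sup (snd z)) \<omega> - B (Inf (snd z)) \<omega>) * (B' (Sup (snd z')) \<omega> - B' (Inf (snd z')) \<omega>))"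
    if "z \<in> p" "z' \<in> q" for z z'
    using i[of "fst z" "snd z" "fst z'" "snd z'"] that by simp
  ultimately show ?thesis
    by (simp add: case_prod_beta Bochner_Integration.integral_sum Bochner_Integration.integrable_sum)
qed

text \<open>Telescoping. Constants are therefore the natural comparison integrands: the variance of
  their sums is known exactly, whatever the division.\<close>

lemma RS_sum_const:
  assumes "a \<le> b" "p tagged_division_of {a..b}"
  shows "RS_sum (\<lambda>_. m) B p = (\<lambda>\<omega>. m * (B b \<omega> - B a \<omega>))"
proof
  fix \<omega>
  show "RS_sum (\<lambda>_. m) B p \<omega> = m * (B b \<omega> - B a \<omega>)"
    using additive_tagged_division_1[OF assms, of "\<lambda>s. B s \<omega>"]
    by (simp add: RS_sum_def case_prod_beta flip: sum_distrib_left)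
qed

text \<open>Two tagged pieces either coincide, which gives a square, or have disjoint interiors. In
  the second case one lies to the left of the other or one is a single point, whose increment is
  zero.\<close>

lemma (in prob_space) increment_cov_division_nonneg:
  assumes B: "real_fBm M H A B" and H: "1 / 2 \<le> H" and p: "p tagged_division_of {a..b}" and a: "0 \<le> a"
    and K: "(x, K) \<in> p" "(y, L) \<in> p"
  shows "0 \<le> expectation (\<lambda>\<omega>. (B (Sup K) \<omega> - B (Inf K) \<omega>) * (B (Sup L) \<omega> - B (Inf L) \<omega>))"
proof (cases "(x, K) = (y, L)")
  case True
  then show ?thesis by simp
next
  case False
  from tagged_division_of_real_cases[OF p K(1)] obtain u v where
    Kuv: "K = {u..v}" "a \<le> u" "u \<le> v" "Inf K = u" "Sup K = v" by metis
  from tagged_division_of_real_cases[OF p K(2)] obtain u' v' where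
    Luv: "L = {u'..v'}" "a \<le> u'" "u' \<le> v'" "Inf L = u'" "Sup L = v'" by metis
  have "interior K \<inter> interior L = {}" by (rule tagged_division_ofD(5)[OF p K False])
  then have disj: "{max u u'<..<min v v'} = {}" using Kuv Luv by (auto simp: interior_atLeastAtMost_real)
  then have "min v v' \<le> max u u'" by (simp add: not_less)
  then consider "v \<le> u'" | "v' \<le> u" | "u = v" | "u' = v'" using Kuv Luv by linarith
  then show ?thesis
  proof cases
    case 1
    then show ?thesis unfolding Kuv(4,5) Luv(4,5) using 1 Kuv Luv a by (intro real_fBm_cov_increments_nonneg[OF B H]) auto
  next
    case 2
    then show ?thesis unfolding Kuv(4,5) Luv(4,5) using 2 Kuv Luv a real_fBm_cov_increments_nonneg[OF B H, of u' v' u v]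
      by (simp add: mult.commute)
  qed (use Kuv Luv in auto)
qed

lemma (in prob_space) RS_sum_const_variance:
  assumes B: "real_fBm M H A B" and p: "p tagged_division_of {a..b}" and a: "0 \<le> a" "a \<le> b"
  shows "expectation (\<lambda>\<omega>. (RS_sum (\<lambda>_. m) B p \<omega>)\<^sup>2) = m\<^sup>2 * (A * (b - a) powr (2 * H))"
  using a real_fBm_increment(3)[OF B, of a b] by (simp add: RS_sum_const[OF a(2) p] power_mult_distrib)

text \<open>The variance is a quadratic form in the values at the tags with nonnegative
  coefficients. The hypothesis compares products, so that it covers both a signed g with |g| \<le> h
  and ordered nonnegative integrands.\<close>

lemma (in prob_space) RS_sum_variance_mono:
  assumes B: "real_fBm M H A B" and H: "1 / 2 \<le> H" and p: "p tagged_division_of {a..b}" and a: "0 \<le> a"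
    and le: "\<And>x y. x \<in> {a..b} \<Longrightarrow> y \<in> {a..b} \<Longrightarrow> g x * g y \<le> h x * h y"
  shows "expectation (\<lambda>\<omega>. (RS_sum g B p \<omega>)\<^sup>2) \<le> expectation (\<lambda>\<omega>. (RS_sum h B p \<omega>)\<^sup>2)"
  unfolding power2_eq_square RS_sum_mult_expectation[OF B p a B p a]
proof (intro sum_mono, clarify, intro sum_mono, clarify)
  fix x K y L assume K: "(x, K) \<in> p" and L: "(y, L) \<in> p"
  have "x \<in> {a..b}" "y \<in> {a..b}" using tagged_division_ofD(2,3)[OF p K] tagged_division_ofD(2,3)[OF p L] by auto
  then show "g x * g y * expectation (\<lambda>\<omega>. (B (Sup K) \<omega> - B (Inf K) \<omega>) * (B (Sup L) \<omega> - B (Inf L) \<omega>)) \<le>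
      h x * h y * expectation (\<lambda>\<omega>. (B (Sup K) \<omega> - B (Inf K) \<omega>) * (B (Sup L) \<omega> - B (Inf L) \<omega>))"
    by (intro mult_right_mono increment_cov_division_nonneg[OF B H p a K L] le)
qed

lemma (in prob_space) RS_sum_upper:
  assumes B: "real_fBm M H A B" and H: "1 / 2 \<le> H" and p: "p tagged_division_of {a..b}" and a: "0 \<le> a" "a \<le> b"
    and g: "\<And>s. s \<in> {a..b} \<Longrightarrow> \<bar>g s\<bar> \<le> m"
  shows "expectation (\<lambda>\<omega>. (RS_sum g B p \<omega>)\<^sup>2) \<le> m\<^sup>2 * (A * (b - a) powr (2 * H))"
  unfolding RS_sum_const_variance[OF B p a, symmetric]
proof (rule RS_sum_variance_mono[OF B H p a(1)])
  fix x y assume xy: "x \<in> {a..b}" "y \<in> {a..b}"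
  have "g x * g y \<le> \<bar>g x\<bar> * \<bar>g y\<bar>" by (simp flip: abs_mult)
  also have "\<dots> \<le> m * m" using g[OF xy(1)] g[OF xy(2)] by (intro mult_mono) auto
  finally show "g x * g y \<le> m * m" .
qed

lemma (in prob_space) RS_sum_lower:
  assumes B: "real_fBm M H A B" and H: "1 / 2 \<le> H" and p: "p tagged_division_of {a..b}" and a: "0 \<le> a" "a \<le> b"
    and g: "\<And>s. s \<in> {a..b} \<Longrightarrow> m \<le> g s" and m: "0 \<le> m"
  shows "m\<^sup>2 * (A * (b - a) powr (2 * H)) \<le> expectation (\<lambda>\<omega>. (RS_sum g B p \<omega>)\<^sup>2)"
  unfolding RS_sum_const_variance[OF B p a, symmetric]
proof (rule RS_sum_variance_mono[OF B H p a(1)])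
  fix x y assume "x \<in> {a..b}" "y \<in> {a..b}"
  then show "m * m \<le> g x * g y" using g[of x] g[of y] m by (intro mult_mono) auto
qed

lemma (in prob_space) RS_sum_cross:
  assumes B: "real_fBm M H A B" and H: "1 / 2 \<le> H"
    and p: "p tagged_division_of {a..b}" and q: "q tagged_division_of {b..c}" and abc: "0 \<le> a" "a \<le> b" "b \<le> c"
    and g: "\<And>s. s \<in> {a..c} \<Longrightarrow> 0 \<le> g s"
  shows "0 \<le> expectation (\<lambda>\<omega>. RS_sum g B p \<omega> * RS_sum g B q \<omega>)"
proof -
  have b: "0 \<le> b" using abc by simp
  show ?thesis unfolding RS_sum_mult_expectation[OF B p abc(1) B q b]
  proof (intro sum_nonneg, clarify, intro sum_nonneg, clarify)
    fix x K y L assume K: "(x, K) \<in> p" and L: "(y, L) \<in> q"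
    from tagged_division_of_real_cases[OF p K] obtain u v where
      1: "K = {u..v}" "a \<le> u" "u \<le> v" "v \<le> b" "x \<in> {u..v}" "Inf K = u" "Sup K = v" by metis
    from tagged_division_of_real_cases[OF q L] obtain u' v' where
      2: "L = {u'..v'}" "b \<le> u'" "u' \<le> v'" "v' \<le> c" "y \<in> {u'..v'}" "Inf L = u'" "Sup L = v'" by metis
    have "0 \<le> expectation (\<lambda>\<omega>. (B (Sup K) \<omega> - B (Inf K) \<omega>) * (B (Sup L) \<omega> - B (Inf L) \<omega>))"
      unfolding 1(6,7) 2(6,7) by (rule real_fBm_cov_increments_nonneg[OF B H]) (use 1 2 abc in auto)
    then show "0 \<le> g x * g y * expectation (\<lambda>\<omega>. (B (Sup K) \<omega> - B (Inf K) \<omega>) * (B (Sup L) \<omega> - B (Inf L) \<omega>))"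
      using g[of x] g[of y] 1 2 abc by (intro mult_nonneg_nonneg) auto
  qed
qed

section \<open>Mean-square Riemann-Stieltjes integrals\<close>

lemma has_RS_integral_sequence:
  assumes "has_RS_integral M g B a b J"
  obtains p where "\<And>n. p n tagged_division_of {a..b}"
    "(\<lambda>n. \<integral>\<omega>. (RS_sum g B (p n) \<omega> - J \<omega>)\<^sup>2 \<partial>M) \<longlonglongrightarrow> 0"
proof -
  have "\<exists>p. p tagged_division_of {a..b} \<and> (\<integral>\<omega>. (RS_sum g B p \<omega> - J \<omega>)\<^sup>2 \<partial>M) < inverse (real (Suc n))" for n
  proof -
    obtain d where d: "d > 0" "\<And>p. p tagged_division_of {a..b} \<and> (\<lambda>x. ball x d) fine p \<Longrightarrow>
        (\<integral>\<omega>. (RS_sum g B p \<omega> - J \<omega>)\<^sup>2 \<partial>M) < inverse (real (Suc n))"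
      using assms[unfolded has_RS_integral_def, THEN conjunct2, rule_format, of "inverse (real (Suc n))"]
      unfolding RS_sum_def by auto
    obtain p where "p tagged_division_of {a..b}" "(\<lambda>x. ball x d) fine p"
      using fine_division_exists_real[of "\<lambda>x. ball x d" a b] d(1) by (auto simp: gauge_def)
    then show ?thesis using d(2) by blast
  qed
  then obtain p where p: "\<And>n. p n tagged_division_of {a..b}"
    "\<And>n. (\<integral>\<omega>. (RS_sum g B (p n) \<omega> - J \<omega>)\<^sup>2 \<partial>M) < inverse (real (Suc n))" by metis
  have "(\<lambda>n. \<integral>\<omega>. (RS_sum g B (p n) \<omega> - J \<omega>)\<^sup>2 \<partial>M) \<longlonglongrightarrow> 0"
    by (rule tendsto_sandwich[OF _ _ tendsto_const LIMSEQ_inverse_real_of_nat])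
      (use p(2) in \<open>auto intro!: always_eventually less_imp_le\<close>)
  then show thesis using that p(1) by blast
qed

lemma power2_diff_le: "(x - y)\<^sup>2 \<le> 2 * x\<^sup>2 + 2 * y\<^sup>2" for x y :: real
  using zero_le_power2[of "x + y"] by (simp add: power2_eq_square algebra_simps)

text \<open>One fixed fine division of [a, b] is glued to an arbitrary fine division of [b, c]; the
  sum over [b, c] is then the difference of two sums close to J2 and J1. Each error gets e / 4
  because (x - y)^2 is at most 2 x^2 + 2 y^2. This isolates the dyadic blocks of an improper
  integral.\<close>

lemma (in prob_space) has_RS_integral_additive:
  assumes B: "real_fBm M H A B" and abc: "0 \<le> a" "a \<le> b" "b \<le> c"
    and J1: "has_RS_integral M g B a b J1" and J2: "has_RS_integral M g B a c J2"
  shows "has_RS_integral M g B b c (\<lambda>\<omega>. J2 \<omega> - J1 \<omega>)"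
  unfolding has_RS_integral_def
proof (intro conjI allI impI)
  have J: "square_integrable M J1" "square_integrable M J2"
    using J1 J2 by (auto simp: has_RS_integral_def)
  then show "square_integrable M (\<lambda>\<omega>. J2 \<omega> - J1 \<omega>)" by (intro square_integrable_diff)
  fix e :: real assume e: "e > 0"
  obtain d1 where d1: "d1 > 0" "\<And>p. p tagged_division_of {a..b} \<and> (\<lambda>x. ball x d1) fine p \<Longrightarrow>
      (\<integral>\<omega>. (RS_sum g B p \<omega> - J1 \<omega>)\<^sup>2 \<partial>M) < e / 4"
    using J1[unfolded has_RS_integral_def, THEN conjunct2, rule_format, of "e / 4"] e
    unfolding RS_sum_def by auto
  obtain d2 where d2: "d2 > 0" "\<And>p. p tagged_division_of {a..c} \<and> (\<lambda>x. ball x d2) fine p \<Longrightarrow>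
      (\<integral>\<omega>. (RS_sum g B p \<omega> - J2 \<omega>)\<^sup>2 \<partial>M) < e / 4"
    using J2[unfolded has_RS_integral_def, THEN conjunct2, rule_format, of "e / 4"] e
    unfolding RS_sum_def by auto
  define d where "d = min d1 d2"
  obtain p where p: "p tagged_division_of {a..b}" "(\<lambda>x. ball x d) fine p"
    using fine_division_exists_real[of "\<lambda>x. ball x d" a b] d1(1) d2(1) by (auto simp: gauge_def d_def)
  have fine: "(\<lambda>x. ball x d') fine q" if "(\<lambda>x. ball x d) fine q" "d \<le> d'" for q d'
    using that subset_ball[OF that(2)] unfolding fine_def by fastforce
  show "\<exists>d>0. \<forall>p. p tagged_division_of {b..c} \<and> (\<lambda>x. ball x d) fine p \<longrightarrow>
        (\<integral>\<omega>. ((\<Sum>(x, K)\<in>p. g x * (B (Sup K) \<omega> - B (Inf K) \<omega>)) - (J2 \<omega> - J1 \<omega>))\<^sup>2 \<partial>M) < e"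
  proof (intro exI[of _ d] conjI allI impI)
    show "d > 0" using d1 d2 by (simp add: d_def)
    fix q assume q: "q tagged_division_of {b..c} \<and> (\<lambda>x. ball x d) fine q"
    have int: "interior {a..b} \<inter> interior {b..c} = {}" by (auto simp: interior_atLeastAtMost_real)
    have un: "(p \<union> q) tagged_division_of {a..c}"
      using tagged_division_Un[OF p(1) _ int, of q] q abc by (simp add: ivl_disj_un_two_touch)
    have fin: "finite p" "finite q" using p q by (auto dest: tagged_division_ofD(1))
    \<comment> \<open>The divisions need not be disjoint as sets: both may contain a tagged
      one-point interval at b. Its increment is zero, so counting it once or twice makes no
      difference.\<close>
    have RS_un: "RS_sum g B (p \<union> q) \<omega> = RS_sum g B p \<omega> + RS_sum g B q \<omega>" for \<omega>
      unfolding RS_sum_def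
    proof (rule sum.union_inter_neutral[OF fin], clarify)
      fix x K assume "(x, K) \<in> p" "(x, K) \<in> q"
      with tagged_division_of_real_cases[OF p(1), of x K] obtain u v where
        "K = {u..v}" "u \<le> v" "v \<le> b" "Inf K = u" "Sup K = v" by metis
      moreover from \<open>(x, K) \<in> q\<close> obtain u' v' where "K = {u'..v'}" "b \<le> u'" "u' \<le> v'" "Inf K = u'" "Sup K = v'"
        using tagged_division_of_real_cases[of q b c x K] q by metis
      ultimately have "Sup K = Inf K" by simp
      then show "g x * (B (Sup K) \<omega> - B (Inf K) \<omega>) = 0" by simp
    qed
    have sq: "square_integrable M (\<lambda>\<omega>. RS_sum g B (p \<union> q) \<omega> - J2 \<omega>)" "square_integrable M (\<lambda>\<omega>. RS_sum g B p \<omega> - J1 \<omega>)"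
      using RS_sum_square_integrable[OF B un abc(1)] RS_sum_square_integrable[OF B p(1) abc(1)] J
      by (auto intro: square_integrable_diff)
    note int = sq[unfolded square_integrable_real_iff, THEN conjunct2]
    have eq: "(\<Sum>(x, K)\<in>q. g x * (B (Sup K) \<omega> - B (Inf K) \<omega>)) - (J2 \<omega> - J1 \<omega>) =
        (RS_sum g B (p \<union> q) \<omega> - J2 \<omega>) - (RS_sum g B p \<omega> - J1 \<omega>)" for \<omega>
      by (simp add: RS_un) (simp add: RS_sum_def)
    have "(\<integral>\<omega>. ((\<Sum>(x, K)\<in>q. g x * (B (Sup K) \<omega> - B (Inf K) \<omega>)) - (J2 \<omega> - J1 \<omega>))\<^sup>2 \<partial>M) \<le>
       (\<integral>\<omega>. 2 * (RS_sum g B (p \<union> q) \<omega> - J2 \<omega>)\<^sup>2 + 2 * (RS_sum g B p \<omega> - J1 \<omega>)\<^sup>2 \<partial>M)"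
      unfolding eq
    proof (rule integral_mono)
      show "integrable M (\<lambda>\<omega>. ((RS_sum g B (p \<union> q) \<omega> - J2 \<omega>) - (RS_sum g B p \<omega> - J1 \<omega>))\<^sup>2)"
        using square_integrable_diff[OF sq] by (simp add: square_integrable_real_iff)
      show "((RS_sum g B (p \<union> q) \<omega> - J2 \<omega>) - (RS_sum g B p \<omega> - J1 \<omega>))\<^sup>2 \<le>
          2 * (RS_sum g B (p \<union> q) \<omega> - J2 \<omega>)\<^sup>2 + 2 * (RS_sum g B p \<omega> - J1 \<omega>)\<^sup>2" for \<omega>
        by (rule power2_diff_le)
    qed (use int in auto)
    also have "\<dots> = 2 * (\<integral>\<omega>. (RS_sum g B (p \<union> q) \<omega> - J2 \<omega>)\<^sup>2 \<partial>M) + 2 * (\<integral>\<omega>. (RS_sum g B p \<omega> - J1 \<omega>)\<^sup>2 \<partial>M)"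
      using int by simp
    also have "\<dots> < 2 * (e / 4) + 2 * (e / 4)"
      using d1(2)[of p] d2(2)[of "p \<union> q"] p q un fine[of p d1] fine[of "p \<union> q" d2] fine_Un[of "\<lambda>x. ball x d" p q]
      by (intro add_strict_mono mult_strict_left_mono) (auto simp: d_def)
    finally show "(\<integral>\<omega>. ((\<Sum>(x, K)\<in>q. g x * (B (Sup K) \<omega> - B (Inf K) \<omega>)) - (J2 \<omega> - J1 \<omega>))\<^sup>2 \<partial>M) < e"
      by simp
  qed
qed

lemma (in prob_space) has_RS_integral_mult_limit:
  assumes B: "real_fBm M H A B" "real_fBm M H' A' B'" and ac: "0 \<le> a" "0 \<le> c"
    and J: "has_RS_integral M g B a b J" and J': "has_RS_integral M h B' c d J'"
  shows "\<exists>p q. (\<forall>n. p n tagged_division_of {a..b}) \<and> (\<forall>n. q n tagged_division_of {c..d}) \<and>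
    (\<lambda>n. expectation (\<lambda>\<omega>. RS_sum g B (p n) \<omega> * RS_sum h B' (q n) \<omega>)) \<longlonglongrightarrow> expectation (\<lambda>\<omega>. J \<omega> * J' \<omega>)"
proof -
  obtain p where p: "\<And>n. p n tagged_division_of {a..b}"
    "(\<lambda>n. expectation (\<lambda>\<omega>. (RS_sum g B (p n) \<omega> - J \<omega>)\<^sup>2)) \<longlonglongrightarrow> 0"
    using has_RS_integral_sequence[OF J] by blast
  obtain q where q: "\<And>n. q n tagged_division_of {c..d}"
    "(\<lambda>n. expectation (\<lambda>\<omega>. (RS_sum h B' (q n) \<omega> - J' \<omega>)\<^sup>2)) \<longlonglongrightarrow> 0"
    using has_RS_integral_sequence[OF J'] by blast
  have "(\<lambda>n. expectation (\<lambda>\<omega>. RS_sum g B (p n) \<omega> * RS_sum h B' (q n) \<omega>)) \<longlonglongrightarrow> expectation (\<lambda>\<omega>. J \<omega> * J' \<omega>)"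
    by (rule tendsto_integral_mult)
      (use p q J J' in \<open>auto simp: has_RS_integral_def intro!: always_eventually RS_sum_square_integrable[OF B(1) p(1) ac(1)]
         RS_sum_square_integrable[OF B(2) q(1) ac(2)]\<close>)
  with p q show ?thesis by blast
qed

lemma (in prob_space) has_RS_integral_square_limit:
  assumes B: "real_fBm M H A B" and a: "0 \<le> a" and J: "has_RS_integral M g B a b J"
  shows "\<exists>p. (\<forall>n. p n tagged_division_of {a..b}) \<and>
    (\<lambda>n. expectation (\<lambda>\<omega>. (RS_sum g B (p n) \<omega>)\<^sup>2)) \<longlonglongrightarrow> expectation (\<lambda>\<omega>. (J \<omega>)\<^sup>2)"
proof -
  obtain p where p: "\<And>n. p n tagged_division_of {a..b}"
    "(\<lambda>n. expectation (\<lambda>\<omega>. (RS_sum g B (p n) \<omega> - J \<omega>)\<^sup>2)) \<longlonglongrightarrow> 0"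
    using has_RS_integral_sequence[OF J] by blast
  have "(\<lambda>n. expectation (\<lambda>\<omega>. RS_sum g B (p n) \<omega> * RS_sum g B (p n) \<omega>)) \<longlonglongrightarrow> expectation (\<lambda>\<omega>. J \<omega> * J \<omega>)"
    by (rule tendsto_integral_mult)
      (use p J in \<open>auto simp: has_RS_integral_def intro!: always_eventually RS_sum_square_integrable[OF B p(1) a]\<close>)
  with p show ?thesis unfolding power2_eq_square by blast
qed

lemma (in prob_space) has_RS_integral_upper:
  assumes B: "real_fBm M H A B" and H: "1 / 2 \<le> H" and a: "0 \<le> a" "a \<le> b"
    and g: "\<And>s. s \<in> {a..b} \<Longrightarrow> \<bar>g s\<bar> \<le> m" and J: "has_RS_integral M g B a b J"
  shows "expectation (\<lambda>\<omega>. (J \<omega>)\<^sup>2) \<le> m\<^sup>2 * (A * (b - a) powr (2 * H))"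
proof -
  obtain p where p: "\<And>n. p n tagged_division_of {a..b}"
    and lim: "(\<lambda>n. expectation (\<lambda>\<omega>. (RS_sum g B (p n) \<omega>)\<^sup>2)) \<longlonglongrightarrow> expectation (\<lambda>\<omega>. (J \<omega>)\<^sup>2)"
    using has_RS_integral_square_limit[OF B a(1) J] by blast
  from lim show ?thesis
    by (rule tendsto_upperbound) (auto intro!: always_eventually RS_sum_upper[OF B H p a g])
qed

lemma (in prob_space) has_RS_integral_lower:
  assumes B: "real_fBm M H A B" and H: "1 / 2 \<le> H" and a: "0 \<le> a" "a \<le> b"
    and g: "\<And>s. s \<in> {a..b} \<Longrightarrow> m \<le> g s" and m: "0 \<le> m" and J: "has_RS_integral M g B a b J"
  shows "m\<^sup>2 * (A * (b - a) powr (2 * H)) \<le> expectation (\<lambda>\<omega>. (J \<omega>)\<^sup>2)"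
proof -
  obtain p where p: "\<And>n. p n tagged_division_of {a..b}"
    and lim: "(\<lambda>n. expectation (\<lambda>\<omega>. (RS_sum g B (p n) \<omega>)\<^sup>2)) \<longlonglongrightarrow> expectation (\<lambda>\<omega>. (J \<omega>)\<^sup>2)"
    using has_RS_integral_square_limit[OF B a(1) J] by blast
  from lim show ?thesis
    by (rule tendsto_lowerbound) (auto intro!: always_eventually RS_sum_lower[OF B H p a g m])
qed

lemma (in prob_space) has_RS_integral_cross:
  assumes B: "real_fBm M H A B" and H: "1 / 2 \<le> H" and abc: "0 \<le> a" "a \<le> b" "b \<le> c"
    and g: "\<And>s. s \<in> {a..c} \<Longrightarrow> 0 \<le> g s"
    and J: "has_RS_integral M g B a b J" and J': "has_RS_integral M g B b c J'"
  shows "0 \<le> expectation (\<lambda>\<omega>. J \<omega> * J' \<omega>)"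
proof -
  have b: "0 \<le> b" using abc by simp
  obtain p q where p: "\<And>n. p n tagged_division_of {a..b}" and q: "\<And>n. q n tagged_division_of {b..c}"
    and lim: "(\<lambda>n. expectation (\<lambda>\<omega>. RS_sum g B (p n) \<omega> * RS_sum g B (q n) \<omega>)) \<longlonglongrightarrow> expectation (\<lambda>\<omega>. J \<omega> * J' \<omega>)"
    using has_RS_integral_mult_limit[OF B B abc(1) b J J'] by blast
  from lim show ?thesis
    by (rule tendsto_lowerbound) (auto intro!: always_eventually RS_sum_cross[OF B H p q abc g])
qed

lemma (in prob_space) has_RS_integral_uncorrelated:
  assumes B: "real_fBm M H A B" "real_fBm M H' A' B'" and ac: "0 \<le> a" "0 \<le> c"
    and uncor: "\<And>u v u' v'. 0 \<le> u \<Longrightarrow> 0 \<le> v \<Longrightarrow> 0 \<le> u' \<Longrightarrow> 0 \<le> v' \<Longrightarrow>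
      expectation (\<lambda>\<omega>. (B v \<omega> - B u \<omega>) * (B' v' \<omega> - B' u' \<omega>)) = 0"
    and J: "has_RS_integral M g B a b J" and J': "has_RS_integral M h B' c d J'"
  shows "expectation (\<lambda>\<omega>. J \<omega> * J' \<omega>) = 0"
proof -
  obtain p q where p: "\<And>n. p n tagged_division_of {a..b}" and q: "\<And>n. q n tagged_division_of {c..d}"
    and "(\<lambda>n. expectation (\<lambda>\<omega>. RS_sum g B (p n) \<omega> * RS_sum h B' (q n) \<omega>)) \<longlonglongrightarrow> expectation (\<lambda>\<omega>. J \<omega> * J' \<omega>)"
    using has_RS_integral_mult_limit[OF B ac J J'] by blast
  moreover have "expectation (\<lambda>\<omega>. RS_sum g B (p n) \<omega> * RS_sum h B' (q n) \<omega>) = 0" for n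
    unfolding RS_sum_mult_expectation[OF B(1) p ac(1) B(2) q ac(2)]
  proof (intro sum.neutral ballI, clarify, intro sum.neutral ballI, clarify)
    fix x K y L assume K: "(x, K) \<in> p n" and L: "(y, L) \<in> q n"
    from tagged_division_of_real_cases[OF p K] obtain u v where
      1: "a \<le> u" "u \<le> v" "Inf K = u" "Sup K = v" by metis
    from tagged_division_of_real_cases[OF q L] obtain u' v' where
      2: "c \<le> u'" "u' \<le> v'" "Inf L = u'" "Sup L = v'" by metis
    have "expectation (\<lambda>\<omega>. (B (Sup K) \<omega> - B (Inf K) \<omega>) * (B' (Sup L) \<omega> - B' (Inf L) \<omega>)) = 0"
      unfolding 1(3,4) 2(3,4) by (rule uncor) (use 1 2 ac in auto)
    then show "g x * h y * expectation (\<lambda>\<omega>. (B (Sup K) \<omega> - B (Inf K) \<omega>) * (B' (Sup L) \<omega> - B' (Inf L) \<omega>)) = 0" by simp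
  qed
  ultimately show ?thesis by (simp add: LIMSEQ_const_iff)
qed

section \<open>Improper integrals along dyadic blocks\<close>

lemma filterlim_dyadic_at_left:
  fixes t \<delta> :: real
  assumes "0 < \<delta>"
  shows "filterlim (\<lambda>n. t - \<delta> / 2 ^ n) (at_left t) sequentially"
proof -
  have "(\<lambda>n. \<delta> / 2 ^ n) \<longlonglongrightarrow> 0" by (rule LIMSEQ_divide_realpow_zero) simp
  then have "(\<lambda>n. t - \<delta> / 2 ^ n) \<longlonglongrightarrow> t - 0" by (intro tendsto_diff tendsto_const)
  then show ?thesis using assms by (simp add: filterlim_at)
qed

text \<open>Along these dyadic points each block is as long as the distance from its right end to t.
  On that scale (t - s)^(\<beta> - 1) changes only by a bounded factor, so that constants are
  adequate comparison integrands.\<close>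

lemma (in prob_space) improper_RS_integral_sequence:
  assumes B: "real_fBm M H A B" and I: "has_improper_RS_integral M g B t I"
    and \<delta>: "0 < \<delta>" "\<delta> \<le> t"
  obtains J where "\<And>u. u \<in> {0..<t} \<Longrightarrow> has_RS_integral M g B 0 u (J u)"
    "(\<lambda>n. expectation (\<lambda>\<omega>. (J (t - \<delta> / 2 ^ n) \<omega>)\<^sup>2)) \<longlonglongrightarrow> expectation (\<lambda>\<omega>. (I \<omega>)\<^sup>2)"
proof -
  obtain J where J: "\<And>u. u \<in> {0..<t} \<Longrightarrow> has_RS_integral M g B 0 u (J u)"
    and lim: "((\<lambda>u. expectation (\<lambda>\<omega>. (J u \<omega> - I \<omega>)\<^sup>2)) \<longlongrightarrow> 0) (at_left t)"
    using I unfolding has_improper_RS_integral_def by blast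
  have u: "t - \<delta> / 2 ^ n \<in> {0..<t}" for n
  proof -
    have "\<delta> / 2 ^ n \<le> \<delta> / 1" using \<delta> by (intro divide_left_mono) auto
    then show ?thesis using \<delta> by auto
  qed
  have "(\<lambda>n. expectation (\<lambda>\<omega>. J (t - \<delta> / 2 ^ n) \<omega> * J (t - \<delta> / 2 ^ n) \<omega>)) \<longlonglongrightarrow> expectation (\<lambda>\<omega>. I \<omega> * I \<omega>)"
    by (rule tendsto_integral_mult)
      (use J[OF u] I filterlim_compose[OF lim filterlim_dyadic_at_left[OF \<delta>(1)]] in
        \<open>auto simp: has_RS_integral_def has_improper_RS_integral_def intro!: always_eventually\<close>)
  then show thesis using that[of J] J by (simp add: power2_eq_square)
qed

text \<open>On a block of length w at distance w from t the integrand is at most m w^(\<beta> - 1)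
  and the increment of B has standard deviation sqrt(A) w^H, so the block has L2 norm at most m
  sqrt(A) w^(\<beta> + H - 1). Minkowski's inequality adds these norms to a geometric series with
  ratio 2^(1 - \<beta> - H) < 1.\<close>

lemma (in prob_space) improper_RS_integral_upper:
  assumes B: "real_fBm M H A B" and H: "1 / 2 \<le> H" and \<beta>: "\<beta> \<le> 1" "1 < \<beta> + H" and t: "0 < t" and m: "0 \<le> m"
    and g: "\<And>s. 0 \<le> s \<Longrightarrow> s < t \<Longrightarrow> \<bar>g s\<bar> \<le> m * (t - s) powr (\<beta> - 1)"
    and I: "has_improper_RS_integral M g B t I"
  shows "expectation (\<lambda>\<omega>. (I \<omega>)\<^sup>2) \<le> (m * t powr (\<beta> + H - 1) / (1 - 2 powr (1 - \<beta> - H)))\<^sup>2 * A"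
proof -
  define \<theta> where "\<theta> = \<beta> + H - 1"
  define r :: real where "r = 2 powr (- \<theta>)"
  have \<theta>: "\<theta> > 0" using \<beta> by (simp add: \<theta>_def)
  have r: "0 < r" "r < 1" using \<theta> powr_less_mono[of "- \<theta>" 0 2] by (auto simp: r_def)
  have A: "0 \<le> A" by (rule real_fBm_variance_nonneg[OF B])
  obtain J where J: "\<And>u. u \<in> {0..<t} \<Longrightarrow> has_RS_integral M g B 0 u (J u)"
    and lim: "(\<lambda>n. expectation (\<lambda>\<omega>. (J (t - t / 2 ^ n) \<omega>)\<^sup>2)) \<longlonglongrightarrow> expectation (\<lambda>\<omega>. (I \<omega>)\<^sup>2)"
    using improper_RS_integral_sequence[OF B I t order.refl] by blast
  define u where "u n = t - t / 2 ^ n" for n :: nat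
  have u: "0 \<le> u n" "u n \<le> u (Suc n)" "u n < t" for n
    using t by (auto simp: u_def field_simps)
  define k where "k = m * sqrt A * t powr \<theta>"
  have k: "k \<ge> 0" using m A by (simp add: k_def)
  define N where "N n = sqrt (expectation (\<lambda>\<omega>. (J (u n) \<omega>)\<^sup>2))" for n
  have Ju: "has_RS_integral M g B 0 (u n) (J (u n))" for n using J u by auto
  then have sq: "square_integrable M (J (u n))" for n by (simp add: has_RS_integral_def)
  \<comment> \<open>Since \<open>u 0 = 0\<close>, this integral runs over a single point; the
    general bound gives 0 through the zero length.\<close>
  have N0: "N 0 = 0"
  proof -
    have "expectation (\<lambda>\<omega>. (J (u 0) \<omega>)\<^sup>2) \<le> (m * t powr (\<beta> - 1))\<^sup>2 * (A * (u 0 - 0) powr (2 * H))"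
    proof (rule has_RS_integral_upper[OF B H _ _ _ Ju])
      fix s assume "s \<in> {0..u 0}"
      then show "\<bar>g s\<bar> \<le> m * t powr (\<beta> - 1)" using g[of 0] t by (auto simp: u_def)
    qed (use u in auto)
    also have "\<dots> = 0" by (simp add: u_def)
    finally show ?thesis by (simp add: N_def antisym)
  qed
  have step: "N (Suc n) \<le> N n + k * r ^ Suc n" for n
  proof -
    define w where "w = t / 2 ^ Suc n"
    have w: "w > 0" "t - u (Suc n) = w" "u (Suc n) - u n = w" using t by (auto simp: w_def u_def field_simps)
    let ?D = "\<lambda>\<omega>. J (u (Suc n)) \<omega> - J (u n) \<omega>"
    have D: "has_RS_integral M g B (u n) (u (Suc n)) ?D"
      by (rule has_RS_integral_additive[OF B order.refl _ _ Ju Ju]) (use u in auto)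
    have "expectation (\<lambda>\<omega>. (?D \<omega>)\<^sup>2) \<le> (m * w powr (\<beta> - 1))\<^sup>2 * (A * (u (Suc n) - u n) powr (2 * H))"
    proof (rule has_RS_integral_upper[OF B H _ _ _ D])
      fix s assume s: "s \<in> {u n..u (Suc n)}"
      have "s < t" "0 \<le> s" using s u[of n] u[of "Suc n"] by auto
      then have "\<bar>g s\<bar> \<le> m * (t - s) powr (\<beta> - 1)" using g by auto
      also have "\<dots> \<le> m * w powr (\<beta> - 1)"
        using s w \<beta> m by (intro mult_left_mono powr_mono2') auto
      finally show "\<bar>g s\<bar> \<le> m * w powr (\<beta> - 1)" .
    qed (use u in auto)
    also have "\<dots> = (k * r ^ Suc n)\<^sup>2"
    proof -
      have "k * r ^ Suc n = m * sqrt A * w powr \<theta>"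
      proof -
        have "r ^ Suc n = r powr real (Suc n)" using r by (simp only: powr_realpow)
        also have "\<dots> = 2 powr (- \<theta> * real (Suc n))" by (simp only: r_def powr_powr)
        also have "\<dots> = (2 ^ Suc n) powr (- \<theta>)" by (simp add: powr_powr mult.commute flip: powr_realpow del: power_Suc)
        finally have "r ^ Suc n = 1 / (2 ^ Suc n) powr \<theta>" by (simp only: powr_minus_divide)
        moreover have "w powr \<theta> = t powr \<theta> / (2 ^ Suc n) powr \<theta>"
          unfolding w_def by (rule powr_divide)
        ultimately show ?thesis by (simp add: k_def del: power_Suc)
      qed
      then have "(k * r ^ Suc n)\<^sup>2 = m\<^sup>2 * A * (w powr \<theta>)\<^sup>2" using A by (simp add: power_mult_distrib)
      also have "(w powr \<theta>)\<^sup>2 = (w powr (\<beta> - 1))\<^sup>2 * w powr (2 * H)"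
        using w by (simp add: \<theta>_def power2_eq_square algebra_simps flip: powr_add)
      finally show ?thesis using w by (simp add: power_mult_distrib)
    qed
    finally have "sqrt (expectation (\<lambda>\<omega>. (?D \<omega>)\<^sup>2)) \<le> k * r ^ Suc n"
      using k r by (intro real_le_lsqrt) auto
    moreover have "N (Suc n) \<le> N n + sqrt (expectation (\<lambda>\<omega>. (?D \<omega>)\<^sup>2))"
      using Minkowski_integral[OF sq[of n] square_integrable_diff[OF sq[of "Suc n"] sq[of n]]] by (simp add: N_def)
    ultimately show ?thesis by simp
  qed
  have "N n \<le> k * (\<Sum>i<n. r ^ Suc i)" for n
  proof (induction n)
    case (Suc n)
    show ?case using step[of n] Suc by (simp add: algebra_simps)
  qed (simp add: N0)
  also have "k * (\<Sum>i<n. r ^ Suc i) \<le> k / (1 - r)" for n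
  proof -
    \<comment> \<open>The sum starts at r, but it is bounded by the full geometric series for a
      simpler constant.\<close>
    have "(\<Sum>i<n. r ^ Suc i) \<le> (\<Sum>i<n. r ^ i)" using r by (intro sum_mono power_decreasing) auto
    also have "\<dots> \<le> (\<Sum>i. r ^ i)" using r by (intro sum_le_suminf summable_geometric) auto
    also have "\<dots> = 1 / (1 - r)" using r by (intro suminf_geometric) auto
    finally show ?thesis using k mult_left_mono[of _ "1 / (1 - r)" k] by simp
  qed
  finally have Nb: "N n \<le> k / (1 - r)" for n .
  have "expectation (\<lambda>\<omega>. (I \<omega>)\<^sup>2) \<le> (k / (1 - r))\<^sup>2"
  proof (rule tendsto_upperbound[OF lim])
    show "\<forall>\<^sub>F n in sequentially. expectation (\<lambda>\<omega>. (J (t - t / 2 ^ n) \<omega>)\<^sup>2) \<le> (k / (1 - r))\<^sup>2"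
    proof (rule always_eventually, rule allI)
      fix n
      have "(N n)\<^sup>2 \<le> (k / (1 - r))\<^sup>2" using Nb[of n] by (intro power_mono) (auto simp: N_def)
      then show "expectation (\<lambda>\<omega>. (J (t - t / 2 ^ n) \<omega>)\<^sup>2) \<le> (k / (1 - r))\<^sup>2"
        by (simp add: N_def u_def)
    qed
  qed simp
  also have "\<dots> = (m * t powr (\<beta> + H - 1) / (1 - 2 powr (1 - \<beta> - H)))\<^sup>2 * A"
    using A by (simp add: k_def r_def \<theta>_def power_mult_distrib power_divide algebra_simps)
  finally show ?thesis .
qed

text \<open>Every dyadic block next to \<open>t\<close> contributes at least a fixed multiple of \<open>A\<close> to the variance.\<close>

lemma (in prob_space) improper_RS_integral_degenerate:
  assumes B: "real_fBm M H A B" and H: "1 / 2 \<le> H" and \<beta>: "\<beta> \<le> 1" "\<beta> + H \<le> 1"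
    and m: "0 < m" and \<delta>: "0 < \<delta>" "\<delta> \<le> t"
    and g0: "\<And>s. 0 \<le> s \<Longrightarrow> s < t \<Longrightarrow> 0 \<le> g s"
    and g: "\<And>s. t - \<delta> \<le> s \<Longrightarrow> s < t \<Longrightarrow> m * (t - s) powr (\<beta> - 1) \<le> g s"
    and I: "has_improper_RS_integral M g B t I"
  shows "A = 0"
proof -
  define \<theta> where "\<theta> = \<beta> + H - 1"
  have \<theta>: "\<theta> \<le> 0" using \<beta> by (simp add: \<theta>_def)
  have A: "0 \<le> A" by (rule real_fBm_variance_nonneg[OF B])
  obtain J where J: "\<And>u. u \<in> {0..<t} \<Longrightarrow> has_RS_integral M g B 0 u (J u)"
    and lim: "(\<lambda>n. expectation (\<lambda>\<omega>. (J (t - \<delta> / 2 ^ n) \<omega>)\<^sup>2)) \<longlonglongrightarrow> expectation (\<lambda>\<omega>. (I \<omega>)\<^sup>2)"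
    using improper_RS_integral_sequence[OF B I \<delta>] by blast
  define u where "u n = t - \<delta> / 2 ^ n" for n :: nat
  have u: "t - \<delta> \<le> u n" "u n \<le> u (Suc n)" "u n < t" for n
  proof -
    have "\<delta> / 2 ^ n \<le> \<delta> / 1" using \<delta> by (intro divide_left_mono) auto
    then show "t - \<delta> \<le> u n" by (simp add: u_def)
  qed (use \<delta> in \<open>auto simp: u_def field_simps\<close>)
  have u0: "0 \<le> u n" for n using u(1)[of n] \<delta> by linarith
  have Ju: "has_RS_integral M g B 0 (u n) (J (u n))" for n using J u u0 by auto
  then have sq: "square_integrable M (J (u n))" for n by (simp add: has_RS_integral_def)
  \<comment> \<open>A block of length w / 2 within distance w of t contributes at least
    \<open>m\<^sup>2 * w powr (2 * (\<beta> - 1))\<close> times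
    \<open>A * (w / 2) powr (2 * H)\<close>. As \<theta> \<le> 0 and w \<le> \<delta>, replacing w
    by \<delta> gives a bound that is the same for all blocks.\<close>
  define \<kappa> where "\<kappa> = m\<^sup>2 * \<delta> powr (2 * \<theta>) * 2 powr (- 2 * H)"
  have \<kappa>: "\<kappa> > 0" using m \<delta> by (simp add: \<kappa>_def)
  define N where "N n = expectation (\<lambda>\<omega>. (J (u n) \<omega>)\<^sup>2)" for n
  have step: "N n + \<kappa> * A \<le> N (Suc n)" for n
  proof -
    define w where "w = \<delta> / 2 ^ n"
    have w: "w > 0" "w \<le> \<delta>" "t - u n = w" "u (Suc n) - u n = w / 2" using \<delta> u(1)[of n] by (auto simp: w_def u_def field_simps)
    let ?D = "\<lambda>\<omega>. J (u (Suc n)) \<omega> - J (u n) \<omega>"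
    have D: "has_RS_integral M g B (u n) (u (Suc n)) ?D"
      by (rule has_RS_integral_additive[OF B order.refl _ _ Ju Ju]) (use u u0 in auto)
    have "(m * w powr (\<beta> - 1))\<^sup>2 * (A * (u (Suc n) - u n) powr (2 * H)) \<le> expectation (\<lambda>\<omega>. (?D \<omega>)\<^sup>2)"
    proof (rule has_RS_integral_lower[OF B H _ _ _ _ D])
      fix s assume s: "s \<in> {u n..u (Suc n)}"
      have "t - \<delta> \<le> s" "s < t" using s u[of n] u[of "Suc n"] by auto
      then have "m * (t - s) powr (\<beta> - 1) \<le> g s" using g by auto
      moreover have "m * w powr (\<beta> - 1) \<le> m * (t - s) powr (\<beta> - 1)"
        using s w \<beta> m \<open>s < t\<close> by (intro mult_left_mono powr_mono2') auto
      ultimately show "m * w powr (\<beta> - 1) \<le> g s" by linarith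
    qed (use u u0 m in auto)
    moreover have "\<kappa> * A \<le> (m * w powr (\<beta> - 1))\<^sup>2 * (A * (u (Suc n) - u n) powr (2 * H))"
    proof -
      have "\<delta> powr (2 * \<theta>) \<le> w powr (2 * \<theta>)" using w \<delta> \<theta> by (intro powr_mono2') auto
      then have "\<kappa> * A \<le> m\<^sup>2 * w powr (2 * \<theta>) * 2 powr (- 2 * H) * A"
        unfolding \<kappa>_def using A by (intro mult_right_mono mult_left_mono) auto
      also have "w powr (2 * \<theta>) = (w powr (\<beta> - 1))\<^sup>2 * w powr (2 * H)"
        using w by (simp add: \<theta>_def power2_eq_square algebra_simps flip: powr_add)
      finally have "\<kappa> * A \<le> m\<^sup>2 * ((w powr (\<beta> - 1))\<^sup>2 * w powr (2 * H)) * 2 powr (- 2 * H) * A" .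
      moreover have "(w / 2) powr (2 * H) = w powr (2 * H) * 2 powr (- 2 * H)"
        using powr_divide[of w 2 "2 * H"] powr_minus_divide[of 2 "2 * H"] by simp
      ultimately show ?thesis unfolding w(4) by (simp add: power_mult_distrib mult_ac)
    qed
    \<comment> \<open>The contributions cannot cancel: the integral up to \<open>u n\<close> and the
      next block are nonnegatively correlated, because the integrand is nonnegative on both.\<close>
    moreover have "N n + expectation (\<lambda>\<omega>. (?D \<omega>)\<^sup>2) \<le> N (Suc n)"
    proof -
      have D2: "square_integrable M ?D" using D by (simp add: has_RS_integral_def)
      note i = sq[of n, unfolded square_integrable_real_iff, THEN conjunct2] D2[unfolded square_integrable_real_iff, THEN conjunct2]
        integrable_mult_square_integrable[OF sq[of n] D2]
      have "(\<lambda>\<omega>. (J (u (Suc n)) \<omega>)\<^sup>2) = (\<lambda>\<omega>. (J (u n) \<omega>)\<^sup>2 + 2 * (J (u n) \<omega> * ?D \<omega>) + (?D \<omega>)\<^sup>2)"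
        by (auto simp: power2_eq_square algebra_simps)
      then have "N (Suc n) = N n + 2 * expectation (\<lambda>\<omega>. J (u n) \<omega> * ?D \<omega>) + expectation (\<lambda>\<omega>. (?D \<omega>)\<^sup>2)"
        unfolding N_def using i by simp
      moreover have "0 \<le> expectation (\<lambda>\<omega>. J (u n) \<omega> * ?D \<omega>)"
      proof (rule has_RS_integral_cross[OF B H _ _ _ _ Ju D])
        fix s assume "s \<in> {0..u (Suc n)}"
        then show "0 \<le> g s" using g0 u(3)[of "Suc n"] by auto
      qed (use u u0 in auto)
      ultimately show ?thesis by simp
    qed
    ultimately show ?thesis by linarith
  qed
  have lower: "real n * (\<kappa> * A) \<le> N n" for n
  proof (induction n)
    case (Suc n)
    then show ?case using step[of n] by (simp add: algebra_simps)
  qed (simp add: N_def)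
  \<comment> \<open>Existence of the improper integral bounds the second moments, whereas they grow
    at least like n times \<open>\<kappa> * A\<close>.\<close>
  have "Bseq N" using lim unfolding N_def u_def by (intro convergent_imp_Bseq convergentI)
  then obtain b where b: "\<And>n. norm (N n) \<le> b" unfolding Bseq_def by blast
  show "A = 0"
  proof (rule ccontr)
    assume "A \<noteq> 0"
    then have p: "\<kappa> * A > 0" using A \<kappa> by simp
    obtain n :: nat where "b < real n * (\<kappa> * A)" using reals_Archimedean3[OF p] by auto
    then show False using lower[of n] b[of n] by simp
  qed
qed

section \<open>Variance and orthogonality of the stochastic integrals\<close>

lemma (in prob_space) improper_RS_integral_uncorrelated:
  assumes B: "real_fBm M H A B" "real_fBm M H' A' B'" and t: "0 < t"
    and uncor: "\<And>u v u' v'. 0 \<le> u \<Longrightarrow> 0 \<le> v \<Longrightarrow> 0 \<le> u' \<Longrightarrow> 0 \<le> v' \<Longrightarrow>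
      expectation (\<lambda>\<omega>. (B v \<omega> - B u \<omega>) * (B' v' \<omega> - B' u' \<omega>)) = 0"
    and I: "has_improper_RS_integral M g B t I" "has_improper_RS_integral M h B' t I'"
  shows "expectation (\<lambda>\<omega>. I \<omega> * I' \<omega>) = 0"
proof -
  obtain J where J: "\<And>u. u \<in> {0..<t} \<Longrightarrow> has_RS_integral M g B 0 u (J u)"
    "((\<lambda>u. expectation (\<lambda>\<omega>. (J u \<omega> - I \<omega>)\<^sup>2)) \<longlongrightarrow> 0) (at_left t)"
    using I(1) unfolding has_improper_RS_integral_def by blast
  obtain J' where J': "\<And>u. u \<in> {0..<t} \<Longrightarrow> has_RS_integral M h B' 0 u (J' u)"
    "((\<lambda>u. expectation (\<lambda>\<omega>. (J' u \<omega> - I' \<omega>)\<^sup>2)) \<longlongrightarrow> 0) (at_left t)"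
    using I(2) unfolding has_improper_RS_integral_def by blast
  have ev: "\<forall>\<^sub>F u in at_left t. u \<in> {0..<t}"
    unfolding eventually_at_left_field using t by (auto intro!: exI[of _ 0])
  have "((\<lambda>u. expectation (\<lambda>\<omega>. J u \<omega> * J' u \<omega>)) \<longlongrightarrow> expectation (\<lambda>\<omega>. I \<omega> * I' \<omega>)) (at_left t)"
  proof (rule tendsto_integral_mult[OF _ _ _ _ J(2) J'(2)])
    show "\<forall>\<^sub>F u in at_left t. square_integrable M (J u)"
      using ev by eventually_elim (use J(1) in \<open>auto simp: has_RS_integral_def\<close>)
    show "\<forall>\<^sub>F u in at_left t. square_integrable M (J' u)"
      using ev by eventually_elim (use J'(1) in \<open>auto simp: has_RS_integral_def\<close>)
  qed (use I in \<open>auto simp: has_improper_RS_integral_def\<close>)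
  moreover have "\<forall>\<^sub>F u in at_left t. expectation (\<lambda>\<omega>. J u \<omega> * J' u \<omega>) = 0"
    using ev
    by eventually_elim (rule has_RS_integral_uncorrelated[OF B order.refl order.refl uncor J(1) J'(1)])
  ultimately have "((\<lambda>u. 0) \<longlongrightarrow> expectation (\<lambda>\<omega>. I \<omega> * I' \<omega>)) (at_left t)"
    by (rule Lim_transform_eventually)
  then show ?thesis
    using tendsto_unique[OF trivial_limit_at_left_real tendsto_const] by metis
qed

text \<open>Covers the range \<beta> + H \<le> 1, where the geometric series diverges: on each
  [0, u] with u < t the integrand is bounded, and the bound for its second moment carries the factor
  A = 0.\<close>

lemma (in prob_space) improper_RS_integral_zero_variance:
  assumes B: "real_fBm M H 0 B" and H: "1 / 2 \<le> H" and t: "0 < t"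
    and g: "\<And>u. u < t \<Longrightarrow> \<exists>m. \<forall>s\<in>{0..u}. \<bar>g s\<bar> \<le> m"
    and I: "has_improper_RS_integral M g B t I"
  shows "expectation (\<lambda>\<omega>. (I \<omega>)\<^sup>2) = 0"
proof -
  obtain J where J: "\<And>u. u \<in> {0..<t} \<Longrightarrow> has_RS_integral M g B 0 u (J u)"
    and lim: "(\<lambda>n. expectation (\<lambda>\<omega>. (J (t - t / 2 ^ n) \<omega>)\<^sup>2)) \<longlonglongrightarrow> expectation (\<lambda>\<omega>. (I \<omega>)\<^sup>2)"
    using improper_RS_integral_sequence[OF B I t order.refl] by blast
  have "expectation (\<lambda>\<omega>. (J (t - t / 2 ^ n) \<omega>)\<^sup>2) = 0" for n
  proof -
    have u: "0 \<le> t - t / 2 ^ n" "t - t / 2 ^ n < t" using t by (auto simp: field_simps)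
    obtain m where "\<forall>s\<in>{0..t - t / 2 ^ n}. \<bar>g s\<bar> \<le> m" using g[OF u(2)] by blast
    then have "expectation (\<lambda>\<omega>. (J (t - t / 2 ^ n) \<omega>)\<^sup>2) \<le> m\<^sup>2 * (0 * (t - t / 2 ^ n - 0) powr (2 * H))"
      by (intro has_RS_integral_upper[OF B H _ _ _ J]) (use u in auto)
    then show ?thesis by (simp add: antisym)
  qed
  then show ?thesis using lim by (simp add: LIMSEQ_const_iff)
qed

text \<open>The geometric series over the dyadic blocks that converge to \<open>t\<close>; it is finite only for
  \<open>\<beta> + H > 1\<close>, and otherwise \<open>A = 0\<close> makes the value irrelevant.\<close>

definition ml_variance_const :: "real \<Rightarrow> real \<Rightarrow> real \<Rightarrow> real" where
  "ml_variance_const \<beta> H t = (1 / Gamma \<beta> * t powr (\<beta> + H - 1) / (1 - 2 powr (1 - \<beta> - H)))\<^sup>2"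

text \<open>For \<beta> + H \<le> 1 the existence of the integral forces A = 0, after which the
  variance bound reads 0 \<le> 0 for any value of the constant. For \<beta> + H > 1 the kernel is
  majorised with m = 1 / Gamma(\<beta>), uniformly in c and hence in the degree.\<close>

lemma (in prob_space) ml_integral_variance:
  assumes B: "real_fBm M H A B" and H: "1 / 2 \<le> H" and \<beta>: "0 < \<beta>" "\<beta> \<le> 1" and t: "0 < t" and c: "0 \<le> c"
    and I: "has_improper_RS_integral M (ml_kernel \<beta> c t) B t I"
  shows "\<beta> + H \<le> 1 \<Longrightarrow> A = 0"
    and "expectation (\<lambda>\<omega>. (I \<omega>)\<^sup>2) \<le> ml_variance_const \<beta> H t * A"
proof -
  have G: "Gamma \<beta> > 0" using \<beta> by (intro Gamma_real_pos)
  note bounds = ml_kernel_bounds[OF \<beta> c]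
  show A0: "A = 0" if "\<beta> + H \<le> 1"
  proof -
    obtain \<delta> where \<delta>: "0 < \<delta>" "\<delta> \<le> t"
      "\<And>s. t - \<delta> \<le> s \<Longrightarrow> s < t \<Longrightarrow> (t - s) powr (\<beta> - 1) / (2 * Gamma \<beta>) \<le> ml_kernel \<beta> c t s"
      using ml_kernel_lower_bound[OF \<beta>(1) t] by blast
    show ?thesis
      by (rule improper_RS_integral_degenerate[OF B H \<beta>(2) that _ \<delta>(1,2) _ _ I, of "1 / (2 * Gamma \<beta>)"])
        (use G bounds(1) \<delta>(3) in auto)
  qed
  show "expectation (\<lambda>\<omega>. (I \<omega>)\<^sup>2) \<le> ml_variance_const \<beta> H t * A"
  proof (cases "\<beta> + H \<le> 1")
    case True
    note A = A0[OF True]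
    have "expectation (\<lambda>\<omega>. (I \<omega>)\<^sup>2) = 0"
    proof (rule improper_RS_integral_zero_variance[OF B[unfolded A] H t _ I])
      fix u assume u: "u < t"
      have "\<bar>ml_kernel \<beta> c t s\<bar> \<le> (t - u) powr (\<beta> - 1) / Gamma \<beta>" if "s \<in> {0..u}" for s
      proof -
        have "\<bar>ml_kernel \<beta> c t s\<bar> \<le> (t - s) powr (\<beta> - 1) / Gamma \<beta>" using bounds[of t s] by simp
        also have "\<dots> \<le> (t - u) powr (\<beta> - 1) / Gamma \<beta>"
          using that u \<beta> G by (intro divide_right_mono powr_mono2') auto
        finally show ?thesis .
      qed
      then show "\<exists>m. \<forall>s\<in>{0..u}. \<bar>ml_kernel \<beta> c t s\<bar> \<le> m" by blast
    qed
    then show ?thesis by (simp add: A)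
  next
    case False
    show ?thesis unfolding ml_variance_const_def
      by (rule improper_RS_integral_upper[OF B H \<beta>(2) _ t _ _ I]) (use False G bounds in auto)
  qed
qed

lemma (in prob_space) complex_ml_integral_variance:
  assumes B: "complex_fBm M H A B" and H: "1 / 2 \<le> H" and \<beta>: "0 < \<beta>" "\<beta> \<le> 1" and t: "0 < t" and c: "0 \<le> c"
    and I: "has_stochastic_integral M (ml_kernel \<beta> c t) B t I"
  shows "square_integrable M I"
    and "expectation (\<lambda>\<omega>. (norm (I \<omega>))\<^sup>2) \<le> 2 * ml_variance_const \<beta> H t * A"
    and "\<beta> + H \<le> 1 \<Longrightarrow> A = 0" and "0 \<le> A"
proof -
  have R: "real_fBm M H A (\<lambda>t \<omega>. Re (B t \<omega>))" "real_fBm M H A (\<lambda>t \<omega>. Im (B t \<omega>))"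
    using B by (auto simp: complex_fBm_def)
  have IR: "has_improper_RS_integral M (ml_kernel \<beta> c t) (\<lambda>s \<omega>. Re (B s \<omega>)) t (\<lambda>\<omega>. Re (I \<omega>))"
    "has_improper_RS_integral M (ml_kernel \<beta> c t) (\<lambda>s \<omega>. Im (B s \<omega>)) t (\<lambda>\<omega>. Im (I \<omega>))"
    using I by (auto simp: has_stochastic_integral_def)
  then have sq: "square_integrable M (\<lambda>\<omega>. Re (I \<omega>))" "square_integrable M (\<lambda>\<omega>. Im (I \<omega>))"
    by (auto simp: has_improper_RS_integral_def)
  then have int: "integrable M (\<lambda>\<omega>. (Re (I \<omega>))\<^sup>2)" "integrable M (\<lambda>\<omega>. (Im (I \<omega>))\<^sup>2)"
    by (auto simp: square_integrable_real_iff)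
  show "square_integrable M I" unfolding square_integrable_def
  proof
    show "I \<in> borel_measurable M"
      using sq by (auto simp: square_integrable_def borel_measurable_complex_iff)
    show "integrable M (\<lambda>\<omega>. (norm (I \<omega>))\<^sup>2)" unfolding cmod_power2 using int by auto
  qed
  \<comment> \<open>The factor 2 counts the real and the imaginary part, each driven by a motion of
    variance A.\<close>
  show "expectation (\<lambda>\<omega>. (norm (I \<omega>))\<^sup>2) \<le> 2 * ml_variance_const \<beta> H t * A"
    unfolding cmod_power2 using int ml_integral_variance(2)[OF R(1) H \<beta> t c IR(1)] ml_integral_variance(2)[OF R(2) H \<beta> t c IR(2)]
    by simp
  show "\<beta> + H \<le> 1 \<Longrightarrow> A = 0" using ml_integral_variance(1)[OF R(1) H \<beta> t c IR(1)] .
  show "0 \<le> A" by (rule real_fBm_variance_nonneg[OF R(1)])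
qed

text \<open>Independence is given for whole paths, as elements of a product space; an increment at
  fixed times is a measurable function of the path, and it is centred. The functions h and h' stand
  for \<open>Re\<close> or \<open>Im\<close>, so that one lemma serves all four pairings.\<close>

lemma (in prob_space) indep_paths_uncorrelated_increments:
  fixes B B' :: "real \<Rightarrow> 'a \<Rightarrow> complex" and h h' :: "complex \<Rightarrow> real"
  assumes ind: "indep_vars (\<lambda>_. path_space) X I" and ij: "i \<in> I" "j \<in> I" "i \<noteq> j"
    and X: "X i = sample_path B" "X j = sample_path B'"
    and h [measurable]: "h \<in> borel_measurable borel" "h' \<in> borel_measurable borel"
    and R: "real_fBm M H A (\<lambda>s \<omega>. h (B s \<omega>))" "real_fBm M H' A' (\<lambda>s \<omega>. h' (B' s \<omega>))"
    and uv: "0 \<le> u" "0 \<le> v" "0 \<le> u'" "0 \<le> v'"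
  shows "expectation (\<lambda>\<omega>. (h (B v \<omega>) - h (B u \<omega>)) * (h' (B' v' \<omega>) - h' (B' u' \<omega>))) = 0"
proof -
  \<comment> \<open>Packs the two functionals into one family, the form in which the product formula
    for independent variables applies over \<open>{i, j}\<close>.\<close>
  define Z where "Z k = (if k = i then (\<lambda>p::real \<Rightarrow> complex. h (p v) - h (p u)) else (\<lambda>p. h' (p v') - h' (p u')))" for k
  have Z: "Z k \<in> borel_measurable path_space" for k
  proof -
    have [measurable]: "(\<lambda>p::real \<Rightarrow> complex. p s) \<in> borel_measurable path_space" if "0 \<le> s" for s
      using that by (intro measurable_component_singleton) auto
    have "(\<lambda>p::real \<Rightarrow> complex. h (p v) - h (p u)) \<in> borel_measurable path_space"
      "(\<lambda>p::real \<Rightarrow> complex. h' (p v') - h' (p u')) \<in> borel_measurable path_space"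
      using uv by measurable
    then show ?thesis by (simp add: Z_def)
  qed
  have "indep_vars (\<lambda>_. path_space) X {i, j}"
    by (rule indep_vars_subset[OF ind]) (use ij in auto)
  then have indZ: "indep_vars (\<lambda>_. borel) (\<lambda>k \<omega>. Z k (X k \<omega>)) {i, j}"
    by (rule indep_vars_compose2) (rule Z)
  have Zi: "(\<lambda>\<omega>. Z i (X i \<omega>)) = (\<lambda>\<omega>. h (B v \<omega>) - h (B u \<omega>))"
    using uv X by (auto simp: Z_def sample_path_def)
  have Zj: "(\<lambda>\<omega>. Z j (X j \<omega>)) = (\<lambda>\<omega>. h' (B' v' \<omega>) - h' (B' u' \<omega>))"
    using uv X ij by (auto simp: Z_def sample_path_def)
  have sq: "square_integrable M (\<lambda>\<omega>. Z i (X i \<omega>))" "square_integrable M (\<lambda>\<omega>. Z j (X j \<omega>))"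
    unfolding Zi Zj using real_fBm_increment(1)[OF R(1)] real_fBm_increment(1)[OF R(2)] uv by auto
  have int: "integrable M (\<lambda>\<omega>. Z k (X k \<omega>))" if "k \<in> {i, j}" for k
  proof -
    have "square_integrable M (\<lambda>\<omega>. Z k (X k \<omega>))" using that sq by auto
    then have "(\<lambda>\<omega>. Z k (X k \<omega>)) \<in> borel_measurable M" "integrable M (\<lambda>\<omega>. (Z k (X k \<omega>))\<^sup>2)"
      by (auto simp: square_integrable_real_iff)
    then show ?thesis by (rule square_integrable_imp_integrable)
  qed
  have "expectation (\<lambda>\<omega>. \<Prod>k\<in>{i, j}. Z k (X k \<omega>)) = (\<Prod>k\<in>{i, j}. expectation (\<lambda>\<omega>. Z k (X k \<omega>)))"
    by (rule indep_vars_lebesgue_integral[OF _ indZ int]) auto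
  also have "\<dots> = 0"
    using ij(3) Zi real_fBm_increment(2)[OF R(1) uv(1,2)] by simp
  also have "(\<lambda>\<omega>. \<Prod>k\<in>{i, j}. Z k (X k \<omega>)) = (\<lambda>\<omega>. (h (B v \<omega>) - h (B u \<omega>)) * (h' (B' v' \<omega>) - h' (B' u' \<omega>)))"
    using ij(3) fun_cong[OF Zi] fun_cong[OF Zj] by simp
  finally show ?thesis .
qed

lemma integrable_mult_cnj_square_integrable:
  fixes f g :: "'a \<Rightarrow> complex"
  assumes "square_integrable M f" "square_integrable M g"
  shows "integrable M (\<lambda>x. f x * cnj (g x))"
proof -
  have [measurable]: "f \<in> borel_measurable M" "g \<in> borel_measurable M"
    using assms by (auto simp: square_integrable_def)
  have "(\<lambda>x. cnj (g x)) \<in> borel_measurable M"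
    by (rule measurable_compose[OF _ borel_measurable_continuous_onI[of cnj]]) (auto intro!: continuous_intros)
  then have "(\<lambda>x. f x * cnj (g x)) \<in> borel_measurable M" by measurable
  then show ?thesis
    by (rule Bochner_Integration.integrable_bound[OF integrable_mult_square_integrable[OF assms[THEN square_integrable_norm]]])
      (auto simp: norm_mult)
qed

text \<open>The real and imaginary parts of J times the conjugate of J' are signed sums of four real
  products, each with mean zero by uncorrelatedness of the driving increments.\<close>

lemma (in prob_space) indep_stochastic_integrals_orthogonal:
  fixes B B' :: "real \<Rightarrow> 'a \<Rightarrow> complex"
  assumes ind: "indep_vars (\<lambda>_. path_space) X I" and ij: "i \<in> I" "j \<in> I" "i \<noteq> j"
    and X: "X i = sample_path B" "X j = sample_path B'"
    and B: "complex_fBm M H A B" "complex_fBm M H' A' B'" and t: "0 < t"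
    and J: "has_stochastic_integral M g B t J" "has_stochastic_integral M g' B' t J'"
    and sq: "square_integrable M J" "square_integrable M J'"
  shows "expectation (\<lambda>\<omega>. J \<omega> * cnj (J' \<omega>)) = 0"
proof -
  have R: "real_fBm M H A (\<lambda>s \<omega>. Re (B s \<omega>))" "real_fBm M H A (\<lambda>s \<omega>. Im (B s \<omega>))"
    "real_fBm M H' A' (\<lambda>s \<omega>. Re (B' s \<omega>))" "real_fBm M H' A' (\<lambda>s \<omega>. Im (B' s \<omega>))"
    using B by (auto simp: complex_fBm_def)
  have I: "has_improper_RS_integral M g (\<lambda>s \<omega>. Re (B s \<omega>)) t (\<lambda>\<omega>. Re (J \<omega>))"
    "has_improper_RS_integral M g (\<lambda>s \<omega>. Im (B s \<omega>)) t (\<lambda>\<omega>. Im (J \<omega>))"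
    "has_improper_RS_integral M g' (\<lambda>s \<omega>. Re (B' s \<omega>)) t (\<lambda>\<omega>. Re (J' \<omega>))"
    "has_improper_RS_integral M g' (\<lambda>s \<omega>. Im (B' s \<omega>)) t (\<lambda>\<omega>. Im (J' \<omega>))"
    using J by (auto simp: has_stochastic_integral_def)
  note sqI = I[unfolded has_improper_RS_integral_def, THEN conjunct1]
  note ints = integrable_mult_square_integrable
  note unc = indep_paths_uncorrelated_increments[OF ind ij X]
  note zero = improper_RS_integral_uncorrelated[OF _ _ t]
  have "expectation (\<lambda>\<omega>. Re (J \<omega>) * Re (J' \<omega>)) = 0"
    by (rule zero[OF R(1,3) _ I(1,3)]) (rule unc[OF _ _ R(1,3)], auto)
  moreover have "expectation (\<lambda>\<omega>. Re (J \<omega>) * Im (J' \<omega>)) = 0"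
    by (rule zero[OF R(1,4) _ I(1,4)]) (rule unc[OF _ _ R(1,4)], auto)
  moreover have "expectation (\<lambda>\<omega>. Im (J \<omega>) * Re (J' \<omega>)) = 0"
    by (rule zero[OF R(2,3) _ I(2,3)]) (rule unc[OF _ _ R(2,3)], auto)
  moreover have "expectation (\<lambda>\<omega>. Im (J \<omega>) * Im (J' \<omega>)) = 0"
    by (rule zero[OF R(2,4) _ I(2,4)]) (rule unc[OF _ _ R(2,4)], auto)
  moreover note integrable_mult_cnj_square_integrable[OF sq]
  ultimately show ?thesis
    using ints[OF sqI(1,3)] ints[OF sqI(1,4)] ints[OF sqI(2,3)] ints[OF sqI(2,4)]
    by (intro complex_eqI) (simp_all flip: integral_Re integral_Im)
qed

lemma expectation_norm_sum_orthogonal: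
  fixes c :: "'j \<Rightarrow> 'a \<Rightarrow> complex" and a :: "'j \<Rightarrow> complex"
  assumes fin: "finite J" and sq: "\<And>j. j \<in> J \<Longrightarrow> square_integrable M (c j)"
    and orth: "\<And>i j. i \<in> J \<Longrightarrow> j \<in> J \<Longrightarrow> i \<noteq> j \<Longrightarrow> (\<integral>x. c i x * cnj (c j x) \<partial>M) = 0"
  shows "(\<integral>x. (norm (\<Sum>j\<in>J. c j x * a j))\<^sup>2 \<partial>M) = (\<Sum>j\<in>J. (\<integral>x. (norm (c j x))\<^sup>2 \<partial>M) * (norm (a j))\<^sup>2)"
proof -
  have "complex_of_real (\<integral>x. (norm (\<Sum>j\<in>J. c j x * a j))\<^sup>2 \<partial>M) =
      (\<integral>x. (\<Sum>i\<in>J. \<Sum>j\<in>J. (c i x * cnj (c j x)) * (a i * cnj (a j))) \<partial>M)"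
    unfolding integral_complex_of_real[symmetric] complex_norm_square
    by (simp add: sum_product mult_ac)
  also have "\<dots> = (\<Sum>i\<in>J. \<Sum>j\<in>J. (\<integral>x. c i x * cnj (c j x) \<partial>M) * (a i * cnj (a j)))"
    using integrable_mult_cnj_square_integrable[OF sq sq]
    by (simp add: Bochner_Integration.integral_sum)
  also have "\<dots> = (\<Sum>i\<in>J. (\<integral>x. c i x * cnj (c i x) \<partial>M) * (a i * cnj (a i)))"
  proof (rule sum.cong[OF refl])
    fix i assume i: "i \<in> J"
    have "(\<Sum>j\<in>J. (\<integral>x. c i x * cnj (c j x) \<partial>M) * (a i * cnj (a j))) =
        (\<Sum>j\<in>J. if j = i then (\<integral>x. c i x * cnj (c i x) \<partial>M) * (a i * cnj (a i)) else 0)"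
      by (rule sum.cong) (use orth i in auto)
    then show "(\<Sum>j\<in>J. (\<integral>x. c i x * cnj (c j x) \<partial>M) * (a i * cnj (a j))) =
        (\<integral>x. c i x * cnj (c i x) \<partial>M) * (a i * cnj (a i))"
      using fin i by simp
  qed
  also have "\<dots> = complex_of_real (\<Sum>j\<in>J. (\<integral>x. (norm (c j x))\<^sup>2 \<partial>M) * (norm (a j))\<^sup>2)"
    by (simp flip: complex_norm_square integral_complex_of_real)
  finally show ?thesis by (simp only: of_real_eq_iff)
qed

lemma norm_vec_power2: "(norm v)\<^sup>2 = (\<Sum>i\<in>UNIV. (norm (v $ i))\<^sup>2)" for v :: "'a::real_normed_vector ^ 'n"
  by (simp add: norm_vec_def L2_set_def sum_nonneg)

lemma square_integrable_vec:
  fixes f :: "'a \<Rightarrow> complex ^ 'n"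
  assumes "\<And>i. square_integrable M (\<lambda>x. f x $ i)"
  shows "square_integrable M f"
proof -
  have "(\<lambda>x. f x) \<in> borel_measurable M"
    by (rule borel_measurable_euclidean_space[THEN iffD2])
      (use assms in \<open>auto simp: square_integrable_def Basis_vec_def inner_axis intro!: borel_measurable_inner\<close>)
  moreover have "integrable M (\<lambda>x. (norm (f x))\<^sup>2)"
    unfolding norm_vec_power2 using assms by (auto simp: square_integrable_def)
  ultimately show ?thesis by (simp add: square_integrable_def)
qed

lemma square_integrable_mult_complex:
  fixes f :: "'a \<Rightarrow> complex"
  shows "square_integrable M f \<Longrightarrow> square_integrable M (\<lambda>x. f x * c)"
  by (auto simp: square_integrable_def norm_mult power_mult_distrib)

lemma expectation_norm_vec_sum_orthogonal:
  fixes c :: "'j \<Rightarrow> 'a \<Rightarrow> complex" and v :: "'j \<Rightarrow> complex ^ 'n"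
  assumes fin: "finite J" and sq: "\<And>j. j \<in> J \<Longrightarrow> square_integrable M (c j)"
    and orth: "\<And>i j. i \<in> J \<Longrightarrow> j \<in> J \<Longrightarrow> i \<noteq> j \<Longrightarrow> (\<integral>x. c i x * cnj (c j x) \<partial>M) = 0"
  shows "square_integrable M (\<lambda>x. \<Sum>j\<in>J. c j x *s v j)"
    and "(\<integral>x. (norm (\<Sum>j\<in>J. c j x *s v j))\<^sup>2 \<partial>M) = (\<Sum>j\<in>J. (\<integral>x. (norm (c j x))\<^sup>2 \<partial>M) * (norm (v j))\<^sup>2)"
proof -
  have sqi: "square_integrable M (\<lambda>x. \<Sum>j\<in>J. c j x * v j $ i)" for i
    by (intro square_integrable_sum square_integrable_mult_complex sq)
  then show "square_integrable M (\<lambda>x. \<Sum>j\<in>J. c j x *s v j)"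
    by (intro square_integrable_vec) simp
  have "(\<integral>x. (norm (\<Sum>j\<in>J. c j x *s v j))\<^sup>2 \<partial>M) = (\<integral>x. (\<Sum>i\<in>UNIV. (norm (\<Sum>j\<in>J. c j x * v j $ i))\<^sup>2) \<partial>M)"
    by (simp add: norm_vec_power2)
  also have "\<dots> = (\<Sum>i\<in>UNIV. \<integral>x. (norm (\<Sum>j\<in>J. c j x * v j $ i))\<^sup>2 \<partial>M)"
    using sqi by (intro Bochner_Integration.integral_sum) (auto simp: square_integrable_def)
  also have "\<dots> = (\<Sum>i\<in>UNIV. \<Sum>j\<in>J. (\<integral>x. (norm (c j x))\<^sup>2 \<partial>M) * (norm (v j $ i))\<^sup>2)"
    by (intro sum.cong refl expectation_norm_sum_orthogonal[OF fin sq orth])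
  also have "\<dots> = (\<Sum>j\<in>J. (\<integral>x. (norm (c j x))\<^sup>2 \<partial>M) * (norm (v j))\<^sup>2)"
    by (subst sum.swap) (simp add: norm_vec_power2 sum_distrib_left)
  finally show "(\<integral>x. (norm (\<Sum>j\<in>J. c j x *s v j))\<^sup>2 \<partial>M) = (\<Sum>j\<in>J. (\<integral>x. (norm (c j x))\<^sup>2 \<partial>M) * (norm (v j))\<^sup>2)" .
qed

section \<open>Complex polynomials and solid harmonics\<close>

text \<open>Polynomials in three real variables with complex coefficients, generated inductively so
  that differentiability, symmetry of second derivatives and the action of rotations follow by
  induction from the sum and product rules.\<close>

inductive cpoly :: "(real^3 \<Rightarrow> complex) \<Rightarrow> bool" where
  cpoly_const: "cpoly (\<lambda>x. c)"
| cpoly_coord: "cpoly (\<lambda>x. complex_of_real (x $ i))"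
| cpoly_add: "cpoly p \<Longrightarrow> cpoly q \<Longrightarrow> cpoly (\<lambda>x. p x + q x)"
| cpoly_mult: "cpoly p \<Longrightarrow> cpoly q \<Longrightarrow> cpoly (\<lambda>x. p x * q x)"

lemma partial_deriv_eqI:
  assumes "(f has_derivative (\<lambda>h. \<Sum>j\<in>UNIV. complex_of_real (h $ j) * d j)) (at x)"
  shows "partial_deriv i f x = d i"
proof -
  have "partial_deriv i f x = (\<Sum>j\<in>UNIV. complex_of_real (axis i 1 $ j) * d j)"
    unfolding partial_deriv_def frechet_derivative_at[OF assms, symmetric] by simp
  also have "\<dots> = (\<Sum>j\<in>UNIV. if j = i then d i else 0)"
    by (intro sum.cong) (auto simp: axis_def)
  also have "\<dots> = d i" by simp
  finally show ?thesis .
qed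

text \<open>\<open>partial_deriv\<close> can be evaluated only once differentiability is known. The
  induction therefore carries candidates d for the partial derivatives, together with the fact that
  they are polynomials.\<close>

lemma cpoly_has_derivative_ex:
  assumes "cpoly p"
  shows "\<exists>d. (\<forall>i. cpoly (d i)) \<and>
    (\<forall>x. (p has_derivative (\<lambda>h. \<Sum>j\<in>UNIV. complex_of_real (h $ j) * d j x)) (at x))"
  using assms
proof induction
  case (cpoly_const c)
  show ?case by (rule exI[of _ "\<lambda>i x. 0"]) (auto intro: cpoly.cpoly_const)
next
  case (cpoly_coord i)
  have "(\<Sum>j\<in>UNIV. complex_of_real (h $ j) * (if j = i then 1 else 0)) = complex_of_real (h $ i)" for h
    by (simp add: if_distrib cong: if_cong)
  moreover have "((\<lambda>x. complex_of_real (x $ i)) has_derivative (\<lambda>h. complex_of_real (h $ i))) (at x)" for x :: "real^3"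
    by (intro bounded_linear_imp_has_derivative bounded_linear_compose[OF bounded_linear_of_real bounded_linear_vec_nth])
  ultimately show ?case
    by (intro exI[of _ "\<lambda>j x. if j = i then 1 else 0"]) (simp add: cpoly.cpoly_const)
next
  case (cpoly_add p q)
  then obtain d e where *: "\<forall>i. cpoly (d i)" "\<forall>x. (p has_derivative (\<lambda>h. \<Sum>j\<in>UNIV. complex_of_real (h $ j) * d j x)) (at x)"
    "\<forall>i. cpoly (e i)" "\<forall>x. (q has_derivative (\<lambda>h. \<Sum>j\<in>UNIV. complex_of_real (h $ j) * e j x)) (at x)" by blast
  have "((\<lambda>x. p x + q x) has_derivative (\<lambda>h. (\<Sum>j\<in>UNIV. complex_of_real (h $ j) * (d j x + e j x)))) (at x)" for x
    using has_derivative_add[OF *(2)[rule_format, of x] *(4)[rule_format, of x]]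
    by (simp add: distrib_left sum.distrib)
  then show ?case using * by (intro exI[of _ "\<lambda>j x. d j x + e j x"]) (auto intro: cpoly.intros)
next
  case (cpoly_mult p q)
  then obtain d e where *: "\<forall>i. cpoly (d i)" "\<forall>x. (p has_derivative (\<lambda>h. \<Sum>j\<in>UNIV. complex_of_real (h $ j) * d j x)) (at x)"
    "\<forall>i. cpoly (e i)" "\<forall>x. (q has_derivative (\<lambda>h. \<Sum>j\<in>UNIV. complex_of_real (h $ j) * e j x)) (at x)" by blast
  have "((\<lambda>x. p x * q x) has_derivative (\<lambda>h. (\<Sum>j\<in>UNIV. complex_of_real (h $ j) * (p x * e j x + d j x * q x)))) (at x)" for x
    using has_derivative_mult[OF *(2)[rule_format, of x] *(4)[rule_format, of x]]
    by (simp add: distrib_left sum.distrib sum_distrib_left sum_distrib_right mult_ac)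
  moreover have "cpoly (\<lambda>x. p x * e j x + d j x * q x)" for j
    using cpoly_mult.hyps * by (intro cpoly.cpoly_add cpoly.cpoly_mult) auto
  ultimately show ?case by (intro exI[of _ "\<lambda>j x. p x * e j x + d j x * q x"]) auto
qed

lemma cpoly_has_derivative:
  assumes "cpoly p"
  shows "(p has_derivative (\<lambda>h. \<Sum>j\<in>UNIV. complex_of_real (h $ j) * partial_deriv j p x)) (at x)"
proof -
  obtain d where "(\<forall>i. cpoly (d i)) \<and>
    (\<forall>x. (p has_derivative (\<lambda>h. \<Sum>j\<in>UNIV. complex_of_real (h $ j) * d j x)) (at x))"
    using cpoly_has_derivative_ex[OF assms] ..
  then have d: "(p has_derivative (\<lambda>h. \<Sum>j\<in>UNIV. complex_of_real (h $ j) * d j x)) (at x)" by simp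
  then show ?thesis using partial_deriv_eqI[OF d] by simp
qed

lemma cpoly_partial_deriv:
  assumes "cpoly p"
  shows "cpoly (partial_deriv i p)"
proof -
  obtain d where d: "(\<forall>i. cpoly (d i)) \<and>
    (\<forall>x. (p has_derivative (\<lambda>h. \<Sum>j\<in>UNIV. complex_of_real (h $ j) * d j x)) (at x))"
    using cpoly_has_derivative_ex[OF assms] ..
  have "partial_deriv i p x = d i x" for x
    using d by (intro partial_deriv_eqI[where d="\<lambda>i. d i x"]) simp
  then have "partial_deriv i p = d i" by blast
  then show ?thesis using d by simp
qed

lemma continuous_on_cpoly: "cpoly p \<Longrightarrow> continuous_on A p"
  by (intro continuous_at_imp_continuous_on ballI has_derivative_continuous[OF cpoly_has_derivative])

lemma partial_deriv_const [simp]: "partial_deriv i (\<lambda>x. c) = (\<lambda>x. 0)"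
  by (rule ext, rule partial_deriv_eqI[where d="\<lambda>_. 0"]) simp

lemma partial_deriv_coord [simp]: "partial_deriv i (\<lambda>x. complex_of_real (x $ j)) = (\<lambda>x. if i = j then 1 else 0)"
proof (rule ext, rule partial_deriv_eqI[where d="\<lambda>i. if i = j then 1 else 0"])
  fix x :: "real^3"
  have "((\<lambda>x. complex_of_real (x $ j)) has_derivative (\<lambda>h. complex_of_real (h $ j))) (at x)"
    by (intro bounded_linear_imp_has_derivative bounded_linear_compose[OF bounded_linear_of_real bounded_linear_vec_nth])
  moreover have "(\<Sum>i\<in>UNIV. complex_of_real (h $ i) * (if i = j then 1 else 0)) = complex_of_real (h $ j)" for h :: "real^3"
    by (simp add: if_distrib cong: if_cong)
  ultimately show "((\<lambda>x. complex_of_real (x $ j)) has_derivative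
      (\<lambda>h. \<Sum>i\<in>UNIV. complex_of_real (h $ i) * (if i = j then 1 else 0))) (at x)" by simp
qed

lemma partial_deriv_add:
  assumes "cpoly p" "cpoly q"
  shows "partial_deriv i (\<lambda>x. p x + q x) = (\<lambda>x. partial_deriv i p x + partial_deriv i q x)"
proof (rule ext, rule partial_deriv_eqI)
  fix x
  show "((\<lambda>x. p x + q x) has_derivative (\<lambda>h. \<Sum>j\<in>UNIV. complex_of_real (h $ j) * (partial_deriv j p x + partial_deriv j q x))) (at x)"
    using has_derivative_add[OF assms[THEN cpoly_has_derivative, of x]] by (simp add: distrib_left sum.distrib)
qed

lemma partial_deriv_mult:
  assumes "cpoly p" "cpoly q"
  shows "partial_deriv i (\<lambda>x. p x * q x) = (\<lambda>x. p x * partial_deriv i q x + partial_deriv i p x * q x)"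
proof (rule ext, rule partial_deriv_eqI)
  fix x
  show "((\<lambda>x. p x * q x) has_derivative (\<lambda>h. \<Sum>j\<in>UNIV. complex_of_real (h $ j) *
      (p x * partial_deriv j q x + partial_deriv j p x * q x))) (at x)"
    using has_derivative_mult[OF assms[THEN cpoly_has_derivative, of x]]
    by (simp add: distrib_left sum.distrib sum_distrib_left sum_distrib_right mult_ac)
qed

lemma cpoly_cmult: "cpoly p \<Longrightarrow> cpoly (\<lambda>x. c * p x)"
  by (intro cpoly_mult cpoly_const)

lemma cpoly_diff: "cpoly p \<Longrightarrow> cpoly q \<Longrightarrow> cpoly (\<lambda>x. p x - q x)"
  using cpoly_add[OF _ cpoly_cmult[of q "-1"], of p] by simp

lemma cpoly_sum: "(\<And>k. k \<in> K \<Longrightarrow> cpoly (f k)) \<Longrightarrow> cpoly (\<lambda>x. \<Sum>k\<in>K. f k x)"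
  by (induction K rule: infinite_finite_induct) (auto intro: cpoly.intros)

lemma cpoly_power: "cpoly p \<Longrightarrow> cpoly (\<lambda>x. p x ^ n)"
  by (induction n) (auto intro: cpoly.intros)

lemma cpoly_cnj: "cpoly p \<Longrightarrow> cpoly (\<lambda>x. cnj (p x))"
  by (induction rule: cpoly.induct) (auto intro: cpoly.intros)

lemma partial_deriv_cmult:
  "cpoly p \<Longrightarrow> partial_deriv i (\<lambda>x. c * p x) = (\<lambda>x. c * partial_deriv i p x)"
  using partial_deriv_mult[OF cpoly_const[of c]] by simp

lemma partial_deriv_diff:
  assumes "cpoly p" "cpoly q"
  shows "partial_deriv i (\<lambda>x. p x - q x) = (\<lambda>x. partial_deriv i p x - partial_deriv i q x)"
  using partial_deriv_add[OF assms(1) cpoly_cmult[OF assms(2), of "-1"], of i] partial_deriv_cmult[OF assms(2), of i "-1"] by simp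

lemma partial_deriv_sum:
  "(\<And>k. k \<in> K \<Longrightarrow> cpoly (f k)) \<Longrightarrow>
    partial_deriv i (\<lambda>x. \<Sum>k\<in>K. f k x) = (\<lambda>x. \<Sum>k\<in>K. partial_deriv i (f k) x)"
  by (induction K rule: infinite_finite_induct) (auto simp: partial_deriv_add cpoly_sum)

lemma partial_deriv_power:
  assumes "cpoly p"
  shows "partial_deriv i (\<lambda>x. p x ^ n) = (\<lambda>x. of_nat n * p x ^ (n - 1) * partial_deriv i p x)"
proof (induction n)
  case (Suc n)
  show ?case
  proof (cases n)
    case (Suc k)
    then show ?thesis
      using partial_deriv_mult[OF assms cpoly_power[OF assms, of n], of i] Suc.IH
      by (auto simp: algebra_simps)
  qed simp
qed simp

lemma partial_deriv_cnj:
  assumes "cpoly p"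
  shows "partial_deriv i (\<lambda>x. cnj (p x)) = (\<lambda>x. cnj (partial_deriv i p x))"
proof (rule ext, rule partial_deriv_eqI)
  fix x
  show "((\<lambda>x. cnj (p x)) has_derivative (\<lambda>h. \<Sum>j\<in>UNIV. complex_of_real (h $ j) * cnj (partial_deriv j p x))) (at x)"
    using has_derivative_cnj[OF cpoly_has_derivative[OF assms, of x]] by simp
qed

lemma partial_deriv_commute:
  assumes "cpoly p"
  shows "partial_deriv i (partial_deriv j p) = partial_deriv j (partial_deriv i p)"
  using assms
proof induction
  case (cpoly_add p q)
  then show ?case by (simp add: partial_deriv_add cpoly_partial_deriv)
next
  case (cpoly_mult p q)
  then show ?case
    by (simp add: partial_deriv_add partial_deriv_mult cpoly_partial_deriv cpoly.cpoly_mult algebra_simps)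
qed simp_all

lemma real_polynomial_function_cpoly:
  assumes "real_polynomial_function u"
  shows "cpoly (\<lambda>x. complex_of_real (u x))"
  using assms
proof induction
  case (linear f)
  have "f x = (\<Sum>i\<in>UNIV. x $ i * f (axis i 1))" for x
  proof -
    interpret bounded_linear f by fact
    have "f x = f (\<Sum>i\<in>UNIV. x $ i *\<^sub>R axis i 1)"
      using basis_expansion[of x] by (simp add: scalar_mult_eq_scaleR)
    then show ?thesis by (simp add: sum scaleR)
  qed
  then have "(\<lambda>x. complex_of_real (f x)) = (\<lambda>x. \<Sum>i\<in>UNIV. complex_of_real (x $ i) * complex_of_real (f (axis i 1)))"
    by (metis (mono_tags, lifting) of_real_mult of_real_sum sum.cong)
  then show ?case by (simp only:) (intro cpoly_sum cpoly.intros)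
qed (auto intro: cpoly.intros)

lemma polynomial_function_cpoly:
  fixes p :: "real^3 \<Rightarrow> complex"
  assumes "polynomial_function p"
  shows "cpoly p"
proof -
  have "real_polynomial_function (Re \<circ> p)" "real_polynomial_function (Im \<circ> p)"
    using assms bounded_linear_Re bounded_linear_Im by (auto simp: polynomial_function_def)
  then have "cpoly (\<lambda>x. complex_of_real (Re (p x)) + \<i> * complex_of_real (Im (p x)))"
    by (intro cpoly_add cpoly_cmult) (auto dest: real_polynomial_function_cpoly simp: o_def)
  then show ?thesis by (simp flip: complex_eq)
qed

section \<open>Linear substitutions and solid harmonics\<close>

lemma linear_vec_nth_eq:
  fixes R :: "real^3 \<Rightarrow> real^3"
  assumes "linear R"
  shows "R x $ i = (\<Sum>j\<in>UNIV. matrix R $ i $ j * x $ j)"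
  using matrix_vector_mul(2)[OF assms, THEN fun_cong, of x] by (simp add: matrix_vector_mult_def vec_eq_iff)

lemma cpoly_compose_linear:
  assumes R: "linear R" and p: "cpoly p"
  shows "cpoly (\<lambda>x. p (R x))"
  using p
proof induction
  case (cpoly_coord i)
  show ?case unfolding linear_vec_nth_eq[OF R] of_real_sum of_real_mult
    by (intro cpoly_sum cpoly_cmult cpoly.cpoly_coord)
qed (auto intro: cpoly.intros)

lemma partial_deriv_compose_linear:
  assumes R: "linear R" and p: "cpoly p"
  shows "partial_deriv j (\<lambda>x. p (R x)) = (\<lambda>x. \<Sum>i\<in>UNIV. complex_of_real (matrix R $ i $ j) * partial_deriv i p (R x))"
proof (rule ext, rule partial_deriv_eqI)
  fix x
  have "(R has_derivative R) (at x)"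
    using R by (intro bounded_linear_imp_has_derivative) (simp add: linear_conv_bounded_linear)
  from has_derivative_compose[OF this cpoly_has_derivative[OF p]]
  have "((\<lambda>x. p (R x)) has_derivative (\<lambda>h. \<Sum>i\<in>UNIV. complex_of_real (R h $ i) * partial_deriv i p (R x))) (at x)" .
  also have "(\<lambda>h. \<Sum>i\<in>UNIV. complex_of_real (R h $ i) * partial_deriv i p (R x)) =
    (\<lambda>h. \<Sum>j\<in>UNIV. complex_of_real (h $ j) * (\<Sum>i\<in>UNIV. complex_of_real (matrix R $ i $ j) * partial_deriv i p (R x)))"
    unfolding linear_vec_nth_eq[OF R] of_real_sum of_real_mult sum_distrib_left sum_distrib_right
    by (rule ext, subst sum.swap) (simp add: mult_ac)
  finally show "((\<lambda>x. p (R x)) has_derivative (\<lambda>h. \<Sum>j\<in>UNIV. complex_of_real (h $ j) *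
     (\<Sum>i\<in>UNIV. complex_of_real (matrix R $ i $ j) * partial_deriv i p (R x)))) (at x)" .
qed

text \<open>The witness p of \<open>spherical_harmonic\<close>, kept as a function on all of space
  so that Euclidean derivatives make sense.\<close>

definition solid_harmonic :: "nat \<Rightarrow> (real^3 \<Rightarrow> complex) \<Rightarrow> bool" where
  "solid_harmonic l p \<longleftrightarrow> cpoly p \<and> (\<forall>c x. p (c *\<^sub>R x) = c ^ l *\<^sub>R p x) \<and> (\<forall>x. laplacian p x = 0)"

lemma spherical_harmonicE:
  assumes "spherical_harmonic l f"
  obtains p where "solid_harmonic l p" "\<And>x. x \<in> S2 \<Longrightarrow> f x = p x"
  using assms polynomial_function_cpoly unfolding spherical_harmonic_def solid_harmonic_def by metis

lemma solid_harmonic_cnj: "solid_harmonic l p \<Longrightarrow> solid_harmonic l (\<lambda>x. cnj (p x))"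
  unfolding solid_harmonic_def laplacian_def
  by (auto simp: cpoly_cnj partial_deriv_cnj cpoly_partial_deriv simp flip: cnj_sum)

lemma solid_harmonic_sum:
  assumes "\<And>k. k \<in> K \<Longrightarrow> solid_harmonic l (f k)"
  shows "solid_harmonic l (\<lambda>x. \<Sum>k\<in>K. c k * f k x)"
proof -
  have cp: "\<And>k. k \<in> K \<Longrightarrow> cpoly (f k)" using assms by (auto simp: solid_harmonic_def)
  have "partial_deriv i (partial_deriv i (\<lambda>x. \<Sum>k\<in>K. c k * f k x)) = (\<lambda>x. \<Sum>k\<in>K. c k * partial_deriv i (partial_deriv i (f k)) x)" for i
    using cp by (simp add: partial_deriv_sum partial_deriv_cmult cpoly_cmult cpoly_partial_deriv)
  then have "laplacian (\<lambda>x. \<Sum>k\<in>K. c k * f k x) x = (\<Sum>k\<in>K. c k * laplacian (f k) x)" for x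
    unfolding laplacian_def by (simp add: sum_distrib_left sum.swap[of _ K])
  then show ?thesis using assms cp
    by (auto simp: solid_harmonic_def cpoly_sum cpoly_cmult scaleR_sum_right intro!: sum.neutral sum.cong)
qed

text \<open>Two applications of the chain rule contract the second derivatives of p with the matrix
  product of R and its transpose, which is the identity; hence the Laplacian commutes with
  R.\<close>

lemma solid_harmonic_compose_orthogonal:
  assumes R: "orthogonal_transformation R" and p: "solid_harmonic l p"
  shows "solid_harmonic l (\<lambda>x. p (R x))"
proof -
  have lin: "linear R" and Q: "matrix R ** transpose (matrix R) = mat 1"
    using R by (auto simp: orthogonal_transformation_matrix orthogonal_matrix_def)
  have Qik: "(\<Sum>j\<in>UNIV. matrix R $ i $ j * matrix R $ k $ j) = (if i = k then 1 else 0)" for i k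
    using Q by (simp add: matrix_matrix_mult_def mat_def transpose_def vec_eq_iff)
  have cp: "cpoly p" using p by (simp add: solid_harmonic_def)
  have "partial_deriv j (partial_deriv j (\<lambda>x. p (R x))) = (\<lambda>x. \<Sum>i\<in>UNIV. \<Sum>k\<in>UNIV.
     complex_of_real (matrix R $ i $ j * matrix R $ k $ j) * partial_deriv k (partial_deriv i p) (R x))" for j
    using cp by (simp add: partial_deriv_compose_linear[OF lin] partial_deriv_sum cpoly_cmult partial_deriv_cmult
        cpoly_partial_deriv cpoly_compose_linear[OF lin] sum_distrib_left mult.assoc)
  then have "laplacian (\<lambda>x. p (R x)) x = (\<Sum>j\<in>UNIV. \<Sum>i\<in>UNIV. \<Sum>k\<in>UNIV.
     complex_of_real (matrix R $ i $ j * matrix R $ k $ j) * partial_deriv k (partial_deriv i p) (R x))" for x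
    by (simp add: laplacian_def)
  also have "\<dots> x = (\<Sum>i\<in>UNIV. \<Sum>k\<in>UNIV. \<Sum>j\<in>UNIV.
     complex_of_real (matrix R $ i $ j * matrix R $ k $ j) * partial_deriv k (partial_deriv i p) (R x))" for x
    by (subst sum.swap, rule sum.cong[OF refl], rule sum.swap)
  also have "\<dots> x = (\<Sum>i\<in>UNIV. \<Sum>k\<in>UNIV. (if i = k then partial_deriv k (partial_deriv i p) (R x) else 0))" for x
    by (intro sum.cong refl) (simp only: sum_distrib_right[symmetric] of_real_sum[symmetric] Qik, simp)
  also have "\<dots> x = laplacian p (R x)" for x by (simp add: laplacian_def)
  finally have "laplacian (\<lambda>x. p (R x)) x = laplacian p (R x)" for x .
  then show ?thesis using p cpoly_compose_linear[OF lin cp] linear_scale[OF lin]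
    by (simp add: solid_harmonic_def)
qed

text \<open>Both sides are the derivative of c to p(c x) at c = 1, by the chain rule and by
  homogeneity.\<close>

lemma solid_harmonic_euler:
  assumes p: "solid_harmonic l p"
  shows "(\<Sum>j\<in>UNIV. complex_of_real (x $ j) * partial_deriv j p x) = of_nat l * p x"
proof -
  have cp: "cpoly p" and hom: "\<And>c x. p (c *\<^sub>R x) = c ^ l *\<^sub>R p x" using p by (auto simp: solid_harmonic_def)
  have "((\<lambda>c. c *\<^sub>R x) has_derivative (\<lambda>h. h *\<^sub>R x)) (at 1)" by (auto intro!: derivative_eq_intros)
  from has_derivative_compose[OF this, of p "\<lambda>h. \<Sum>j\<in>UNIV. complex_of_real (h $ j) * partial_deriv j p x"]
    cpoly_has_derivative[OF cp, of x]
  have "((\<lambda>c. p (c *\<^sub>R x)) has_derivative (\<lambda>h. \<Sum>j\<in>UNIV. complex_of_real ((h *\<^sub>R x) $ j) * partial_deriv j p x)) (at 1)"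
    by simp
  then have "((\<lambda>c. p (c *\<^sub>R x)) has_vector_derivative (\<Sum>j\<in>UNIV. complex_of_real (x $ j) * partial_deriv j p x)) (at 1)"
    unfolding has_vector_derivative_def by (simp add: sum_distrib_left scaleR_conv_of_real[where 'a=complex] mult_ac)
  moreover have "((\<lambda>c. c ^ l *\<^sub>R p x) has_vector_derivative (real l *\<^sub>R p x)) (at 1)"
    unfolding has_vector_derivative_def by (auto intro!: derivative_eq_intros)
  ultimately have "(\<Sum>j\<in>UNIV. complex_of_real (x $ j) * partial_deriv j p x) = real l *\<^sub>R p x"
    unfolding hom by (rule vector_derivative_unique_at)
  then show ?thesis
    by (simp add: scaleR_conv_of_real[where 'a=complex])
qed

section \<open>The surface measure and orthogonality of harmonics\<close>

lemma lborel_distr_orthogonal: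
  fixes R :: "real^3 \<Rightarrow> real^3"
  assumes R: "orthogonal_transformation R"
  shows "distr lborel borel R = lborel"
proof (rule lborel_eqI[symmetric])
  have lin: "linear R" "linear (inv R)"
    using R orthogonal_transformation_inv[OF R] by (auto simp: orthogonal_transformation_linear)
  have [measurable]: "R \<in> borel_measurable borel"
    using lin by (intro borel_measurable_continuous_onI linear_continuous_on) (simp add: linear_conv_bounded_linear)
  have bij: "bij R" by (rule orthogonal_transformation_bij[OF R])
  fix l u :: "real^3" assume le: "\<And>b. b \<in> Basis \<Longrightarrow> l \<bullet> b \<le> u \<bullet> b"
  have img: "R -` box l u = inv R ` box l u" using bij by (simp add: bij_vimage_eq_inv_image)
  have b: "R -` box l u \<in> sets borel" using measurable_sets[of R borel borel "box l u"] by simp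
  have m: "inv R ` box l u \<in> lmeasurable" "measure lebesgue (inv R ` box l u) = measure lebesgue (box l u)"
    by (rule measurable_orthogonal_image measure_orthogonal_image; (rule orthogonal_transformation_inv[OF R] | simp))+
  have "emeasure (distr lborel borel R) (box l u) = emeasure lborel (R -` box l u)"
    by (subst emeasure_distr) auto
  also have "\<dots> = emeasure lebesgue (inv R ` box l u)"
    using b img by simp
  also have "\<dots> = ennreal (measure lebesgue (box l u))"
    using m by (simp add: emeasure_eq_measure2)
  also have "\<dots> = emeasure lborel (box l u)"
    by (simp add: emeasure_eq_measure2 measure_completion)
  also have "\<dots> = (\<Prod>b\<in>Basis. (u - l) \<bullet> b)"
    using le by (simp add: emeasure_lborel_box)
  finally show "emeasure (distr lborel borel R) (box l u) = ennreal (\<Prod>b\<in>Basis. (u - l) \<bullet> b)" .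
qed simp

lemma space_sphere_measure [simp]: "space sphere_measure = S2"
  by (simp add: sphere_measure_def space_restrict_space space_scale_measure)

lemma sets_sphere_measure [measurable_cong]: "sets sphere_measure = sets (restrict_space borel S2)"
  by (simp add: sphere_measure_def)

lemma measurable_normalize:
  "(\<lambda>x::real^3. x /\<^sub>R norm x) \<in> restrict_space lborel (cball 0 1 - {0}) \<rightarrow>\<^sub>M restrict_space borel S2"
  by (rule measurable_restrict_space2)
     (auto simp: space_restrict_space intro!: measurable_restrict_space1)

lemma emeasure_sphere_measure_eq:
  assumes "A \<in> sets sphere_measure"
  shows "emeasure sphere_measure A = 3 * emeasure lborel {x \<in> cball 0 1 - {0}. x /\<^sub>R norm x \<in> A}"
    and "{x \<in> cball 0 1 - {0}. x /\<^sub>R norm x \<in> A} \<in> sets borel"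
proof -
  let ?M = "restrict_space lborel (cball 0 1 - {0}) :: (real^3) measure"
  let ?f = "\<lambda>x::real^3. x /\<^sub>R norm x"
  have A: "A \<in> sets (restrict_space borel S2)" using assms by (simp add: sets_sphere_measure)
  have eq: "?f -` A \<inter> space ?M = {x \<in> cball 0 1 - {0}. x /\<^sub>R norm x \<in> A}"
    by (auto simp: space_restrict_space)
  have s: "{x \<in> cball 0 1 - {0}. x /\<^sub>R norm x \<in> A} \<in> sets ?M"
    using measurable_sets[OF measurable_normalize A] unfolding eq .
  then show "{x \<in> cball 0 1 - {0}. x /\<^sub>R norm x \<in> A} \<in> sets borel"
    by (subst (asm) sets_restrict_space_iff) auto
  have "emeasure sphere_measure A = 3 * emeasure ?M (?f -` A \<inter> space ?M)"
    unfolding sphere_measure_def by (simp add: emeasure_distr[OF measurable_normalize A])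
  also have "emeasure ?M (?f -` A \<inter> space ?M) = emeasure lborel {x \<in> cball 0 1 - {0}. x /\<^sub>R norm x \<in> A}"
    unfolding eq by (rule emeasure_restrict_space) auto
  finally show "emeasure sphere_measure A = 3 * emeasure lborel {x \<in> cball 0 1 - {0}. x /\<^sub>R norm x \<in> A}" .
qed

lemma finite_measure_sphere_measure: "finite_measure sphere_measure"
  by (rule finite_measureI) (simp add: emeasure_sphere_measure)

lemma measure_sphere_measure: "measure sphere_measure S2 = 4 * pi"
  by (simp add: measure_def emeasure_sphere_measure)

lemma orthogonal_in_S2: "orthogonal_transformation R \<Longrightarrow> R x \<in> S2 \<longleftrightarrow> x \<in> S2" for R :: "real^3 \<Rightarrow> real^3"
  by (simp add: orthogonal_transformation_norm)

lemma measurable_orthogonal_S2: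
  fixes R :: "real^3 \<Rightarrow> real^3"
  assumes R: "orthogonal_transformation R"
  shows "R \<in> sphere_measure \<rightarrow>\<^sub>M sphere_measure"
proof -
  have "R \<in> borel_measurable borel"
    using orthogonal_transformation_linear[OF R]
    by (intro borel_measurable_continuous_onI linear_continuous_on) (simp add: linear_conv_bounded_linear)
  then have "R \<in> restrict_space borel S2 \<rightarrow>\<^sub>M restrict_space borel S2"
    using orthogonal_in_S2[OF R]
    by (intro measurable_restrict_space2 measurable_restrict_space1) (auto simp: space_restrict_space)
  then show ?thesis
    by (simp add: measurable_cong_sets[OF sets_sphere_measure sets_sphere_measure])
qed

text \<open>R commutes with x to x / |x|, so the cone over a preimage is the preimage of the cone,
  and invariance is inherited from Lebesgue measure.\<close>

lemma distr_sphere_measure_orthogonal: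
  fixes R :: "real^3 \<Rightarrow> real^3"
  assumes R: "orthogonal_transformation R"
  shows "distr sphere_measure sphere_measure R = sphere_measure"
proof (rule measure_eqI)
  note lin = orthogonal_transformation_linear[OF R]
  have [measurable]: "R \<in> borel_measurable borel"
    using lin by (intro borel_measurable_continuous_onI linear_continuous_on) (simp add: linear_conv_bounded_linear)
  note [measurable] = measurable_orthogonal_S2[OF R]
  fix A assume "A \<in> sets (distr sphere_measure sphere_measure R)"
  then have A: "A \<in> sets sphere_measure" by simp
  let ?B = "\<lambda>A. {x \<in> cball 0 1 - {0::real^3}. x /\<^sub>R norm x \<in> A}"
  have A': "R -` A \<inter> S2 \<in> sets sphere_measure"
    using measurable_sets[OF measurable_orthogonal_S2[OF R] A] by simp
  have "emeasure (distr sphere_measure sphere_measure R) A = emeasure sphere_measure (R -` A \<inter> S2)"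
    using A by (subst emeasure_distr) auto
  also have "\<dots> = 3 * emeasure lborel (?B (R -` A \<inter> S2))"
    by (rule emeasure_sphere_measure_eq(1)[OF A'])
  also have "?B (R -` A \<inter> S2) = R -` ?B A"
  proof -
    have "R x = 0 \<longleftrightarrow> x = 0" for x using orthogonal_transformation_norm[OF R, of x] by (metis norm_eq_zero)
    then show ?thesis using linear_scale[OF lin] orthogonal_transformation_norm[OF R] by (auto simp: dist_norm)
  qed
  also have "emeasure lborel (R -` ?B A) = emeasure (distr lborel borel R) (?B A)"
    using emeasure_sphere_measure_eq(2)[OF A] by (subst emeasure_distr) auto
  also have "3 * \<dots> = emeasure sphere_measure A"
    unfolding lborel_distr_orthogonal[OF R] by (rule emeasure_sphere_measure_eq(1)[OF A, symmetric])
  finally show "emeasure (distr sphere_measure sphere_measure R) A = emeasure sphere_measure A" .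
qed simp

lemma integral_sphere_orthogonal:
  fixes R :: "real^3 \<Rightarrow> real^3" and f :: "real^3 \<Rightarrow> 'b::{banach, second_countable_topology}"
  assumes R: "orthogonal_transformation R" and f: "f \<in> borel_measurable sphere_measure"
  shows "(\<integral>x. f (R x) \<partial>sphere_measure) = (\<integral>x. f x \<partial>sphere_measure)"
  using integral_distr[OF measurable_orthogonal_S2[OF R] f] by (simp add: distr_sphere_measure_orthogonal[OF R])

lemma continuous_measurable_sphere_measure:
  fixes f :: "real^3 \<Rightarrow> 'b::{second_countable_topology, metric_space}"
  assumes "continuous_on UNIV f"
  shows "f \<in> borel_measurable sphere_measure"
  using borel_measurable_continuous_onI[OF assms]
  by (simp add: measurable_cong_sets[OF sets_sphere_measure refl] measurable_restrict_space1)

lemma continuous_integrable_sphere_measure: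
  fixes f :: "real^3 \<Rightarrow> 'b::{banach, second_countable_topology}"
  assumes "continuous_on UNIV f"
  shows "integrable sphere_measure f"
proof -
  interpret finite_measure sphere_measure by (rule finite_measure_sphere_measure)
  have "bounded (f ` S2)"
    by (intro compact_imp_bounded compact_continuous_image continuous_on_subset[OF assms]) auto
  then obtain C where C: "\<forall>y\<in>f ` S2. norm y \<le> C" unfolding bounded_iff by blast
  show ?thesis
    by (rule integrable_const_bound[where B=C])
      (use C in \<open>auto intro: continuous_measurable_sphere_measure[OF assms]\<close>)
qed

text \<open>A null set of the sphere has a null cone, while a nonzero value of a continuous function
  persists on a nonempty open part of the cone. This turns equalities in L2 into equalities at every
  point.\<close>

lemma zero_on_sphere_if_integral_zero:
  fixes h :: "real^3 \<Rightarrow> complex"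
  assumes h: "continuous_on UNIV h" and 0: "(\<integral>x. (norm (h x))\<^sup>2 \<partial>sphere_measure) = 0" and x: "x \<in> S2"
  shows "h x = 0"
proof (rule ccontr)
  assume nz: "h x \<noteq> 0"
  have c: "continuous_on UNIV (\<lambda>x. (norm (h x))\<^sup>2)" by (intro continuous_intros h)
  have "AE x in sphere_measure. (norm (h x))\<^sup>2 = 0"
    using 0 integral_nonneg_eq_0_iff_AE[OF continuous_integrable_sphere_measure[OF c]] by simp
  then have ae: "AE x in sphere_measure. \<not> h x \<noteq> 0" by simp
  let ?N = "{x \<in> S2. h x \<noteq> 0}"
  have N: "?N \<in> sets sphere_measure"
  proof -
    have [measurable]: "h \<in> borel_measurable sphere_measure" by (rule continuous_measurable_sphere_measure[OF h])
    have "{x \<in> space sphere_measure. h x \<noteq> 0} \<in> sets sphere_measure" by measurable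
    then show ?thesis by simp
  qed
  define V where "V = {x \<in> cball 0 1 - {0}. x /\<^sub>R norm x \<in> ?N}"
  note V = emeasure_sphere_measure_eq[OF N, folded V_def]
  have "emeasure sphere_measure ?N = 0" using ae AE_iff_measurable[OF N, of "\<lambda>x. h x = 0"] by simp
  then have "emeasure lborel V = 0" unfolding V(1) by simp
  then have "V \<in> null_sets lborel" using V(2) by (simp add: null_sets_def)
  then have neg: "negligible V" by (simp add: negligible_iff_null_sets null_sets_completionI)
  let ?U = "{y \<in> ball 0 1 - {0::real^3}. h (y /\<^sub>R norm y) \<noteq> 0}"
  have "open ?U"
  proof -
    have "continuous_on (ball 0 1 - {0::real^3}) (\<lambda>y. h (y /\<^sub>R norm y))"
      by (rule continuous_on_compose2[OF h]) (auto intro!: continuous_intros)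
    then have "open ((ball 0 1 - {0::real^3}) \<inter> (\<lambda>y. h (y /\<^sub>R norm y)) -` (- {0}))"
      by (intro continuous_open_preimage) auto
    moreover have "(ball 0 1 - {0::real^3}) \<inter> (\<lambda>y. h (y /\<^sub>R norm y)) -` (- {0}) = ?U" by auto
    ultimately show ?thesis by simp
  qed
  moreover have "(1 / 2) *\<^sub>R x \<in> ?U" using x nz by auto
  moreover have "negligible ?U" by (rule negligible_subset[OF neg]) (auto simp: V_def)
  ultimately show False using open_not_negligible by blast
qed

section \<open>Infinitesimal rotations and orthogonality of different degrees\<close>

definition plane_rotation :: "3 \<Rightarrow> 3 \<Rightarrow> real \<Rightarrow> real^3 \<Rightarrow> real^3" where
  "plane_rotation i j \<theta> x = (\<chi> k. if k = i then cos \<theta> * x $ i - sin \<theta> * x $ j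
     else if k = j then sin \<theta> * x $ i + cos \<theta> * x $ j else x $ k)"

lemma orthogonal_plane_rotation:
  assumes "i \<noteq> j"
  shows "orthogonal_transformation (plane_rotation i j \<theta>)"
  unfolding orthogonal_transformation
proof (intro conjI allI)
  show "linear (plane_rotation i j \<theta>)"
    by (rule linearI) (auto simp: plane_rotation_def vec_eq_iff algebra_simps)
  fix v :: "real^3"
  have sc: "(cos \<theta> * a - sin \<theta> * b)\<^sup>2 + (sin \<theta> * a + cos \<theta> * b)\<^sup>2 = a\<^sup>2 + b\<^sup>2" for a b
  proof -
    have "(cos \<theta> * a - sin \<theta> * b)\<^sup>2 + (sin \<theta> * a + cos \<theta> * b)\<^sup>2 = ((sin \<theta>)\<^sup>2 + (cos \<theta>)\<^sup>2) * (a\<^sup>2 + b\<^sup>2)"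
      by algebra
    then show ?thesis by simp
  qed
  have split: "(norm w)\<^sup>2 = (\<Sum>k\<in>UNIV - {i, j}. (w $ k)\<^sup>2) + ((w $ i)\<^sup>2 + (w $ j)\<^sup>2)" for w :: "real^3"
    unfolding norm_vec_power2 using assms
    by (subst sum.subset_diff[of "{i, j}" UNIV]) auto
  have "(\<Sum>k\<in>UNIV - {i, j}. (plane_rotation i j \<theta> v $ k)\<^sup>2) = (\<Sum>k\<in>UNIV - {i, j}. (v $ k)\<^sup>2)"
    by (rule sum.cong) (auto simp: plane_rotation_def)
  moreover have "(plane_rotation i j \<theta> v $ i)\<^sup>2 + (plane_rotation i j \<theta> v $ j)\<^sup>2 = (v $ i)\<^sup>2 + (v $ j)\<^sup>2"
    using sc[of "v $ i" "v $ j"] assms by (simp add: plane_rotation_def)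
  ultimately have "(norm (plane_rotation i j \<theta> v))\<^sup>2 = (norm v)\<^sup>2"
    by (simp only: split)
  then show "norm (plane_rotation i j \<theta> v) = norm v" by (simp add: power2_eq_iff_nonneg)
qed

text \<open>The generator of \<open>plane_rotation i j\<close>, up to a factor the angular momentum
  operator of that plane; it differentiates along the sphere.\<close>

definition ang_mom :: "3 \<Rightarrow> 3 \<Rightarrow> (real^3 \<Rightarrow> complex) \<Rightarrow> real^3 \<Rightarrow> complex" where
  "ang_mom i j p x = complex_of_real (x $ i) * partial_deriv j p x - complex_of_real (x $ j) * partial_deriv i p x"

lemma cpoly_ang_mom: "cpoly p \<Longrightarrow> cpoly (ang_mom i j p)"
  unfolding ang_mom_def[abs_def] by (intro cpoly_diff cpoly_mult cpoly_coord cpoly_partial_deriv)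

lemma ang_mom_mult:
  assumes "cpoly p" "cpoly q"
  shows "ang_mom i j (\<lambda>x. p x * q x) x = ang_mom i j p x * q x + p x * ang_mom i j q x"
  by (simp add: ang_mom_def partial_deriv_mult[OF assms] algebra_simps)

text \<open>Stated at every \<theta> and not only at 0, because the difference quotients are
  dominated through the derivative along the whole rotation.\<close>

lemma plane_rotation_derivative:
  assumes ij: "i \<noteq> j" and p: "cpoly p"
  shows "((\<lambda>\<theta>. p (plane_rotation i j \<theta> x)) has_vector_derivative ang_mom i j p (plane_rotation i j \<theta> x)) (at \<theta>)"
  using p
proof induction
  case (cpoly_const c)
  show ?case by (simp add: ang_mom_def)
next
  case (cpoly_coord k)
  have "((\<lambda>\<theta>. plane_rotation i j \<theta> x $ k) has_real_derivative
      (if k = i then - (plane_rotation i j \<theta> x $ j) else if k = j then plane_rotation i j \<theta> x $ i else 0)) (at \<theta>)"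
    using ij by (auto simp: plane_rotation_def intro!: derivative_eq_intros)
  then have "((\<lambda>\<theta>. complex_of_real (plane_rotation i j \<theta> x $ k)) has_vector_derivative
      complex_of_real (if k = i then - (plane_rotation i j \<theta> x $ j) else if k = j then plane_rotation i j \<theta> x $ i else 0)) (at \<theta>)"
    unfolding has_real_derivative_iff_has_vector_derivative by (rule bounded_linear.has_vector_derivative[OF bounded_linear_of_real])
  then show ?case using ij by (auto simp: ang_mom_def)
next
  case (cpoly_add p q)
  then show ?case
    using has_vector_derivative_add[OF cpoly_add.IH]
    by (simp add: ang_mom_def partial_deriv_add algebra_simps)
next
  case (cpoly_mult p q)
  then show ?case
    using has_vector_derivative_mult[OF cpoly_mult.IH]
    by (simp add: ang_mom_mult add.commute)
qed

lemma has_vector_derivative_slope: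
  assumes "(f has_vector_derivative d) (at (0::real))"
  shows "((\<lambda>t. (f t - f 0) /\<^sub>R t) \<longlongrightarrow> d) (at 0)"
proof -
  have "((\<lambda>t. norm (f t - f 0 - t *\<^sub>R d) / norm t) \<longlongrightarrow> 0) (at 0)"
    using assms by (simp add: has_vector_derivative_def has_derivative_iff_norm)
  moreover have "\<forall>\<^sub>F t in at (0::real). norm (f t - f 0 - t *\<^sub>R d) / norm t = norm ((f t - f 0) /\<^sub>R t - d)"
    unfolding eventually_at_filter
  proof (intro always_eventually allI impI)
    fix t :: real assume "t \<noteq> 0"
    then have "(f t - f 0) /\<^sub>R t - d = (f t - f 0 - t *\<^sub>R d) /\<^sub>R t"
      by (simp add: scaleR_diff_right)
    then show "norm (f t - f 0 - t *\<^sub>R d) / norm t = norm ((f t - f 0) /\<^sub>R t - d)"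
      by (simp add: divide_inverse mult.commute)
  qed
  ultimately have "((\<lambda>t. norm ((f t - f 0) /\<^sub>R t - d)) \<longlongrightarrow> 0) (at 0)"
    by (rule Lim_transform_eventually)
  then show ?thesis by (simp add: tendsto_norm_zero_iff LIM_zero_iff)
qed

text \<open>Infinitesimal form of the rotation invariance of the surface measure.\<close>

lemma integral_ang_mom:
  assumes ij: "i \<noteq> j" and p: "cpoly p"
  shows "(\<integral>x. ang_mom i j p x \<partial>sphere_measure) = 0"
proof -
  let ?R = "plane_rotation i j"
  have cont: "continuous_on UNIV p" "continuous_on UNIV (ang_mom i j p)"
    using p by (auto intro: continuous_on_cpoly cpoly_ang_mom)
  have "bounded (ang_mom i j p ` S2)"
    by (intro compact_imp_bounded compact_continuous_image continuous_on_subset[OF cont(2)]) auto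
  then obtain C where "\<forall>y\<in>ang_mom i j p ` S2. norm y \<le> C" unfolding bounded_iff by blast
  then have C: "norm (ang_mom i j p x) \<le> C" if "x \<in> S2" for x using that by blast
  define \<theta> where "\<theta> n = 1 / (real n + 1)" for n
  have \<theta>: "\<theta> n > 0" for n by (simp add: \<theta>_def)
  define s where "s n x = (p (?R (\<theta> n) x) - p x) /\<^sub>R \<theta> n" for n x
  have R0: "?R 0 x = x" for x by (simp add: plane_rotation_def vec_eq_iff)
  have contR: "continuous_on UNIV (\<lambda>x. p (?R t x))" for t
    by (rule continuous_on_cpoly) (rule cpoly_compose_linear[OF orthogonal_transformation_linear[OF orthogonal_plane_rotation[OF ij]] p])
  \<comment> \<open>Each difference quotient has integral zero by rotation invariance. The mean
    value inequality bounds all of them by the supremum of the derivative on the sphere, which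
    rotations preserve.\<close>
  have "(\<lambda>n. \<integral>x. s n x \<partial>sphere_measure) \<longlonglongrightarrow> (\<integral>x. ang_mom i j p x \<partial>sphere_measure)"
  proof (rule integral_dominated_convergence[where w="\<lambda>_. C"])
    show "ang_mom i j p \<in> borel_measurable sphere_measure" by (rule continuous_measurable_sphere_measure[OF cont(2)])
    show "s n \<in> borel_measurable sphere_measure" for n
      unfolding s_def[abs_def] by (intro continuous_measurable_sphere_measure continuous_intros contR cont)
    show "integrable sphere_measure (\<lambda>_. C)" by (rule continuous_integrable_sphere_measure) simp
    show "AE x in sphere_measure. (\<lambda>n. s n x) \<longlonglongrightarrow> ang_mom i j p x"
    proof (rule AE_I2)
      fix x
      have "((\<lambda>t. (p (?R t x) - p (?R 0 x)) /\<^sub>R t) \<longlongrightarrow> ang_mom i j p (?R 0 x)) (at 0)"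
        by (rule has_vector_derivative_slope[OF plane_rotation_derivative[OF ij p]])
      moreover have "filterlim \<theta> (at 0) sequentially"
        unfolding filterlim_at using \<theta> LIMSEQ_inverse_real_of_nat
        by (auto simp: \<theta>_def[abs_def] inverse_eq_divide add.commute)
      ultimately show "(\<lambda>n. s n x) \<longlonglongrightarrow> ang_mom i j p x"
        unfolding s_def R0 by (rule filterlim_compose)
    qed
    show "AE x in sphere_measure. norm (s n x) \<le> C" for n
    proof (rule AE_I2)
      fix x assume "x \<in> space sphere_measure"
      then have x: "x \<in> S2" by simp
      have "norm (p (?R (\<theta> n) x) - p (?R 0 x)) \<le> C * norm (\<theta> n - 0)"
      proof (rule differentiable_bound[where S=UNIV and f'="\<lambda>t h. h *\<^sub>R ang_mom i j p (?R t x)"])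
        show "((\<lambda>t. p (?R t x)) has_derivative (\<lambda>h. h *\<^sub>R ang_mom i j p (?R t x))) (at t)" for t
          using plane_rotation_derivative[OF ij p, of x t] by (simp add: has_vector_derivative_def)
        show "onorm (\<lambda>h. h *\<^sub>R ang_mom i j p (?R t x)) \<le> C" for t
        proof (rule onorm_le)
          fix h :: real
          have "?R t x \<in> S2" using x orthogonal_in_S2[OF orthogonal_plane_rotation[OF ij]] by blast
          then have "norm (ang_mom i j p (?R t x)) * \<bar>h\<bar> \<le> C * \<bar>h\<bar>" by (intro mult_right_mono C) auto
          then show "norm (h *\<^sub>R ang_mom i j p (?R t x)) \<le> C * norm h"
            by (simp add: mult.commute)
        qed
      qed auto
      moreover have "norm (s n x) = norm (p (?R (\<theta> n) x) - p x) / \<theta> n"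
        using \<theta>[of n] by (simp add: s_def divide_inverse mult.commute)
      ultimately show "norm (s n x) \<le> C" using \<theta>[of n] by (simp add: R0 divide_le_eq)
    qed
  qed
  moreover have "(\<integral>x. s n x \<partial>sphere_measure) = 0" for n
    unfolding s_def
    using integral_sphere_orthogonal[OF orthogonal_plane_rotation[OF ij] continuous_measurable_sphere_measure[OF cont(1)], of "\<theta> n"]
      continuous_integrable_sphere_measure[OF contR, of "\<theta> n"] continuous_integrable_sphere_measure[OF cont(1)]
    by simp
  ultimately show ?thesis by (simp add: LIMSEQ_const_iff)
qed

text \<open>\<open>ang_mom i j\<close> is a derivation whose values have mean zero, hence skew for
  the bilinear pairing.\<close>

lemma integral_ang_mom_by_parts:
  assumes ij: "i \<noteq> j" and p: "cpoly p" and q: "cpoly q"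
  shows "(\<integral>x. ang_mom i j p x * q x \<partial>sphere_measure) = - (\<integral>x. p x * ang_mom i j q x \<partial>sphere_measure)"
proof -
  have int: "integrable sphere_measure (\<lambda>x. ang_mom i j p x * q x)" "integrable sphere_measure (\<lambda>x. p x * ang_mom i j q x)"
    using p q by (auto intro!: continuous_integrable_sphere_measure continuous_on_cpoly cpoly_mult cpoly_ang_mom)
  have "0 = (\<integral>x. ang_mom i j (\<lambda>x. p x * q x) x \<partial>sphere_measure)"
    using integral_ang_mom[OF ij cpoly_mult[OF p q]] by simp
  also have "\<dots> = (\<integral>x. ang_mom i j p x * q x \<partial>sphere_measure) + (\<integral>x. p x * ang_mom i j q x \<partial>sphere_measure)"
    unfolding ang_mom_mult[OF p q] using int by simp
  finally show ?thesis by (simp add: eq_neg_iff_add_eq_0)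
qed

lemma ang_mom_twice:
  assumes ij: "i \<noteq> j" and p: "cpoly p"
  shows "ang_mom i j (ang_mom i j p) x =
    complex_of_real (x $ i) ^ 2 * partial_deriv j (partial_deriv j p) x
    + complex_of_real (x $ j) ^ 2 * partial_deriv i (partial_deriv i p) x
    - 2 * complex_of_real (x $ i) * complex_of_real (x $ j) * partial_deriv i (partial_deriv j p) x
    - complex_of_real (x $ i) * partial_deriv i p x - complex_of_real (x $ j) * partial_deriv j p x"
proof -
  have pd: "partial_deriv k (ang_mom i j p) = (\<lambda>x.
      complex_of_real (x $ i) * partial_deriv k (partial_deriv j p) x + (if k = i then 1 else 0) * partial_deriv j p x
      - (complex_of_real (x $ j) * partial_deriv k (partial_deriv i p) x + (if k = j then 1 else 0) * partial_deriv i p x))" for k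
    unfolding ang_mom_def[abs_def]
    by (simp only: partial_deriv_diff partial_deriv_mult partial_deriv_coord cpoly_mult cpoly_coord cpoly_partial_deriv[OF p])
  show ?thesis unfolding ang_mom_def[of i j "ang_mom i j p"] pd
    using ij partial_deriv_commute[OF p, of i j] by (simp add: power2_eq_square algebra_simps)
qed

text \<open>The sum of the squared infinitesimal rotations is the Laplace-Beltrami operator.\<close>

lemma solid_harmonic_casimir:
  assumes p: "solid_harmonic l p" and x: "x \<in> S2"
  shows "ang_mom 1 2 (ang_mom 1 2 p) x + ang_mom 2 3 (ang_mom 2 3 p) x + ang_mom 3 1 (ang_mom 3 1 p) x
    = - (of_nat l * (of_nat l + 1)) * p x"
proof -
  have cp: "cpoly p" using p by (simp add: solid_harmonic_def)
  define a b c where "a = complex_of_real (x $ 1)" and "b = complex_of_real (x $ 2)" and "c = complex_of_real (x $ 3)"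
  define D where "D i = partial_deriv i p x" for i
  define DD where "DD i j = partial_deriv i (partial_deriv j p) x" for i j
  have sym: "DD i j = DD j i" for i j using partial_deriv_commute[OF cp, of i j] by (simp add: DD_def)
  have one: "a\<^sup>2 + b\<^sup>2 + c\<^sup>2 = 1"
  proof -
    have "(x $ 1)\<^sup>2 + (x $ 2)\<^sup>2 + (x $ 3)\<^sup>2 = 1"
      using x norm_vec_power2[of x] by (simp add: sum_3)
    then have "complex_of_real ((x $ 1)\<^sup>2 + (x $ 2)\<^sup>2 + (x $ 3)\<^sup>2) = 1" by simp
    then show ?thesis unfolding a_def b_def c_def by simp
  qed
  have euler: "a * D 1 + b * D 2 + c * D 3 = of_nat l * p x"
    using solid_harmonic_euler[OF p, of x] by (simp add: sum_3 a_def b_def c_def D_def)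
  \<comment> \<open>As an identity of functions Euler's relation can be differentiated again; this
    expresses the second derivatives contracted with x through first derivatives.\<close>
  have euler_fun: "(\<lambda>x. \<Sum>j\<in>UNIV. complex_of_real (x $ j) * partial_deriv j p x) = (\<lambda>x. of_nat l * p x)"
    using solid_harmonic_euler[OF p] by blast
  have "partial_deriv i (\<lambda>x. \<Sum>j\<in>UNIV. complex_of_real (x $ j) * partial_deriv j p x) x =
      D i + (a * DD i 1 + b * DD i 2 + c * DD i 3)" for i
  proof -
    have "partial_deriv i (\<lambda>x. \<Sum>j\<in>UNIV. complex_of_real (x $ j) * partial_deriv j p x) x =
        (\<Sum>j\<in>UNIV. complex_of_real (x $ j) * partial_deriv i (partial_deriv j p) x + (if i = j then 1 else 0) * partial_deriv j p x)"
      by (simp only: partial_deriv_sum cpoly_mult cpoly_coord cpoly_partial_deriv[OF cp] partial_deriv_mult partial_deriv_coord)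
    also have "\<dots> = (\<Sum>j\<in>UNIV. complex_of_real (x $ j) * DD i j) + (\<Sum>j\<in>UNIV. if i = j then D j else 0)"
      unfolding sum.distrib[symmetric] by (intro sum.cong) (auto simp: DD_def D_def)
    also have "\<dots> = D i + (a * DD i 1 + b * DD i 2 + c * DD i 3)"
      using exhaust_3[of i] by (auto simp: sum_3 a_def b_def c_def)
    finally show ?thesis .
  qed
  then have e2: "D i + (a * DD i 1 + b * DD i 2 + c * DD i 3) = of_nat l * D i" for i
    unfolding euler_fun by (simp add: partial_deriv_cmult[OF cp] D_def)
  have lap: "DD 1 1 + DD 2 2 + DD 3 3 = 0"
    using p by (simp add: solid_harmonic_def laplacian_def sum_3 DD_def)
  have twice12: "ang_mom 1 2 (ang_mom 1 2 p) x = a\<^sup>2 * DD 2 2 + b\<^sup>2 * DD 1 1 - 2 * a * b * DD 1 2 - a * D 1 - b * D 2"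
    unfolding a_def b_def D_def DD_def by (rule ang_mom_twice[OF _ cp]) simp
  have twice23: "ang_mom 2 3 (ang_mom 2 3 p) x = b\<^sup>2 * DD 3 3 + c\<^sup>2 * DD 2 2 - 2 * b * c * DD 2 3 - b * D 2 - c * D 3"
    unfolding b_def c_def D_def DD_def by (rule ang_mom_twice[OF _ cp]) simp
  have twice31: "ang_mom 3 1 (ang_mom 3 1 p) x = c\<^sup>2 * DD 1 1 + a\<^sup>2 * DD 3 3 - 2 * c * a * DD 3 1 - c * D 3 - a * D 1"
    unfolding a_def c_def D_def DD_def by (rule ang_mom_twice[OF _ cp]) simp
  \<comment> \<open>The squared rotations amount to |x|^2 times the Laplacian minus radial terms.
    The Laplacian vanishes, and the radial terms contribute l^2 and l by Euler's relation and its
    derivative.\<close>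
  have "ang_mom 1 2 (ang_mom 1 2 p) x + ang_mom 2 3 (ang_mom 2 3 p) x + ang_mom 3 1 (ang_mom 3 1 p) x
    = (a\<^sup>2 + b\<^sup>2 + c\<^sup>2) * (DD 1 1 + DD 2 2 + DD 3 3)
      - (a * (D 1 + (a * DD 1 1 + b * DD 1 2 + c * DD 1 3)) + b * (D 2 + (a * DD 2 1 + b * DD 2 2 + c * DD 2 3))
         + c * (D 3 + (a * DD 3 1 + b * DD 3 2 + c * DD 3 3))) - (a * D 1 + b * D 2 + c * D 3)"
    unfolding twice12 twice23 twice31 sym[of 2 1] sym[of 3 1] sym[of 3 2]
    by (simp add: power2_eq_square algebra_simps)
  also have "\<dots> = - (a * (of_nat l * D 1) + b * (of_nat l * D 2) + c * (of_nat l * D 3)) - (a * D 1 + b * D 2 + c * D 3)"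
    unfolding e2 lap by simp
  also have "\<dots> = - (of_nat l + 1) * (a * D 1 + b * D 2 + c * D 3)"
    by (simp add: algebra_simps)
  also have "\<dots> = - (of_nat l * (of_nat l + 1)) * p x" unfolding euler by (simp add: algebra_simps)
  finally show ?thesis .
qed

text \<open>The Casimir operator is symmetric, by two integrations by parts, and has different
  eigenvalues on different degrees. Conjugation preserves the degree, so the bilinear pairing with
  the conjugate of q suffices.\<close>

lemma solid_harmonics_orthogonal:
  assumes p: "solid_harmonic l p" and q: "solid_harmonic k q" and "l \<noteq> k"
  shows "(\<integral>x. p x * cnj (q x) \<partial>sphere_measure) = 0"
proof -
  define r where "r = (\<lambda>x. cnj (q x))"
  have r: "solid_harmonic k r" unfolding r_def by (rule solid_harmonic_cnj[OF q])
  have cp: "cpoly p" and cr: "cpoly r" using p r by (auto simp: solid_harmonic_def)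
  have swap: "(\<integral>x. ang_mom i j (ang_mom i j p) x * r x \<partial>sphere_measure) = (\<integral>x. p x * ang_mom i j (ang_mom i j r) x \<partial>sphere_measure)"
    if "i \<noteq> j" for i j
    using integral_ang_mom_by_parts[OF that cpoly_ang_mom[OF cp] cr] integral_ang_mom_by_parts[OF that cp cpoly_ang_mom[OF cr]]
    by simp
  have int: "integrable sphere_measure (\<lambda>x. ang_mom i j (ang_mom i j p) x * r x)"
    "integrable sphere_measure (\<lambda>x. p x * ang_mom i j (ang_mom i j r) x)" for i j
    using cp cr by (auto intro!: continuous_integrable_sphere_measure continuous_on_cpoly cpoly_mult cpoly_ang_mom)
  have "- (of_nat l * (of_nat l + 1)) * (\<integral>x. p x * r x \<partial>sphere_measure) =
     (\<integral>x. (- (of_nat l * (of_nat l + 1)) * p x) * r x \<partial>sphere_measure)"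
    unfolding mult.assoc by (rule integral_mult_right_zero[symmetric])
  also have "\<dots> = (\<integral>x. (ang_mom 1 2 (ang_mom 1 2 p) x + ang_mom 2 3 (ang_mom 2 3 p) x + ang_mom 3 1 (ang_mom 3 1 p) x) * r x \<partial>sphere_measure)"
    by (rule Bochner_Integration.integral_cong[OF refl]) (simp only: space_sphere_measure solid_harmonic_casimir[OF p])
  also have "\<dots> = (\<integral>x. p x * (ang_mom 1 2 (ang_mom 1 2 r) x + ang_mom 2 3 (ang_mom 2 3 r) x + ang_mom 3 1 (ang_mom 3 1 r) x) \<partial>sphere_measure)"
    using int swap[of 1 2] swap[of 2 3] swap[of 3 1] by (simp add: distrib_left distrib_right)
  also have "\<dots> = (\<integral>x. - (of_nat k * (of_nat k + 1)) * (p x * r x) \<partial>sphere_measure)"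
    by (rule Bochner_Integration.integral_cong[OF refl]) (simp only: space_sphere_measure solid_harmonic_casimir[OF r], simp)
  also have "\<dots> = - (of_nat k * (of_nat k + 1)) * (\<integral>x. p x * r x \<partial>sphere_measure)"
    by (rule integral_mult_right_zero)
  finally have "(of_nat l * (of_nat l + 1) - of_nat k * (of_nat k + 1)) * (\<integral>x. p x * r x \<partial>sphere_measure) = 0"
    by (simp add: algebra_simps)
  moreover have "(of_nat l * (of_nat l + 1) - of_nat k * (of_nat k + 1)) \<noteq> (0::complex)"
  proof -
    have "l * (l + 1) \<noteq> k * (k + 1)"
    proof (cases "l < k")
      case True
      then have "l * (l + 1) < k * (k + 1)" by (intro mult_strict_mono) auto
      then show ?thesis by simp
    next
      case False
      then have "k < l" using assms(3) by simp
      then have "k * (k + 1) < l * (l + 1)" by (intro mult_strict_mono) auto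
      then show ?thesis by simp
    qed
    moreover have "of_nat n * (of_nat n + 1) = complex_of_nat (n * (n + 1))" for n
      by (simp add: distrib_left)
    ultimately show ?thesis by (simp only: right_minus_eq of_nat_eq_iff not_False_eq_True)
  qed
  ultimately show ?thesis unfolding r_def by simp
qed

section \<open>The addition theorem and vector spherical harmonics\<close>

text \<open>\<open>q\<close> holds polynomial representatives of \<open>Y\<close>. The two are
  required to agree only on the sphere, so every derivative is taken of \<open>q\<close>.\<close>

locale harmonic_basis =
  fixes Y q :: "nat \<Rightarrow> int \<Rightarrow> real^3 \<Rightarrow> complex"
  assumes basis: "spherical_harmonic_basis Y"
    and solid: "\<bar>m\<bar> \<le> int l \<Longrightarrow> solid_harmonic l (q l m)"
    and Y_eq: "\<bar>m\<bar> \<le> int l \<Longrightarrow> x \<in> S2 \<Longrightarrow> Y l m x = q l m x"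
begin

lemma cpoly_q: "\<bar>m\<bar> \<le> int l \<Longrightarrow> cpoly (q l m)"
  using solid by (simp add: solid_harmonic_def)

lemma square_integrable_q: "\<bar>m\<bar> \<le> int l \<Longrightarrow> square_integrable sphere_measure (q l m)"
  unfolding square_integrable_def
  by (intro conjI continuous_measurable_sphere_measure continuous_integrable_sphere_measure continuous_intros continuous_on_cpoly cpoly_q)

lemma L2_inner_Y_eq:
  assumes "\<bar>m\<bar> \<le> int l"
  shows "L2_inner_S2 f (Y l m) = (\<integral>x. f x * cnj (q l m x) \<partial>sphere_measure)"
  unfolding L2_inner_S2_def using Y_eq[OF assms] by (intro Bochner_Integration.integral_cong) auto

lemma orthonormal_q:
  assumes "\<bar>m\<bar> \<le> int l" "\<bar>m'\<bar> \<le> int l"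
  shows "(\<integral>x. q l m x * cnj (q l m' x) \<partial>sphere_measure) = (if m = m' then 1 else 0)"
proof -
  have "(\<integral>x. q l m x * cnj (q l m' x) \<partial>sphere_measure) = L2_inner_S2 (Y l m) (Y l m')"
    unfolding L2_inner_Y_eq[OF assms(2)] using Y_eq[OF assms(1)] by (intro Bochner_Integration.integral_cong) auto
  then show ?thesis using basis assms by (simp add: spherical_harmonic_basis_def)
qed

lemma integral_norm_q:
  assumes "\<bar>m\<bar> \<le> int l"
  shows "(\<integral>x. (norm (q l m x))\<^sup>2 \<partial>sphere_measure) = 1"
proof -
  have "complex_of_real (\<integral>x. (norm (q l m x))\<^sup>2 \<partial>sphere_measure) = (\<integral>x. q l m x * cnj (q l m x) \<partial>sphere_measure)"
    by (simp flip: integral_complex_of_real complex_norm_square)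
  then show ?thesis using orthonormal_q[OF assms assms] by simp
qed

lemma integral_norm_combination:
  "(\<integral>x. (norm (\<Sum>m=-int l..int l. a m * q l m x))\<^sup>2 \<partial>sphere_measure) = (\<Sum>m=-int l..int l. (norm (a m))\<^sup>2)"
proof -
  have "(\<integral>x. (norm (\<Sum>m=-int l..int l. q l m x * a m))\<^sup>2 \<partial>sphere_measure) =
      (\<Sum>m=-int l..int l. (\<integral>x. (norm (q l m x))\<^sup>2 \<partial>sphere_measure) * (norm (a m))\<^sup>2)"
    by (rule expectation_norm_sum_orthogonal) (auto simp: abs_le_iff orthonormal_q intro!: square_integrable_q)
  also have "\<dots> = (\<Sum>m=-int l..int l. (norm (a m))\<^sup>2)"
    by (intro sum.cong) (auto simp: integral_norm_q abs_le_iff)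
  finally show ?thesis by (simp add: mult.commute)
qed

text \<open>In the L2 expansion given by completeness all other degrees drop out by orthogonality,
  so the error is constant from N = l on and must be 0. Two polynomials that agree in L2 of the
  sphere agree at each of its points.\<close>

lemma solid_harmonic_expansion:
  assumes f: "solid_harmonic l f" and x: "x \<in> S2"
  shows "f x = (\<Sum>m=-int l..int l. L2_inner_S2 f (Y l m) * q l m x)"
proof -
  define g where "g = (\<lambda>x. \<Sum>m=-int l..int l. L2_inner_S2 f (Y l m) * q l m x)"
  have cf: "cpoly f" using f by (simp add: solid_harmonic_def)
  have cg: "cpoly g" unfolding g_def by (intro cpoly_sum cpoly_cmult cpoly_q) auto
  have sq: "square_integrable sphere_measure f"
    unfolding square_integrable_def
    by (intro conjI continuous_measurable_sphere_measure continuous_integrable_sphere_measure continuous_intros continuous_on_cpoly cf)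
  have lim: "(\<lambda>N. \<integral>x. (norm (f x - (\<Sum>k\<le>N. \<Sum>m=-int k..int k. L2_inner_S2 f (Y k m) * Y k m x)))\<^sup>2 \<partial>sphere_measure) \<longlonglongrightarrow> 0"
    using basis sq by (simp add: spherical_harmonic_basis_def)
  have zero: "L2_inner_S2 f (Y k m) = 0" if "k \<noteq> l" "\<bar>m\<bar> \<le> int k" for k m
    unfolding L2_inner_Y_eq[OF that(2)] using solid_harmonics_orthogonal[OF f solid[OF that(2)]] that by simp
  have "(\<integral>x. (norm (f x - (\<Sum>k\<le>N. \<Sum>m=-int k..int k. L2_inner_S2 f (Y k m) * Y k m x)))\<^sup>2 \<partial>sphere_measure)
     = (\<integral>x. (norm (f x - g x))\<^sup>2 \<partial>sphere_measure)" if "l \<le> N" for N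
  proof (rule Bochner_Integration.integral_cong[OF refl])
    fix x assume "x \<in> space sphere_measure"
    then have x: "x \<in> S2" by simp
    have "(\<Sum>k\<le>N. \<Sum>m=-int k..int k. L2_inner_S2 f (Y k m) * Y k m x) = (\<Sum>k\<le>N. if k = l then g x else 0)"
    proof (intro sum.cong refl)
      fix k
      show "(\<Sum>m=-int k..int k. L2_inner_S2 f (Y k m) * Y k m x) = (if k = l then g x else 0)"
        using zero[of k] Y_eq[OF _ x] by (auto simp: g_def abs_le_iff intro!: sum.neutral sum.cong)
    qed
    also have "\<dots> = g x" using that by simp
    finally show "(norm (f x - (\<Sum>k\<le>N. \<Sum>m=-int k..int k. L2_inner_S2 f (Y k m) * Y k m x)))\<^sup>2 = (norm (f x - g x))\<^sup>2" by simp
  qed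
  then have "\<forall>\<^sub>F N in sequentially. (\<integral>x. (norm (f x - (\<Sum>k\<le>N. \<Sum>m=-int k..int k. L2_inner_S2 f (Y k m) * Y k m x)))\<^sup>2 \<partial>sphere_measure)
     = (\<integral>x. (norm (f x - g x))\<^sup>2 \<partial>sphere_measure)"
    unfolding eventually_sequentially by blast
  then have "(\<lambda>N. \<integral>x. (norm (f x - g x))\<^sup>2 \<partial>sphere_measure) \<longlonglongrightarrow> 0"
    by (rule Lim_transform_eventually[OF lim])
  then have "(\<integral>x. (norm (f x - g x))\<^sup>2 \<partial>sphere_measure) = 0" by (simp add: LIMSEQ_const_iff)
  then have "f x - g x = 0"
    by (intro zero_on_sphere_if_integral_zero[OF _ _ x, of "\<lambda>x. f x - g x"] continuous_on_cpoly cpoly_diff cf cg)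
  then show ?thesis by (simp add: g_def)
qed

definition power_sum :: "nat \<Rightarrow> real^3 \<Rightarrow> real" where
  "power_sum l x = (\<Sum>m=-int l..int l. (norm (q l m x))\<^sup>2)"

text \<open>\<open>power_sum l\<close> is the diagonal of a reproducing kernel of a rotation-invariant space.\<close>

lemma power_sum_orthogonal_le:
  assumes R: "orthogonal_transformation R" and x: "x \<in> S2"
  shows "power_sum l (R x) \<le> power_sum l x"
proof -
  \<comment> \<open>The reproducing kernel at R x: its value at R x and its squared norm are both
    \<open>power_sum l (R x)\<close>. The rotated function g has the same norm and takes that value
    at x.\<close>
  define f where "f = (\<lambda>z. \<Sum>m=-int l..int l. cnj (q l m (R x)) * q l m z)"
  have f: "solid_harmonic l f" unfolding f_def by (intro solid_harmonic_sum solid) auto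
  define g where "g = (\<lambda>z. f (R z))"
  have g: "solid_harmonic l g" unfolding g_def by (rule solid_harmonic_compose_orthogonal[OF R f])
  define c where "c m = L2_inner_S2 g (Y l m)" for m
  have g_eq: "g z = (\<Sum>m=-int l..int l. c m * q l m z)" if "z \<in> S2" for z
    unfolding c_def by (rule solid_harmonic_expansion[OF g that])
  have cont: "continuous_on UNIV f" using f by (intro continuous_on_cpoly) (simp add: solid_harmonic_def)
  have "(\<Sum>m=-int l..int l. (norm (c m))\<^sup>2) = (\<integral>z. (norm (\<Sum>m=-int l..int l. c m * q l m z))\<^sup>2 \<partial>sphere_measure)"
    by (rule integral_norm_combination[symmetric])
  also have "\<dots> = (\<integral>z. (norm (f (R z)))\<^sup>2 \<partial>sphere_measure)"
    using g_eq by (intro Bochner_Integration.integral_cong) (auto simp: g_def)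
  also have "\<dots> = (\<integral>z. (norm (f z))\<^sup>2 \<partial>sphere_measure)"
    by (intro integral_sphere_orthogonal[OF R, of "\<lambda>z. (norm (f z))\<^sup>2"] continuous_measurable_sphere_measure continuous_intros cont)
  also have "\<dots> = power_sum l (R x)"
    unfolding f_def integral_norm_combination by (simp add: power_sum_def)
  finally have c: "(\<Sum>m=-int l..int l. (norm (c m))\<^sup>2) = power_sum l (R x)" .
  have "complex_of_real (power_sum l (R x)) = f (R x)"
    by (simp add: power_sum_def f_def complex_norm_square mult.commute del: of_real_power)
  also have "\<dots> = (\<Sum>m=-int l..int l. c m * q l m x)" using g_eq[OF x] by (simp add: g_def)
  finally have "norm (complex_of_real (power_sum l (R x))) = norm (\<Sum>m=-int l..int l. c m * q l m x)" by simp
  also have "\<dots> \<le> (\<Sum>m=-int l..int l. norm (c m) * norm (q l m x))"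
    by (rule order.trans[OF norm_sum]) (simp add: norm_mult)
  finally have le: "\<bar>power_sum l (R x)\<bar> \<le> (\<Sum>m=-int l..int l. norm (c m) * norm (q l m x))" by simp
  have nonneg: "0 \<le> power_sum l z" for z by (simp add: power_sum_def sum_nonneg)
  \<comment> \<open>By Cauchy-Schwarz the square is at most \<open>power_sum l (R x)\<close> times
    \<open>power_sum l x\<close>; cancelling one factor leaves the claim.\<close>
  have "(power_sum l (R x))\<^sup>2 \<le> (\<Sum>m=-int l..int l. norm (c m) * norm (q l m x))\<^sup>2"
    using le nonneg by (intro power_mono) auto
  also have "\<dots> \<le> (\<Sum>m=-int l..int l. (norm (c m))\<^sup>2) * (\<Sum>m=-int l..int l. (norm (q l m x))\<^sup>2)"
    by (rule Cauchy_Schwarz_ineq_sum)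
  also have "\<dots> = power_sum l (R x) * power_sum l x" unfolding c by (simp add: power_sum_def)
  finally have "power_sum l (R x) * power_sum l (R x) \<le> power_sum l (R x) * power_sum l x"
    by (simp add: power2_eq_square)
  then show ?thesis
    using nonneg[of x] nonneg[of "R x"] by (cases "power_sum l (R x) = 0") (auto simp: mult_le_cancel_left)
qed

text \<open>Rotations from x to y and back turn the inequality into equality. The value follows by
  integrating 2l + 1 normalised functions over a sphere of area 4 pi.\<close>

lemma power_sum_const:
  assumes x: "x \<in> S2"
  shows "power_sum l x = (2 * real l + 1) / (4 * pi)"
proof -
  have eq: "power_sum l y = power_sum l x" if y: "y \<in> S2" for y
  proof -
    have n: "norm x = norm y" using x y by simp
    obtain R where R: "orthogonal_transformation R" "R x = y" using orthogonal_transformation_exists[OF n] by blast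
    obtain R' where R': "orthogonal_transformation R'" "R' y = x" using orthogonal_transformation_exists[OF n[symmetric]] by blast
    show ?thesis using power_sum_orthogonal_le[OF R(1) x] power_sum_orthogonal_le[OF R'(1) y] R R'
      by (simp add: antisym)
  qed
  have "(\<integral>y. power_sum l y \<partial>sphere_measure) = (\<Sum>m=-int l..int l. \<integral>y. (norm (q l m y))\<^sup>2 \<partial>sphere_measure)"
    unfolding power_sum_def
    by (rule Bochner_Integration.integral_sum) (use square_integrable_q in \<open>auto simp: square_integrable_def abs_le_iff\<close>)
  also have "\<dots> = (\<Sum>m=-int l..int l. 1)" by (intro sum.cong) (auto simp: integral_norm_q abs_le_iff)
  also have "\<dots> = 2 * real l + 1" by simp
  also have "(\<integral>y. power_sum l y \<partial>sphere_measure) = (\<integral>y. power_sum l x \<partial>sphere_measure)"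
    using eq by (intro Bochner_Integration.integral_cong) auto
  also have "\<dots> = 4 * pi * power_sum l x"
    by (simp add: measure_sphere_measure)
  finally show ?thesis by (simp add: field_simps)
qed

text \<open>Homogeneity carries the constant from the sphere to all of space. The factor |x|^(2l) is
  written as a power of the sum of squares so that both sides are polynomials and can be
  differentiated.\<close>

lemma power_sum_eq:
  "(\<Sum>m=-int l..int l. q l m x * cnj (q l m x)) =
    complex_of_real ((2 * real l + 1) / (4 * pi)) * (\<Sum>j\<in>UNIV. complex_of_real (x $ j) ^ 2) ^ l"
proof -
  obtain u :: "real^3" where u: "norm u = 1" "x = norm x *\<^sub>R u"
  proof (cases "x = 0")
    case True
    then show thesis using that[of "axis 1 1"] by simp
  next
    case False
    then show thesis using that[of "x /\<^sub>R norm x"] by simp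
  qed
  have hom: "q l m x = complex_of_real (norm x ^ l) * q l m u" if "m \<in> {-int l..int l}" for m
  proof -
    have "q l m (norm x *\<^sub>R u) = norm x ^ l *\<^sub>R q l m u" using solid[of m l] that by (auto simp: solid_harmonic_def)
    then show ?thesis using u(2) by (simp add: scaleR_conv_of_real)
  qed
  have "(\<Sum>m=-int l..int l. q l m x * cnj (q l m x)) =
     (\<Sum>m=-int l..int l. complex_of_real ((norm x ^ l)\<^sup>2) * (q l m u * cnj (q l m u)))"
    by (intro sum.cong refl) (simp add: hom power2_eq_square)
  also have "\<dots> = complex_of_real ((norm x ^ l)\<^sup>2) * complex_of_real (power_sum l u)"
    by (simp add: power_sum_def sum_distrib_left complex_norm_square del: of_real_power)
  also have "(norm x ^ l)\<^sup>2 = ((norm x)\<^sup>2) ^ l" by (simp add: power_mult[symmetric] mult.commute)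
  also have "complex_of_real (((norm x)\<^sup>2) ^ l) = (\<Sum>j\<in>UNIV. complex_of_real (x $ j) ^ 2) ^ l"
    unfolding norm_vec_power2 by simp
  finally show ?thesis using power_sum_const[of u l] u by (simp add: mult.commute)
qed

text \<open>Since q and its conjugate are harmonic, the Laplacian of the sum of |q|^2 is twice the
  sum of the squared gradients. On the other side the Laplacian of |x|^(2l) is 2l (2l + 1) at |x| =
  1.\<close>

lemma gradient_power_sum:
  assumes x: "x \<in> S2"
  shows "(\<Sum>m=-int l..int l. \<Sum>i\<in>UNIV. (norm (partial_deriv i (q l m) x))\<^sup>2) =
    (2 * real l + 1) / (4 * pi) * (real l * (2 * real l + 1))"
proof -
  define \<kappa> where "\<kappa> = complex_of_real ((2 * real l + 1) / (4 * pi))"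
  define s where "s = (\<lambda>x::real^3. \<Sum>j\<in>UNIV. complex_of_real (x $ j) ^ 2)"
  have cs: "cpoly s" unfolding s_def by (intro cpoly_sum cpoly_power cpoly_coord)
  have ds: "partial_deriv i s = (\<lambda>x. 2 * complex_of_real (x $ i))" for i
  proof -
    have "partial_deriv i s = (\<lambda>x. \<Sum>j\<in>UNIV. 2 * complex_of_real (x $ j) * (if i = j then 1 else 0))"
      unfolding s_def by (simp add: partial_deriv_sum cpoly_power cpoly_coord partial_deriv_power)
    then show ?thesis by (simp add: if_distrib cong: if_cong)
  qed
  have s1: "s x = 1"
  proof -
    have "(\<Sum>j\<in>UNIV. (x $ j)\<^sup>2) = 1" using x norm_vec_power2[of x] by simp
    then have "complex_of_real (\<Sum>j\<in>UNIV. (x $ j)\<^sup>2) = 1" by simp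
    then show ?thesis by (simp add: s_def)
  qed
  have "(\<lambda>x. \<Sum>m=-int l..int l. q l m x * cnj (q l m x)) = (\<lambda>x. \<kappa> * s x ^ l)"
    using power_sum_eq unfolding \<kappa>_def s_def by blast
  then have lap: "laplacian (\<lambda>x. \<Sum>m=-int l..int l. q l m x * cnj (q l m x)) x = laplacian (\<lambda>x. \<kappa> * s x ^ l) x"
    by simp
  have cpq: "cpoly (q l m)" "cpoly (\<lambda>x. cnj (q l m x))" if "m \<in> {-int l..int l}" for m
    using that cpoly_q[of m l] by (auto intro: cpoly_cnj)
  have pd2: "partial_deriv i (partial_deriv i (\<lambda>x. q l m x * cnj (q l m x))) x =
      q l m x * cnj (partial_deriv i (partial_deriv i (q l m)) x) + partial_deriv i (partial_deriv i (q l m)) x * cnj (q l m x)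
      + 2 * complex_of_real ((norm (partial_deriv i (q l m) x))\<^sup>2)" if "m \<in> {-int l..int l}" for m i
    using cpq[OF that]
    by (simp add: partial_deriv_mult partial_deriv_add partial_deriv_cnj cpoly_partial_deriv cpoly_mult cpoly_cnj
        complex_norm_square algebra_simps del: of_real_power)
  have harm: "(\<Sum>i\<in>UNIV. partial_deriv i (partial_deriv i (q l m)) x) = 0" if "m \<in> {-int l..int l}" for m
    using solid[of m l] that by (auto simp: solid_harmonic_def laplacian_def)
  have "laplacian (\<lambda>x. \<Sum>m=-int l..int l. q l m x * cnj (q l m x)) x =
     (\<Sum>i\<in>UNIV. \<Sum>m=-int l..int l. partial_deriv i (partial_deriv i (\<lambda>x. q l m x * cnj (q l m x))) x)"
  proof -
    have cp: "cpoly (\<lambda>x. q l m x * cnj (q l m x))" if "m \<in> {-int l..int l}" for m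
      by (rule cpoly_mult[OF cpq[OF that]])
    have "partial_deriv i (partial_deriv i (\<lambda>x. \<Sum>m=-int l..int l. q l m x * cnj (q l m x))) =
      (\<lambda>x. \<Sum>m=-int l..int l. partial_deriv i (partial_deriv i (\<lambda>x. q l m x * cnj (q l m x))) x)" for i
      by (subst partial_deriv_sum[OF cp], assumption, rule partial_deriv_sum[OF cpoly_partial_deriv[OF cp]])
    then show ?thesis by (simp only: laplacian_def)
  qed
  also have "\<dots> = (\<Sum>m=-int l..int l. \<Sum>i\<in>UNIV. partial_deriv i (partial_deriv i (\<lambda>x. q l m x * cnj (q l m x))) x)"
    by (rule sum.swap)
  also have "\<dots> = (\<Sum>m=-int l..int l. 2 * complex_of_real (\<Sum>i\<in>UNIV. (norm (partial_deriv i (q l m) x))\<^sup>2))"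
  proof (intro sum.cong refl)
    fix m assume m: "m \<in> {-int l..int l}"
    show "(\<Sum>i\<in>UNIV. partial_deriv i (partial_deriv i (\<lambda>x. q l m x * cnj (q l m x))) x) =
       2 * complex_of_real (\<Sum>i\<in>UNIV. (norm (partial_deriv i (q l m) x))\<^sup>2)"
      unfolding pd2[OF m] sum.distrib sum_distrib_left[symmetric] sum_distrib_right[symmetric] cnj_sum[symmetric] harm[OF m]
      by simp
  qed
  also have "\<dots> = complex_of_real (2 * (\<Sum>m=-int l..int l. \<Sum>i\<in>UNIV. (norm (partial_deriv i (q l m) x))\<^sup>2))"
    by (simp add: sum_distrib_left)
  finally have lhs: "laplacian (\<lambda>x. \<Sum>m=-int l..int l. q l m x * cnj (q l m x)) x =
     complex_of_real (2 * (\<Sum>m=-int l..int l. \<Sum>i\<in>UNIV. (norm (partial_deriv i (q l m) x))\<^sup>2))" .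
  have "partial_deriv i (\<lambda>x. \<kappa> * s x ^ l) = (\<lambda>x. \<kappa> * (of_nat l * s x ^ (l - 1) * (2 * complex_of_real (x $ i))))" for i
    using cs by (simp add: partial_deriv_cmult cpoly_power partial_deriv_power ds)
  also have "(\<lambda>x. \<kappa> * (of_nat l * s x ^ (l - 1) * (2 * complex_of_real (x $ i)))) =
      (\<lambda>x. (\<kappa> * of_nat l * 2) * (s x ^ (l - 1) * complex_of_real (x $ i)))" for i
    by (simp add: mult_ac)
  finally have d1: "partial_deriv i (\<lambda>x. \<kappa> * s x ^ l) = (\<lambda>x. (\<kappa> * of_nat l * 2) * (s x ^ (l - 1) * complex_of_real (x $ i)))" for i .
  have d2: "partial_deriv i (partial_deriv i (\<lambda>x. \<kappa> * s x ^ l)) x =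
      (\<kappa> * of_nat l * 2) * (1 + 2 * of_nat (l - 1) * complex_of_real (x $ i) ^ 2)" for i
  proof -
    have "partial_deriv i (partial_deriv i (\<lambda>x. \<kappa> * s x ^ l)) x = (\<kappa> * of_nat l * 2) *
        (s x ^ (l - 1) * 1 + of_nat (l - 1) * s x ^ (l - 1 - 1) * (2 * complex_of_real (x $ i)) * complex_of_real (x $ i))"
      unfolding d1
      by (simp only: partial_deriv_cmult cpoly_power cpoly_mult cpoly_coord cs partial_deriv_mult partial_deriv_power partial_deriv_coord ds if_True simp_thms)
    then show ?thesis by (simp add: s1 power2_eq_square)
  qed
  have "laplacian (\<lambda>x. \<kappa> * s x ^ l) x = (\<kappa> * of_nat l * 2) * (3 + 2 * of_nat (l - 1) * s x)"
    unfolding laplacian_def d2 sum_distrib_left[symmetric] sum.distrib by (simp add: s_def)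
  \<comment> \<open>The 3 is the dimension, and 3 + 2 (l - 1) = 2l + 1 for l \<ge> 1. For l = 0 the
    subtraction is truncated, but the factor l vanishes.\<close>
  also have "\<dots> = \<kappa> * complex_of_real (2 * (real l * (2 * real l + 1)))"
    unfolding s1 by (cases l) (simp_all add: algebra_simps)
  finally have "complex_of_real (2 * (\<Sum>m=-int l..int l. \<Sum>i\<in>UNIV. (norm (partial_deriv i (q l m) x))\<^sup>2)) =
     \<kappa> * complex_of_real (2 * (real l * (2 * real l + 1)))"
    using lhs lap by simp
  also have "\<dots> = complex_of_real ((2 * real l + 1) / (4 * pi) * (2 * (real l * (2 * real l + 1))))"
    unfolding \<kappa>_def by (rule of_real_mult[symmetric])
  finally show ?thesis unfolding of_real_eq_iff by linarith
qed

text \<open>At a unit vector the derivative of y to y / |y| is the tangent projection, so the radial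
  extension keeps exactly the tangential part of the gradient of the polynomial.\<close>

lemma partial_deriv_radial_extension:
  assumes lm: "\<bar>m\<bar> \<le> int l" and x: "x \<in> S2"
  shows "partial_deriv i (radial_extension (Y l m)) x =
    (\<Sum>j\<in>UNIV. complex_of_real (tangent_projection x $ i $ j) * partial_deriv j (q l m) x)"
proof -
  have nx: "norm x = 1" "x \<noteq> 0" using x by auto
  have "(norm has_derivative (\<lambda>h. h \<bullet> x)) (at x)"
    using has_derivative_norm[OF nx(2)] nx by (simp add: sgn_div_norm)
  then have "((\<lambda>y. inverse (norm y) *\<^sub>R y) has_derivative (\<lambda>h. h - (x \<bullet> h) *\<^sub>R x)) (at x)"
    using nx by (auto intro!: derivative_eq_intros simp: inner_commute)
  from has_derivative_compose[OF this, of "q l m" "\<lambda>h. \<Sum>j\<in>UNIV. complex_of_real (h $ j) * partial_deriv j (q l m) x"]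
    cpoly_has_derivative[OF cpoly_q[OF lm], of x] nx
  have "((\<lambda>y. q l m (inverse (norm y) *\<^sub>R y)) has_derivative
     (\<lambda>h. \<Sum>j\<in>UNIV. complex_of_real ((h - (x \<bullet> h) *\<^sub>R x) $ j) * partial_deriv j (q l m) x)) (at x)" by simp
  then have der: "(radial_extension (Y l m) has_derivative
     (\<lambda>h. \<Sum>j\<in>UNIV. complex_of_real ((h - (x \<bullet> h) *\<^sub>R x) $ j) * partial_deriv j (q l m) x)) (at x)"
  proof (rule has_derivative_transform_within_open[of _ _ _ _ "- {0}"])
    fix y :: "real^3" assume "y \<in> - {0}"
    then have "y /\<^sub>R norm y \<in> S2" by simp
    then show "q l m (inverse (norm y) *\<^sub>R y) = radial_extension (Y l m) y"
      unfolding radial_extension_def using Y_eq[OF lm] by metis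
  qed (use nx in auto)
  have "(axis i 1 - (x \<bullet> axis i 1) *\<^sub>R x) $ j = tangent_projection x $ i $ j" for j
    unfolding inner_axis by (simp add: tangent_projection_def mat_def axis_def)
  then show ?thesis
    unfolding partial_deriv_def[of i] frechet_derivative_at[OF der, symmetric] by simp
qed

lemma gradient_radial_extension:
  assumes lm: "\<bar>m\<bar> \<le> int l" and x: "x \<in> S2"
  shows "gradient (radial_extension (Y l m)) x =
    map_matrix complex_of_real (tangent_projection x) *v (\<chi> j. partial_deriv j (q l m) x)"
  by (simp add: gradient_def matrix_vector_mult_def map_matrix_def partial_deriv_radial_extension[OF assms])

end

text \<open>Cauchy-Schwarz in each row gives 12 = 3 * 2^2, and the three rows give 36.\<close>

lemma norm_matrix_vector_le:
  fixes A :: "real^3^3" and v :: "complex^3"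
  assumes "\<And>i j. \<bar>A $ i $ j\<bar> \<le> 2"
  shows "(norm (map_matrix complex_of_real A *v v))\<^sup>2 \<le> 36 * (norm v)\<^sup>2"
proof -
  have "(norm ((map_matrix complex_of_real A *v v) $ i))\<^sup>2 \<le> 12 * (norm v)\<^sup>2" for i
  proof -
    have "norm ((map_matrix complex_of_real A *v v) $ i) \<le> (\<Sum>j\<in>UNIV. \<bar>A $ i $ j\<bar> * norm (v $ j))"
      by (simp add: matrix_vector_mult_def map_matrix_def) (rule order.trans[OF norm_sum], simp add: norm_mult)
    then have "(norm ((map_matrix complex_of_real A *v v) $ i))\<^sup>2 \<le> (\<Sum>j\<in>UNIV. \<bar>A $ i $ j\<bar> * norm (v $ j))\<^sup>2"
      by (intro power_mono) auto
    also have "\<dots> \<le> (\<Sum>j\<in>UNIV. \<bar>A $ i $ j\<bar>\<^sup>2) * (\<Sum>j\<in>UNIV. (norm (v $ j))\<^sup>2)"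
      by (rule Cauchy_Schwarz_ineq_sum)
    also have "(\<Sum>j\<in>UNIV. \<bar>A $ i $ j\<bar>\<^sup>2) \<le> (\<Sum>j\<in>(UNIV::3 set). 2\<^sup>2)"
      using assms by (intro sum_mono power_mono) auto
    finally show ?thesis by (simp add: norm_vec_power2 mult_right_mono sum_nonneg)
  qed
  then have "(norm (map_matrix complex_of_real A *v v))\<^sup>2 \<le> (\<Sum>i\<in>(UNIV::3 set). 12 * (norm v)\<^sup>2)"
    unfolding norm_vec_power2[of "map_matrix complex_of_real A *v v"] by (intro sum_mono)
  then show ?thesis by simp
qed

lemma component_le_1_S2: "x \<in> S2 \<Longrightarrow> \<bar>x $ i\<bar> \<le> 1"
  using component_le_norm_cart[of x i] by simp

lemma tangent_projection_entry_le:
  assumes "x \<in> S2"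
  shows "\<bar>tangent_projection x $ i $ j\<bar> \<le> 2"
proof -
  have "\<bar>x $ i * x $ j\<bar> \<le> 1 * 1" unfolding abs_mult by (intro mult_mono component_le_1_S2 assms) auto
  then have "- 1 \<le> x $ i * x $ j" "x $ i * x $ j \<le> 1" by linarith+
  then show ?thesis by (auto simp: tangent_projection_def mat_def)
qed

lemma cross_matrix_entry_le:
  assumes "x \<in> S2"
  shows "\<bar>cross_matrix x $ i $ j\<bar> \<le> 2"
  using exhaust_3[of i] exhaust_3[of j] component_le_1_S2[OF assms, of 1] component_le_1_S2[OF assms, of 2]
    component_le_1_S2[OF assms, of 3]
  by (auto simp: cross_matrix_def)

lemma dotc_matrix_zero:
  assumes "\<And>j. (\<Sum>i\<in>UNIV. x $ i * A $ i $ j) = 0"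
  shows "dotc (map_matrix complex_of_real A *v v) (\<chi> i. complex_of_real (x $ i)) = 0"
proof -
  have "dotc (map_matrix complex_of_real A *v v) (\<chi> i. complex_of_real (x $ i)) =
     (\<Sum>i\<in>UNIV. \<Sum>j\<in>UNIV. complex_of_real (x $ i * A $ i $ j) * v $ j)"
    by (simp add: dotc_def matrix_vector_mult_def map_matrix_def sum_distrib_left mult_ac)
  also have "\<dots> = (\<Sum>j\<in>UNIV. complex_of_real (\<Sum>i\<in>UNIV. x $ i * A $ i $ j) * v $ j)"
    by (subst sum.swap) (simp add: sum_distrib_right)
  finally show ?thesis using assms by simp
qed

lemma tangent_projection_left_kernel:
  assumes "x \<in> S2"
  shows "(\<Sum>i\<in>UNIV. x $ i * tangent_projection x $ i $ j) = 0"
proof -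
  have 1: "x $ 1 * x $ 1 + x $ 2 * x $ 2 + x $ 3 * x $ 3 = 1"
    using assms norm_vec_power2[of x] by (simp add: sum_3 power2_eq_square)
  have "(\<Sum>i\<in>UNIV. x $ i * tangent_projection x $ i $ j) = x $ j - x $ j * (x $ 1 * x $ 1 + x $ 2 * x $ 2 + x $ 3 * x $ 3)"
    using exhaust_3[of j] by (auto simp: tangent_projection_def mat_def sum_3 algebra_simps)
  then show ?thesis unfolding 1 by simp
qed

lemma cross_matrix_left_kernel: "(\<Sum>i\<in>UNIV. x $ i * cross_matrix x $ i $ j) = 0"
  using exhaust_3[of j] by (auto simp: cross_matrix_def sum_3)

lemma eigval_pos: "1 \<le> l \<Longrightarrow> 0 < eigval l"
  by (simp add: eigval_def)

context harmonic_basis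
begin

definition grad_q :: "nat \<Rightarrow> int \<Rightarrow> real^3 \<Rightarrow> complex^3" where
  "grad_q l m x = (\<chi> j. partial_deriv j (q l m) x)"

text \<open>The inner projection comes from the radial extension, the outer matrix from the surface
  operator.\<close>

lemma vsh_eq:
  assumes lm: "\<bar>m\<bar> \<le> int l" and x: "x \<in> S2"
  shows "vsh_y Y l m x = (map_matrix complex_of_real (cross_matrix x) *v
      (map_matrix complex_of_real (tangent_projection x) *v grad_q l m x)) /\<^sub>R sqrt (eigval l)"
    and "vsh_z Y l m x = (map_matrix complex_of_real (tangent_projection x) *v
      (map_matrix complex_of_real (tangent_projection x) *v grad_q l m x)) /\<^sub>R sqrt (eigval l)"
  by (simp_all add: vsh_y_def vsh_z_def surface_curl_def surface_gradient_def gradient_radial_extension[OF assms] grad_q_def)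

lemma vsh_tangent:
  assumes lm: "\<bar>m\<bar> \<le> int l" and x: "x \<in> S2"
  shows "dotc (vsh_y Y l m x) (\<chi> i. complex_of_real (x $ i)) = 0"
    and "dotc (vsh_z Y l m x) (\<chi> i. complex_of_real (x $ i)) = 0"
proof -
  have sc: "dotc (v /\<^sub>R r) w = dotc v w /\<^sub>R r" for v w r
    by (simp add: dotc_def scaleR_sum_right)
  show "dotc (vsh_y Y l m x) (\<chi> i. complex_of_real (x $ i)) = 0"
    unfolding vsh_eq[OF assms] sc dotc_matrix_zero[OF cross_matrix_left_kernel] by simp
  show "dotc (vsh_z Y l m x) (\<chi> i. complex_of_real (x $ i)) = 0"
    unfolding vsh_eq[OF assms] sc dotc_matrix_zero[OF tangent_projection_left_kernel[OF x]] by simp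
qed

text \<open>\<open>1296 = 36 * 36\<close>, one factor 36 for each of the two matrices; it is not sharp.\<close>

lemma norm_vsh_le:
  assumes lm: "\<bar>m\<bar> \<le> int l" and l: "1 \<le> l" and x: "x \<in> S2"
  shows "(norm (vsh_y Y l m x))\<^sup>2 \<le> 1296 * (norm (grad_q l m x))\<^sup>2 / eigval l"
    and "(norm (vsh_z Y l m x))\<^sup>2 \<le> 1296 * (norm (grad_q l m x))\<^sup>2 / eigval l"
proof -
  note T = norm_matrix_vector_le[of "tangent_projection x", OF tangent_projection_entry_le[OF x]]
  note C = norm_matrix_vector_le[of "cross_matrix x", OF cross_matrix_entry_le[OF x]]
  have e: "eigval l > 0" by (rule eigval_pos[OF l])
  have sc: "(norm (v /\<^sub>R sqrt (eigval l)))\<^sup>2 = (norm v)\<^sup>2 / eigval l" for v :: "complex^3"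
    using e by (simp add: power_mult_distrib power_inverse divide_inverse mult.commute)
  show "(norm (vsh_y Y l m x))\<^sup>2 \<le> 1296 * (norm (grad_q l m x))\<^sup>2 / eigval l"
    unfolding vsh_eq[OF lm x] sc
    using C[of "map_matrix complex_of_real (tangent_projection x) *v grad_q l m x"] T[of "grad_q l m x"] e
    by (intro divide_right_mono) auto
  show "(norm (vsh_z Y l m x))\<^sup>2 \<le> 1296 * (norm (grad_q l m x))\<^sup>2 / eigval l"
    unfolding vsh_eq[OF lm x] sc
    using T[of "map_matrix complex_of_real (tangent_projection x) *v grad_q l m x"] T[of "grad_q l m x"] e
    by (intro divide_right_mono) auto
qed

text \<open>The gradients sum to order (2l + 1) \<lambda>_l, since l (2l + 1) \<le> 2 \<lambda>_l;
  the normalisation by \<lambda>_l leaves the multiplicity 2l + 1.\<close>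

lemma sum_norm_vsh_le:
  assumes l: "1 \<le> l" and x: "x \<in> S2"
  shows "(\<Sum>m=-int l..int l. (norm (vsh_y Y l m x))\<^sup>2) \<le> 1296 * (2 * real l + 1)"
    and "(\<Sum>m=-int l..int l. (norm (vsh_z Y l m x))\<^sup>2) \<le> 1296 * (2 * real l + 1)"
proof -
  have e: "eigval l > 0" by (rule eigval_pos[OF l])
  have g: "(\<Sum>m=-int l..int l. (norm (grad_q l m x))\<^sup>2) = (2 * real l + 1) / (4 * pi) * (real l * (2 * real l + 1))"
    unfolding norm_vec_power2 grad_q_def using gradient_power_sum[OF x, of l] by simp
  also have "\<dots> \<le> (2 * real l + 1) / (4 * pi) * (2 * eigval l)"
    by (intro mult_left_mono) (auto simp: eigval_def algebra_simps)
  also have "\<dots> = (2 * real l + 1) * eigval l * (1 / (2 * pi))" by simp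
  also have "\<dots> \<le> (2 * real l + 1) * eigval l * 1"
    using e pi_gt3 by (intro mult_left_mono) (auto simp: field_simps)
  finally have "1296 * (\<Sum>m=-int l..int l. (norm (grad_q l m x))\<^sup>2) / eigval l \<le> 1296 * ((2 * real l + 1) * eigval l * 1) / eigval l"
    using e by (intro divide_right_mono mult_left_mono) auto
  also have "\<dots> = 1296 * (2 * real l + 1)" using e by simp
  finally have "(\<Sum>m=-int l..int l. 1296 * (norm (grad_q l m x))\<^sup>2 / eigval l) \<le> 1296 * (2 * real l + 1)"
    unfolding sum_divide_distrib sum_distrib_left .
  moreover have "(\<Sum>m=-int l..int l. (norm (vsh_y Y l m x))\<^sup>2) \<le> (\<Sum>m=-int l..int l. 1296 * (norm (grad_q l m x))\<^sup>2 / eigval l)"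
    by (intro sum_mono norm_vsh_le l x) auto
  moreover have "(\<Sum>m=-int l..int l. (norm (vsh_z Y l m x))\<^sup>2) \<le> (\<Sum>m=-int l..int l. 1296 * (norm (grad_q l m x))\<^sup>2 / eigval l)"
    by (intro sum_mono norm_vsh_le l x) auto
  ultimately show "(\<Sum>m=-int l..int l. (norm (vsh_y Y l m x))\<^sup>2) \<le> 1296 * (2 * real l + 1)"
    "(\<Sum>m=-int l..int l. (norm (vsh_z Y l m x))\<^sup>2) \<le> 1296 * (2 * real l + 1)" by linarith+
qed

lemma measurable_vsh:
  assumes lm: "\<bar>m\<bar> \<le> int l"
  shows "vsh_y Y l m \<in> borel_measurable sphere_measure" "vsh_z Y l m \<in> borel_measurable sphere_measure"
proof -
  have c: "continuous_on UNIV (\<lambda>x. partial_deriv j (q l m) x)" for j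
    by (intro continuous_on_cpoly cpoly_partial_deriv cpoly_q lm)
  have g: "continuous_on UNIV (\<lambda>x. grad_q l m x)"
    unfolding grad_q_def by (intro continuous_on_vec_lambda c)
  have mv: "continuous_on UNIV (\<lambda>x. map_matrix complex_of_real (A x) *v v x)"
    if "\<And>i j. continuous_on UNIV (\<lambda>x::real^3. A x $ i $ j)" "continuous_on UNIV v"
    for A :: "real^3 \<Rightarrow> real^3^3" and v :: "real^3 \<Rightarrow> complex^3"
  proof -
    have "continuous_on UNIV (\<lambda>x. \<Sum>j\<in>UNIV. complex_of_real (A x $ i $ j) * v x $ j)" for i
      by (intro continuous_on_sum continuous_on_mult continuous_on_of_real that(1) continuous_on_component[OF that(2)])
    then have "continuous_on UNIV (\<lambda>x. \<chi> i. \<Sum>j\<in>UNIV. complex_of_real (A x $ i $ j) * v x $ j)"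
      by (intro continuous_on_vec_lambda)
    then show ?thesis by (simp add: matrix_vector_mult_def map_matrix_def)
  qed
  have T: "continuous_on UNIV (\<lambda>x. tangent_projection x $ i $ j)" for i j
    unfolding tangent_projection_def by (auto intro!: continuous_intros)
  have C: "continuous_on UNIV (\<lambda>x. cross_matrix x $ i $ j)" for i j
    using exhaust_3[of i] exhaust_3[of j] 
    by (elim disjE) (simp_all add: cross_matrix_def continuous_on_minus continuous_on_component)
  have "(\<lambda>x. (map_matrix complex_of_real (cross_matrix x) *v
      (map_matrix complex_of_real (tangent_projection x) *v grad_q l m x)) /\<^sub>R sqrt (eigval l)) \<in> borel_measurable sphere_measure"
    by (intro continuous_measurable_sphere_measure continuous_on_scaleR continuous_on_const mv T C g)
  then show "vsh_y Y l m \<in> borel_measurable sphere_measure"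
    by (rule measurable_cong[THEN iffD1, rotated]) (simp only: space_sphere_measure vsh_eq[OF lm])
  have "(\<lambda>x. (map_matrix complex_of_real (tangent_projection x) *v
      (map_matrix complex_of_real (tangent_projection x) *v grad_q l m x)) /\<^sub>R sqrt (eigval l)) \<in> borel_measurable sphere_measure"
    by (intro continuous_measurable_sphere_measure continuous_on_scaleR continuous_on_const mv T C g)
  then show "vsh_z Y l m \<in> borel_measurable sphere_measure"
    by (rule measurable_cong[THEN iffD1, rotated]) (simp only: space_sphere_measure vsh_eq[OF lm])
qed

end

section \<open>Tails and mean-square limits of random fields\<close>

text \<open>No sign is imposed at l = 0: the fields contain degrees l \<ge> 1 only, and
  \<open>tail L\<close> starts at L + 1.\<close>

locale weighted_tail =
  fixes w :: "nat \<Rightarrow> real"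
  assumes nonneg: "1 \<le> l \<Longrightarrow> 0 \<le> w l"
    and summable_w: "summable (\<lambda>l. (2 * real l + 1) * w l)"
begin

definition tail :: "nat \<Rightarrow> real" where
  "tail L = (\<Sum>k. (2 * real (L + 1 + k) + 1) * w (L + 1 + k))"

lemma summable_tail: "summable (\<lambda>k. (2 * real (L + 1 + k) + 1) * w (L + 1 + k))"
  using summable_ignore_initial_segment[OF summable_w, of "L + 1"] by (simp add: add_ac)

lemma term_nonneg: "0 \<le> (2 * real (L + 1 + k) + 1) * w (L + 1 + k)"
  by (intro mult_nonneg_nonneg nonneg) auto

lemma tail_nonneg: "0 \<le> tail L"
  unfolding tail_def by (intro suminf_nonneg summable_tail term_nonneg)

lemma sum_le_tail:
  assumes "L \<le> N"
  shows "(\<Sum>l\<in>{Suc L..N}. (2 * real l + 1) * w l) \<le> tail L"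
proof -
  have "(\<Sum>l\<in>{Suc L..N}. (2 * real l + 1) * w l) = (\<Sum>k<N - L. (2 * real (L + 1 + k) + 1) * w (L + 1 + k))"
    by (rule sum.reindex_bij_witness[of _ "\<lambda>k. L + 1 + k" "\<lambda>l. l - L - 1"]) auto
  also have "\<dots> \<le> tail L"
    unfolding tail_def by (rule sum_le_suminf[OF summable_tail]) (blast intro: term_nonneg)+
  finally show ?thesis .
qed

lemma tail_tendsto_0: "tail \<longlonglongrightarrow> 0"
proof -
  define f where "f l = (2 * real l + 1) * w l" for l
  have "tail L = (\<Sum>l. f l) - (\<Sum>l<L + 1. f l)" for L
    using suminf_minus_initial_segment[OF summable_w[folded f_def], of "L + 1"]
    by (simp add: tail_def f_def add_ac)
  moreover have "(\<lambda>L. (\<Sum>l. f l) - (\<Sum>l<L + 1. f l)) \<longlonglongrightarrow> (\<Sum>l. f l) - (\<Sum>l. f l)"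
    using LIMSEQ_Suc[OF summable_LIMSEQ[OF summable_w[folded f_def]]]
    by (intro tendsto_diff tendsto_const) (simp del: sum.lessThan_Suc)
  ultimately have "(\<lambda>L. tail L) \<longlonglongrightarrow> (\<Sum>l. f l) - (\<Sum>l. f l)" by (simp only:)
  then show ?thesis by simp
qed

text \<open>With a = \<nu> - 2 the terms are of order l^(-a - 1). By the mean value theorem each is
  at most a multiple of a difference of consecutive values of l^(-a), and these telescope to
  L^(-a).\<close>

lemma tail_decay:
  assumes \<nu>: "2 < \<nu>" and decay: "\<And>l. l0 \<le> l \<Longrightarrow> w l \<le> C0 * real l powr (- \<nu>)" and C0: "0 < C0" and l0: "1 \<le> l0"
  shows "\<exists>C>0. \<forall>L\<ge>1. tail L \<le> C * real L powr (- (\<nu> - 2))"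
proof -
  define a where "a = \<nu> - 2"
  have a: "a > 0" using \<nu> by (simp add: a_def)
  \<comment> \<open>Absorbs the finitely many degrees below \<open>l0\<close>, because the claim
    concerns all L \<ge> 1.\<close>
  define C1 where "C1 = C0 + (\<Sum>l\<in>{1..<l0}. w l * real l powr \<nu>)"
  have s0: "0 \<le> (\<Sum>l\<in>{1..<l0}. w l * real l powr \<nu>)" by (intro sum_nonneg mult_nonneg_nonneg nonneg) auto
  have C1: "C1 > 0" using C0 s0 by (simp add: C1_def)
  have wl: "w l \<le> C1 * real l powr (- \<nu>)" if "1 \<le> l" for l
  proof (cases "l0 \<le> l")
    case True
    have "w l \<le> C0 * real l powr (- \<nu>)" by (rule decay[OF True])
    also have "\<dots> \<le> C1 * real l powr (- \<nu>)" using s0 by (intro mult_right_mono) (auto simp: C1_def)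
    finally show ?thesis .
  next
    case False
    have "w l = (w l * real l powr \<nu>) * real l powr (- \<nu>)" using that by (simp add: powr_minus)
    also have "\<dots> \<le> C1 * real l powr (- \<nu>)"
    proof (rule mult_right_mono)
      have "w l * real l powr \<nu> \<le> (\<Sum>l\<in>{1..<l0}. w l * real l powr \<nu>)"
        by (rule member_le_sum) (use that False in \<open>auto intro!: mult_nonneg_nonneg nonneg\<close>)
      then show "w l * real l powr \<nu> \<le> C1" using C0 by (simp add: C1_def)
    qed simp
    finally show ?thesis .
  qed
  have step: "(2 * real (Suc n) + 1) * w (Suc n) \<le> 3 * C1 / a * (real n powr (- a) - real (Suc n) powr (- a))"
    if n: "1 \<le> n" for n
  proof -
    have "((\<lambda>x. - (x powr (- a))) has_real_derivative (a * x powr (- a - 1))) (at x)" if "0 < x" for x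
      using that by (auto intro!: derivative_eq_intros)
    then have "\<exists>z. z > real n \<and> z < real (Suc n) \<and> - (real (Suc n) powr (- a)) - (- (real n powr (- a))) = (real (Suc n) - real n) * (a * z powr (- a - 1))"
      using n by (intro MVT2) auto
    then obtain z where z: "real n < z" "z < real (Suc n)" "real n powr (- a) - real (Suc n) powr (- a) = a * z powr (- a - 1)"
      by auto
    have "(2 * real (Suc n) + 1) * w (Suc n) \<le> (3 * real (Suc n)) * (C1 * real (Suc n) powr (- \<nu>))"
      using wl[of "Suc n"] nonneg[of "Suc n"] by (intro mult_mono) auto
    also have "\<dots> = 3 * C1 * real (Suc n) powr (- a - 1)"
      using powr_add[of "real (Suc n)" 1 "- \<nu>"] by (simp add: a_def)
    also have "\<dots> \<le> 3 * C1 * z powr (- a - 1)"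
      using z n a C1 by (intro mult_left_mono powr_mono2') auto
    also have "\<dots> = 3 * C1 / a * (real n powr (- a) - real (Suc n) powr (- a))" unfolding z(3) using a by simp
    finally show ?thesis .
  qed
  have "tail L \<le> 3 * C1 / a * real L powr (- a)" if L: "1 \<le> L" for L
  proof -
    have "(\<lambda>k. real (L + k) powr (- a)) \<longlonglongrightarrow> 0"
    proof -
      have "(\<lambda>k. real k powr (- a)) \<longlonglongrightarrow> 0"
        by (rule tendsto_neg_powr) (use a filterlim_real_sequentially in auto)
      from LIMSEQ_ignore_initial_segment[OF this, of L] show ?thesis by (simp only: add.commute)
    qed
    from telescope_sums'[OF this]
    have "(\<lambda>k. real (L + k) powr (- a) - real (L + Suc k) powr (- a)) sums (real L powr (- a))" by simp
    then have sm: "(\<lambda>k. 3 * C1 / a * (real (L + k) powr (- a) - real (L + Suc k) powr (- a))) sums (3 * C1 / a * real L powr (- a))"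
      by (rule sums_mult)
    have "tail L \<le> (\<Sum>k. 3 * C1 / a * (real (L + k) powr (- a) - real (L + Suc k) powr (- a)))"
      unfolding tail_def
    proof (rule suminf_le[OF _ summable_tail sums_summable[OF sm]])
      fix k
      show "(2 * real (L + 1 + k) + 1) * w (L + 1 + k) \<le> 3 * C1 / a * (real (L + k) powr (- a) - real (L + Suc k) powr (- a))"
        using step[of "L + k"] L by simp
    qed
    then show ?thesis using sm by (simp add: sums_iff)
  qed
  then show ?thesis using C1 a by (intro exI[of _ "3 * C1 / a"]) (auto simp: a_def)
qed

end

section \<open>Random fields as mean-square limits\<close>

lemma nn_integral_norm_power2:
  fixes f :: "'a \<Rightarrow> 'b::{second_countable_topology, banach}"
  assumes "square_integrable M f"
  shows "(\<integral>\<^sup>+x. ennreal ((norm (f x))\<^sup>2) \<partial>M) = ennreal (\<integral>x. (norm (f x))\<^sup>2 \<partial>M)"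
  using assms by (intro nn_integral_eq_integral) (auto simp: square_integrable_def)

lemma square_integrable_if_nn_integral_le:
  fixes f :: "'a \<Rightarrow> 'b::{second_countable_topology, banach}"
  assumes [measurable]: "f \<in> borel_measurable M" and le: "(\<integral>\<^sup>+x. ennreal ((norm (f x))\<^sup>2) \<partial>M) \<le> ennreal c" and c: "0 \<le> c"
  shows "square_integrable M f" "(\<integral>x. (norm (f x))\<^sup>2 \<partial>M) \<le> c"
proof -
  have "(\<integral>\<^sup>+x. ennreal (norm ((norm (f x))\<^sup>2)) \<partial>M) < \<infinity>"
    using le by (auto simp: le_less_trans[OF _ ennreal_less_top])
  then have "integrable M (\<lambda>x. (norm (f x))\<^sup>2)" by (intro integrableI_bounded) auto
  then show sq: "square_integrable M f" by (simp add: square_integrable_def)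
  show "(\<integral>x. (norm (f x))\<^sup>2 \<partial>M) \<le> c"
    using le c unfolding nn_integral_norm_power2[OF sq] by (simp add: ennreal_le_iff)
qed

lemma (in prob_space) pair_sigma_finite_sphere: "pair_sigma_finite M sphere_measure"
proof -
  interpret S: finite_measure sphere_measure by (rule finite_measure_sphere_measure)
  show ?thesis by unfold_locales
qed

text \<open>Tonelli, then integration over area 4 pi. The hypothesis uses the nonnegative integral,
  which has no default value for non-integrable functions, so that square integrability is a
  conclusion.\<close>

lemma (in prob_space) field_norm_from_pointwise:
  fixes f :: "'a \<Rightarrow> real^3 \<Rightarrow> complex^3"
  assumes meas: "(\<lambda>(\<omega>, x). f \<omega> x) \<in> borel_measurable (M \<Otimes>\<^sub>M sphere_measure)" and c: "0 \<le> c"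
    and le: "\<And>x. x \<in> S2 \<Longrightarrow> (\<integral>\<^sup>+\<omega>. ennreal ((norm (f \<omega> x))\<^sup>2) \<partial>M) \<le> ennreal c"
  shows "square_integrable (M \<Otimes>\<^sub>M sphere_measure) (\<lambda>(\<omega>, x). f \<omega> x)"
    and "L2_field_norm M f \<le> sqrt (4 * pi * c)"
proof -
  interpret PS: pair_sigma_finite M sphere_measure by (rule pair_sigma_finite_sphere)
  define F where "F = (\<lambda>(\<omega>, x). f \<omega> x)"
  have [measurable]: "F \<in> borel_measurable (M \<Otimes>\<^sub>M sphere_measure)" using meas by (simp add: F_def)
  have "(\<integral>\<^sup>+z. ennreal ((norm (F z))\<^sup>2) \<partial>(M \<Otimes>\<^sub>M sphere_measure)) =
      (\<integral>\<^sup>+x. (\<integral>\<^sup>+\<omega>. ennreal ((norm (F (\<omega>, x)))\<^sup>2) \<partial>M) \<partial>sphere_measure)"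
    by (rule PS.nn_integral_snd[symmetric]) measurable
  also have "\<dots> \<le> (\<integral>\<^sup>+x. ennreal c \<partial>sphere_measure)"
    by (rule nn_integral_mono) (use le in \<open>auto simp: F_def\<close>)
  also have "\<dots> = ennreal (4 * pi * c)"
    by (simp add: emeasure_sphere_measure ennreal_mult'[symmetric] c mult.commute)
  finally have nn: "(\<integral>\<^sup>+z. ennreal ((norm (F z))\<^sup>2) \<partial>(M \<Otimes>\<^sub>M sphere_measure)) \<le> ennreal (4 * pi * c)" .
  note sq = square_integrable_if_nn_integral_le[OF _ nn]
  have sqF: "square_integrable (M \<Otimes>\<^sub>M sphere_measure) F" "(\<integral>z. (norm (F z))\<^sup>2 \<partial>(M \<Otimes>\<^sub>M sphere_measure)) \<le> 4 * pi * c"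
    using c by (auto intro: sq)
  then show "square_integrable (M \<Otimes>\<^sub>M sphere_measure) (\<lambda>(\<omega>, x). f \<omega> x)" by (simp add: F_def)
  have "(\<integral>\<omega>. (\<integral>x. (norm (F (\<omega>, x)))\<^sup>2 \<partial>sphere_measure) \<partial>M) = (\<integral>z. (norm (F z))\<^sup>2 \<partial>(M \<Otimes>\<^sub>M sphere_measure))"
    using sqF(1) by (intro PS.integral_fst') (simp add: square_integrable_def)
  then show "L2_field_norm M f \<le> sqrt (4 * pi * c)"
    using sqF(2) by (simp add: L2_field_norm_def F_def)
qed

text \<open>The Cauchy bound \<open>T L\<close> is uniform in x and N. With \<open>S_0\<close>, its
  case L = 0 also bounds the fields themselves and, in the limit, their sum.\<close>

locale cauchy_fields = prob_space M for M :: "'w measure" +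
  fixes S :: "nat \<Rightarrow> 'w \<Rightarrow> real^3 \<Rightarrow> complex^3" and T :: "nat \<Rightarrow> real"
  assumes S_meas: "(\<lambda>(\<omega>, x). S L \<omega> x) \<in> borel_measurable (M \<Otimes>\<^sub>M sphere_measure)"
    and S_sq: "x \<in> S2 \<Longrightarrow> square_integrable M (\<lambda>\<omega>. S L \<omega> x)"
    and S_tangent: "x \<in> S2 \<Longrightarrow> dotc (S L \<omega> x) (\<chi> i. complex_of_real (x $ i)) = 0"
    and S_0: "S 0 \<omega> x = 0"
    and S_cauchy: "x \<in> S2 \<Longrightarrow> L \<le> N \<Longrightarrow> (\<integral>\<omega>. (norm (S N \<omega> x - S L \<omega> x))\<^sup>2 \<partial>M) \<le> T L"
    and T_lim: "T \<longlonglongrightarrow> 0"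
    and T_nonneg: "0 \<le> T L"
begin

text \<open>Minkowski's inequality with S N in between; the bound on S N - S L is uniform in N and
  survives as N tends to infinity.\<close>

lemma field_sum_pointwise:
  assumes X: "is_field_sum M S X" and x: "x \<in> S2"
  shows "square_integrable M (\<lambda>\<omega>. X \<omega> x - S L \<omega> x)"
    and "(\<integral>\<omega>. (norm (X \<omega> x - S L \<omega> x))\<^sup>2 \<partial>M) \<le> T L"
proof -
  have sqX: "square_integrable M (\<lambda>\<omega>. X \<omega> x)"
    and lim: "(\<lambda>N. \<integral>\<omega>. (norm (X \<omega> x - S N \<omega> x))\<^sup>2 \<partial>M) \<longlonglongrightarrow> 0"
    using X x by (auto simp: is_field_sum_def)
  have sq: "square_integrable M (\<lambda>\<omega>. X \<omega> x - S N \<omega> x)" for N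
    by (intro square_integrable_diff sqX S_sq[OF x])
  then show "square_integrable M (\<lambda>\<omega>. X \<omega> x - S L \<omega> x)" .
  have "(\<lambda>N. sqrt (\<integral>\<omega>. (norm (X \<omega> x - S N \<omega> x))\<^sup>2 \<partial>M) + sqrt (T L)) \<longlonglongrightarrow> sqrt 0 + sqrt (T L)"
    by (intro tendsto_intros lim)
  moreover have "\<forall>\<^sub>F N in sequentially. sqrt (\<integral>\<omega>. (norm (X \<omega> x - S L \<omega> x))\<^sup>2 \<partial>M) \<le>
      sqrt (\<integral>\<omega>. (norm (X \<omega> x - S N \<omega> x))\<^sup>2 \<partial>M) + sqrt (T L)"
    unfolding eventually_sequentially
  proof (intro exI[of _ L] allI impI)
    fix N assume N: "L \<le> N"
    have "sqrt (\<integral>\<omega>. (norm (X \<omega> x - S L \<omega> x))\<^sup>2 \<partial>M) \<le>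
      sqrt (\<integral>\<omega>. (norm (X \<omega> x - S N \<omega> x))\<^sup>2 \<partial>M) + sqrt (\<integral>\<omega>. (norm (S N \<omega> x - S L \<omega> x))\<^sup>2 \<partial>M)"
      using Minkowski_integral[OF sq[of N] square_integrable_diff[OF S_sq[OF x, of N] S_sq[OF x, of L]]] by simp
    also have "sqrt (\<integral>\<omega>. (norm (S N \<omega> x - S L \<omega> x))\<^sup>2 \<partial>M) \<le> sqrt (T L)"
      using S_cauchy[OF x N] by simp
    finally show "sqrt (\<integral>\<omega>. (norm (X \<omega> x - S L \<omega> x))\<^sup>2 \<partial>M) \<le>
      sqrt (\<integral>\<omega>. (norm (X \<omega> x - S N \<omega> x))\<^sup>2 \<partial>M) + sqrt (T L)" by simp
  qed
  ultimately have "sqrt (\<integral>\<omega>. (norm (X \<omega> x - S L \<omega> x))\<^sup>2 \<partial>M) \<le> sqrt 0 + sqrt (T L)"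
    by (rule tendsto_lowerbound) simp
  then show "(\<integral>\<omega>. (norm (X \<omega> x - S L \<omega> x))\<^sup>2 \<partial>M) \<le> T L" by simp
qed

lemma field_sum_L2:
  assumes X: "is_field_sum M S X"
  shows "L2_field_norm M (\<lambda>\<omega> x. X \<omega> x - S L \<omega> x) \<le> sqrt (4 * pi * T L)"
proof (rule field_norm_from_pointwise(2)[OF _ T_nonneg])
  have "(\<lambda>(\<omega>, x). X \<omega> x) \<in> borel_measurable (M \<Otimes>\<^sub>M sphere_measure)"
    using X by (simp add: is_field_sum_def L2_random_tangent_field_def square_integrable_def)
  from borel_measurable_diff[OF this S_meas[of L]]
  show "(\<lambda>(\<omega>, x). X \<omega> x - S L \<omega> x) \<in> borel_measurable (M \<Otimes>\<^sub>M sphere_measure)"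
    by (simp add: case_prod_beta')
  show "(\<integral>\<^sup>+\<omega>. ennreal ((norm (X \<omega> x - S L \<omega> x))\<^sup>2) \<partial>M) \<le> ennreal (T L)" if "x \<in> S2" for x
    unfolding nn_integral_norm_power2[OF field_sum_pointwise(1)[OF X that]]
    using field_sum_pointwise(2)[OF X that] by (simp add: ennreal_leI)
qed

text \<open>Along a subsequence with \<open>T (r k) \<le> 1 / 4 ^ k\<close> the fields converge almost surely at every
  point of the sphere; \<open>X\<close> is this limit, and \<open>0\<close> where the subsequence diverges.\<close>

lemma field_sum_exists: "\<exists>X. is_field_sum M S X"
proof -
  have "\<exists>n. \<forall>L\<ge>n. T L < (1 / 4) ^ k" for k :: nat
    using order_tendstoD(2)[OF T_lim, of "(1 / 4) ^ k"] by (auto simp: eventually_sequentially)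
  then obtain n0 where n0: "\<And>k L. n0 k \<le> L \<Longrightarrow> T L < (1 / 4) ^ k" by metis
  \<comment> \<open>The partial sums make r monotone and at least n0 k; the summand k makes it
    unbounded.\<close>
  define r where "r k = k + (\<Sum>j\<le>k. n0 j)" for k
  have r_mono: "r k \<le> r (Suc k)" and r_ge: "k \<le> r k" and r_n0: "n0 k \<le> r k" for k
    by (auto simp: r_def intro: order.trans[OF member_le_sum[of k "{..k}" n0]])
  have Tr: "T (r k) < (1 / 4) ^ k" for k by (rule n0[OF r_n0])
  define G where "G k z = (case z of (\<omega>, x) \<Rightarrow> S (r k) \<omega> x)" for k z
  have G[measurable]: "G k \<in> borel_measurable (M \<Otimes>\<^sub>M sphere_measure)" for k
    using S_meas[of "r k"] by (simp add: G_def[abs_def])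
  \<comment> \<open>The limit is taken on pairs and not separately for each x, which makes the field
    jointly measurable.\<close>
  define Z where "Z z = (if Cauchy (\<lambda>k. G k z) then lim (\<lambda>k. G k z) else 0)" for z
  have Z[measurable]: "Z \<in> borel_measurable (M \<Otimes>\<^sub>M sphere_measure)"
    unfolding Z_def[abs_def] by measurable
  define X where "X \<omega> x = Z (\<omega>, x)" for \<omega> x
  have Xm: "(\<lambda>(\<omega>, x). X \<omega> x) \<in> borel_measurable (M \<Otimes>\<^sub>M sphere_measure)"
    using Z by (simp add: X_def case_prod_beta')
  have Xx: "(\<lambda>\<omega>. X \<omega> x) \<in> borel_measurable M" if "x \<in> S2" for x
    unfolding X_def by (rule measurable_compose[OF measurable_Pair2' Z]) (use that in simp)
  have conv: "AE \<omega> in M. (\<lambda>k. S (r k) \<omega> x) \<longlonglongrightarrow> X \<omega> x" if x: "x \<in> S2" for x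
  proof -
    define d where "d k \<omega> = norm (S (r (Suc k)) \<omega> x - S (r k) \<omega> x)" for k \<omega>
    have dsq: "square_integrable M (\<lambda>\<omega>. S (r (Suc k)) \<omega> x - S (r k) \<omega> x)" for k
      by (intro square_integrable_diff S_sq[OF x])
    have dsq': "square_integrable M (d k)" for k
      unfolding d_def by (rule square_integrable_norm[OF dsq])
    then have [measurable]: "d k \<in> borel_measurable M" for k by (simp add: square_integrable_def)
    \<comment> \<open>On a probability space the L1 norm is at most the L2 norm, the root of T (r
      k). The expected increments are then summable, so the increments are summable almost
      surely.\<close>
    have dk: "(\<integral>\<^sup>+\<omega>. ennreal (d k \<omega>) \<partial>M) \<le> ennreal ((1 / 2) ^ k)" for k
    proof -
      have one: "square_integrable M (\<lambda>_. 1::real)" by (simp add: square_integrable_def)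
      have "(\<integral>\<omega>. d k \<omega> * 1 \<partial>M) \<le> sqrt (\<integral>\<omega>. (d k \<omega>)\<^sup>2 \<partial>M) * sqrt (\<integral>\<omega>. 1\<^sup>2 \<partial>M)"
        using Cauchy_Schwarz_integral[OF dsq'[of k] one] by linarith
      also have "\<dots> = sqrt (\<integral>\<omega>. (d k \<omega>)\<^sup>2 \<partial>M)" by (simp add: prob_space)
      also have "\<dots> \<le> sqrt ((1 / 4) ^ k)"
        using S_cauchy[OF x r_mono, of k] Tr[of k] unfolding d_def by (intro real_sqrt_le_mono) linarith
      also have "\<dots> = (1 / 2) ^ k" by (simp add: real_sqrt_power real_sqrt_divide)
      finally have "(\<integral>\<omega>. d k \<omega> \<partial>M) \<le> (1 / 2) ^ k" by simp
      moreover have "integrable M (d k)"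
        using integrable_mult_square_integrable[OF dsq'[of k] one] by simp
      ultimately show ?thesis
        by (subst nn_integral_eq_integral) (auto simp: d_def[abs_def] intro!: ennreal_leI)
    qed
    have "(\<integral>\<^sup>+\<omega>. (\<Sum>k. ennreal (d k \<omega>)) \<partial>M) = (\<Sum>k. \<integral>\<^sup>+\<omega>. ennreal (d k \<omega>) \<partial>M)"
      by (rule nn_integral_suminf) measurable
    also have "\<dots> \<le> (\<Sum>k. ennreal ((1 / 2) ^ k))"
      by (intro suminf_le dk) auto
    also have "\<dots> = ennreal (\<Sum>k. (1 / 2) ^ k)"
      by (rule suminf_ennreal2) (auto intro: summable_geometric)
    finally have "(\<integral>\<^sup>+\<omega>. (\<Sum>k. ennreal (d k \<omega>)) \<partial>M) \<noteq> \<infinity>"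
      by (auto simp: top_unique)
    then have "AE \<omega> in M. (\<Sum>k. ennreal (d k \<omega>)) \<noteq> \<infinity>"
      by (intro nn_integral_noteq_infinite) auto
    then show ?thesis
    proof eventually_elim
      case (elim \<omega>)
      have "summable (\<lambda>k. d k \<omega>)"
        by (rule summable_suminf_not_top) (use elim in \<open>auto simp: d_def\<close>)
      then have "summable (\<lambda>k. S (r (Suc k)) \<omega> x - S (r k) \<omega> x)"
        unfolding d_def by (rule summable_norm_cancel)
      then have "(\<lambda>n. \<Sum>k<n. S (r (Suc k)) \<omega> x - S (r k) \<omega> x) \<longlonglongrightarrow> (\<Sum>k. S (r (Suc k)) \<omega> x - S (r k) \<omega> x)"
        by (rule summable_LIMSEQ)
      then have "(\<lambda>n. S (r n) \<omega> x - S (r 0) \<omega> x) \<longlonglongrightarrow> (\<Sum>k. S (r (Suc k)) \<omega> x - S (r k) \<omega> x)"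
        by (simp only: sum_lessThan_telescope[of "\<lambda>k. S (r k) \<omega> x"])
      from tendsto_add[OF this tendsto_const[of "S (r 0) \<omega> x"]]
      have cv: "(\<lambda>n. G n (\<omega>, x)) \<longlonglongrightarrow> (\<Sum>k. S (r (Suc k)) \<omega> x - S (r k) \<omega> x) + S (r 0) \<omega> x"
        by (simp add: G_def)
      then have "Cauchy (\<lambda>n. G n (\<omega>, x))" by (rule LIMSEQ_imp_Cauchy)
      then have "X \<omega> x = lim (\<lambda>n. G n (\<omega>, x))" by (simp add: X_def Z_def)
      then have "(\<lambda>n. G n (\<omega>, x)) \<longlonglongrightarrow> X \<omega> x" using cv limI[OF cv] by simp
      then show ?case by (simp add: G_def)
    qed
  qed
  have bound: "(\<integral>\<^sup>+\<omega>. ennreal ((norm (X \<omega> x - S L \<omega> x))\<^sup>2) \<partial>M) \<le> ennreal (T L)" if x: "x \<in> S2" for x L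
  proof -
    have [measurable]: "(\<lambda>\<omega>. S N \<omega> x) \<in> borel_measurable M" for N using S_sq[OF x] by (simp add: square_integrable_def)
    \<comment> \<open>Fatou's lemma along the subsequence; X is not yet known to be square
      integrable.\<close>
    have "(\<integral>\<^sup>+\<omega>. ennreal ((norm (X \<omega> x - S L \<omega> x))\<^sup>2) \<partial>M) =
      (\<integral>\<^sup>+\<omega>. liminf (\<lambda>k. ennreal ((norm (S (r k) \<omega> x - S L \<omega> x))\<^sup>2)) \<partial>M)"
    proof (rule nn_integral_cong_AE)
      show "AE \<omega> in M. ennreal ((norm (X \<omega> x - S L \<omega> x))\<^sup>2) = liminf (\<lambda>k. ennreal ((norm (S (r k) \<omega> x - S L \<omega> x))\<^sup>2))"
        using conv[OF x]
      proof eventually_elim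
        case (elim \<omega>)
        then have "(\<lambda>k. ennreal ((norm (S (r k) \<omega> x - S L \<omega> x))\<^sup>2)) \<longlonglongrightarrow> ennreal ((norm (X \<omega> x - S L \<omega> x))\<^sup>2)"
          by (intro tendsto_ennrealI tendsto_intros)
        then show ?case using lim_imp_Liminf[OF sequentially_bot] by metis
      qed
    qed
    also have "\<dots> \<le> liminf (\<lambda>k. \<integral>\<^sup>+\<omega>. ennreal ((norm (S (r k) \<omega> x - S L \<omega> x))\<^sup>2) \<partial>M)"
      by (rule nn_integral_liminf) measurable
    also have "\<dots> \<le> ennreal (T L)"
    proof (rule Liminf_le)
      have "(\<integral>\<^sup>+\<omega>. ennreal ((norm (S (r k) \<omega> x - S L \<omega> x))\<^sup>2) \<partial>M) \<le> ennreal (T L)" if "L \<le> k" for k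
        using S_cauchy[OF x order.trans[OF that r_ge]]
        unfolding nn_integral_norm_power2[OF square_integrable_diff[OF S_sq[OF x] S_sq[OF x]]] by (simp add: ennreal_leI)
      then show "\<forall>\<^sub>F k in sequentially. (\<integral>\<^sup>+\<omega>. ennreal ((norm (S (r k) \<omega> x - S L \<omega> x))\<^sup>2) \<partial>M) \<le> ennreal (T L)"
        unfolding eventually_sequentially by blast
    qed simp
    finally show ?thesis .
  qed
  have diffm: "(\<lambda>(\<omega>, x). X \<omega> x - S L \<omega> x) \<in> borel_measurable (M \<Otimes>\<^sub>M sphere_measure)" for L
    using borel_measurable_diff[OF Xm S_meas[of L]] by (simp add: case_prod_beta')
  have "is_field_sum M S X"
    unfolding is_field_sum_def L2_random_tangent_field_def
  proof (intro conjI ballI)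
    show "square_integrable (M \<Otimes>\<^sub>M sphere_measure) (\<lambda>(\<omega>, x). X \<omega> x)"
      by (rule field_norm_from_pointwise(1)[OF Xm T_nonneg[of 0]]) (use bound[of _ 0] in \<open>simp add: S_0\<close>)
    \<comment> \<open>Holds everywhere: X is either a limit of tangent vectors or the default 0,
      which is tangent too.\<close>
    show "AE \<omega> in M. AE x in sphere_measure. dotc (X \<omega> x) (\<chi> i. complex_of_real (x $ i)) = 0"
    proof (intro AE_I2)
      fix \<omega> x assume "x \<in> space sphere_measure"
      then have x: "x \<in> S2" by simp
      show "dotc (X \<omega> x) (\<chi> i. complex_of_real (x $ i)) = 0"
      proof (cases "Cauchy (\<lambda>k. G k (\<omega>, x))")
        case True
        then have "(\<lambda>k. G k (\<omega>, x)) \<longlonglongrightarrow> X \<omega> x"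
          using Cauchy_convergent_iff convergent_LIMSEQ_iff by (auto simp: X_def Z_def)
        then have "(\<lambda>k. dotc (G k (\<omega>, x)) (\<chi> i. complex_of_real (x $ i))) \<longlonglongrightarrow> dotc (X \<omega> x) (\<chi> i. complex_of_real (x $ i))"
          unfolding dotc_def by (intro tendsto_intros)
        moreover have "dotc (G k (\<omega>, x)) (\<chi> i. complex_of_real (x $ i)) = 0" for k
          using S_tangent[OF x] by (simp add: G_def)
        ultimately show ?thesis by (simp add: LIMSEQ_const_iff)
      next
        case False
        then show ?thesis by (simp add: X_def Z_def dotc_def)
      qed
    qed
    have "(\<lambda>L. sqrt (4 * pi * T L)) \<longlonglongrightarrow> sqrt (4 * pi * 0)" by (intro tendsto_intros T_lim)
    then have T': "(\<lambda>L. sqrt (4 * pi * T L)) \<longlonglongrightarrow> 0" by simp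
    show "(\<lambda>L. L2_field_norm M (\<lambda>\<omega> x. X \<omega> x - S L \<omega> x)) \<longlonglongrightarrow> 0"
    proof (rule tendsto_sandwich[OF _ _ tendsto_const T'])
      show "\<forall>\<^sub>F L in sequentially. L2_field_norm M (\<lambda>\<omega> x. X \<omega> x - S L \<omega> x) \<le> sqrt (4 * pi * T L)"
        by (intro always_eventually allI field_norm_from_pointwise(2)[OF diffm T_nonneg bound])
    qed (auto simp: L2_field_norm_def)
    fix x assume x: "x \<in> S2"
    show "square_integrable M (\<lambda>\<omega>. X \<omega> x)"
      by (rule square_integrable_if_nn_integral_le(1)[OF Xx[OF x] _ T_nonneg[of 0]]) (use bound[OF x, of 0] in \<open>simp add: S_0\<close>)
    have Sx: "(\<lambda>\<omega>. S N \<omega> x) \<in> borel_measurable M" for N using S_sq[OF x] by (simp add: square_integrable_def)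
    show "(\<lambda>L. \<integral>\<omega>. (norm (X \<omega> x - S L \<omega> x))\<^sup>2 \<partial>M) \<longlonglongrightarrow> 0"
    proof (rule tendsto_sandwich[OF _ _ tendsto_const T_lim])
      show "\<forall>\<^sub>F L in sequentially. (\<integral>\<omega>. (norm (X \<omega> x - S L \<omega> x))\<^sup>2 \<partial>M) \<le> T L"
        by (intro always_eventually allI square_integrable_if_nn_integral_le(2)[OF borel_measurable_diff[OF Xx[OF x] Sx] bound[OF x] T_nonneg])
    qed simp
  qed
  then show ?thesis by blast
qed

lemma field_sum_probability:
  assumes X: "is_field_sum M S X" and x: "x \<in> S2" and \<epsilon>: "0 < \<epsilon>"
  shows "measure M {\<omega> \<in> space M. norm (X \<omega> x - S L \<omega> x) \<ge> \<epsilon>} \<le> T L / \<epsilon>\<^sup>2"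
proof -
  note sq = field_sum_pointwise[OF X x, of L]
  have eq: "{\<omega> \<in> space M. norm (X \<omega> x - S L \<omega> x) \<ge> \<epsilon>} = {\<omega> \<in> space M. (norm (X \<omega> x - S L \<omega> x))\<^sup>2 \<ge> \<epsilon>\<^sup>2}"
    using \<epsilon> by (auto simp: abs_le_square_iff[symmetric])
  have "measure M {\<omega> \<in> space M. (norm (X \<omega> x - S L \<omega> x))\<^sup>2 \<ge> \<epsilon>\<^sup>2} \<le> (\<integral>\<omega>. (norm (X \<omega> x - S L \<omega> x))\<^sup>2 \<partial>M) / \<epsilon>\<^sup>2"
    by (rule integral_Markov_inequality_measure[where A="{}"])
      (use sq(1) \<epsilon> in \<open>auto simp: square_integrable_def\<close>)
  also have "\<dots> \<le> T L / \<epsilon>\<^sup>2" using sq(2) by (simp add: divide_right_mono)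
  finally show ?thesis unfolding eq .
qed

end

section \<open>Truncation errors\<close>

lemma truncated_field_diff:
  assumes "L \<le> N"
  shows "truncated_field Y Ih It N \<omega> x - truncated_field Y Ih It L \<omega> x =
    (\<Sum>j\<in>(SIGMA l:{Suc L..N}. {-int l..int l}). Ih (fst j) (snd j) \<omega> *s vsh_y Y (fst j) (snd j) x) +
    (\<Sum>j\<in>(SIGMA l:{Suc L..N}. {-int l..int l}). It (fst j) (snd j) \<omega> *s vsh_z Y (fst j) (snd j) x)"
proof -
  have un: "{1..N} = {1..L} \<union> {Suc L..N}" using assms by auto
  have "truncated_field Y Ih It N \<omega> x = truncated_field Y Ih It L \<omega> x +
      (\<Sum>l\<in>{Suc L..N}. \<Sum>m=-int l..int l. Ih l m \<omega> *s vsh_y Y l m x + It l m \<omega> *s vsh_z Y l m x)"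
    unfolding truncated_field_def un by (rule sum.union_disjoint) auto
  then show ?thesis
    by (simp add: sum.distrib sum.Sigma case_prod_beta)
qed

lemma dotc_add: "dotc (u + u') v = dotc u v + dotc u' v"
  by (simp add: dotc_def distrib_right sum.distrib)

lemma dotc_smult: "dotc (c *s u) v = c * dotc u v"
  by (simp add: dotc_def sum_distrib_left mult.assoc)

lemma dotc_sum: "dotc (\<Sum>k\<in>K. f k) v = (\<Sum>k\<in>K. dotc (f k) v)"
  by (induction K rule: infinite_finite_induct) (auto simp: dotc_add, auto simp: dotc_def)

text \<open>Orthogonality is asked for within each of the two families; the sum of both is handled
  by |a + b|^2 \<le> 2 |a|^2 + 2 |b|^2.\<close>

locale vsh_series = prob_space M + harmonic_basis Y q + weighted_tail w
  for M :: "'w measure" and Y q :: "nat \<Rightarrow> int \<Rightarrow> real^3 \<Rightarrow> complex" and w :: "nat \<Rightarrow> real" +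
  fixes Ih It :: "nat \<Rightarrow> int \<Rightarrow> 'w \<Rightarrow> complex" and V :: real
  assumes V: "0 \<le> V"
    and sq: "1 \<le> l \<Longrightarrow> \<bar>m\<bar> \<le> int l \<Longrightarrow> square_integrable M (Ih l m)"
      "1 \<le> l \<Longrightarrow> \<bar>m\<bar> \<le> int l \<Longrightarrow> square_integrable M (It l m)"
    and variance: "1 \<le> l \<Longrightarrow> \<bar>m\<bar> \<le> int l \<Longrightarrow> (\<integral>\<omega>. (norm (Ih l m \<omega>))\<^sup>2 \<partial>M) \<le> V * w l"
      "1 \<le> l \<Longrightarrow> \<bar>m\<bar> \<le> int l \<Longrightarrow> (\<integral>\<omega>. (norm (It l m \<omega>))\<^sup>2 \<partial>M) \<le> V * w l"
    and orthogonal: "1 \<le> l \<Longrightarrow> \<bar>m\<bar> \<le> int l \<Longrightarrow> 1 \<le> l' \<Longrightarrow> \<bar>m'\<bar> \<le> int l' \<Longrightarrow> (l, m) \<noteq> (l', m') \<Longrightarrow>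
        (\<integral>\<omega>. Ih l m \<omega> * cnj (Ih l' m' \<omega>) \<partial>M) = 0"
      "1 \<le> l \<Longrightarrow> \<bar>m\<bar> \<le> int l \<Longrightarrow> 1 \<le> l' \<Longrightarrow> \<bar>m'\<bar> \<le> int l' \<Longrightarrow> (l, m) \<noteq> (l', m') \<Longrightarrow>
        (\<integral>\<omega>. It l m \<omega> * cnj (It l' m' \<omega>) \<partial>M) = 0"
begin

lemma second_moment_block:
  fixes c :: "nat \<Rightarrow> int \<Rightarrow> 'w \<Rightarrow> complex" and v :: "nat \<Rightarrow> int \<Rightarrow> complex^3"
  assumes c_sq: "\<And>l m. 1 \<le> l \<Longrightarrow> \<bar>m\<bar> \<le> int l \<Longrightarrow> square_integrable M (c l m)"
    and c_var: "\<And>l m. 1 \<le> l \<Longrightarrow> \<bar>m\<bar> \<le> int l \<Longrightarrow> (\<integral>\<omega>. (norm (c l m \<omega>))\<^sup>2 \<partial>M) \<le> V * w l"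
    and c_orth: "\<And>l m l' m'. 1 \<le> l \<Longrightarrow> \<bar>m\<bar> \<le> int l \<Longrightarrow> 1 \<le> l' \<Longrightarrow> \<bar>m'\<bar> \<le> int l' \<Longrightarrow> (l, m) \<noteq> (l', m') \<Longrightarrow>
        (\<integral>\<omega>. c l m \<omega> * cnj (c l' m' \<omega>) \<partial>M) = 0"
    and v: "\<And>l. 1 \<le> l \<Longrightarrow> (\<Sum>m=-int l..int l. (norm (v l m))\<^sup>2) \<le> 1296 * (2 * real l + 1)"
    and LN: "L \<le> N"
  defines "J \<equiv> SIGMA l:{Suc L..N}. {-int l..int l}"
  shows "square_integrable M (\<lambda>\<omega>. \<Sum>j\<in>J. c (fst j) (snd j) \<omega> *s v (fst j) (snd j))"
    and "(\<integral>\<omega>. (norm (\<Sum>j\<in>J. c (fst j) (snd j) \<omega> *s v (fst j) (snd j)))\<^sup>2 \<partial>M) \<le> 1296 * V * tail L"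
proof -
  have fin: "finite J" by (simp add: J_def)
  have J: "1 \<le> fst j" "\<bar>snd j\<bar> \<le> int (fst j)" if "j \<in> J" for j
    using that by (auto simp: J_def)
  have c_sq': "square_integrable M (c (fst j) (snd j))" if "j \<in> J" for j by (rule c_sq[OF J[OF that]])
  have c_orth': "(\<integral>\<omega>. c (fst i) (snd i) \<omega> * cnj (c (fst j) (snd j) \<omega>) \<partial>M) = 0" if "i \<in> J" "j \<in> J" "i \<noteq> j" for i j
    by (rule c_orth[OF J[OF that(1)] J[OF that(2)]]) (use that(3) in \<open>auto simp: prod_eq_iff\<close>)
  note sums = expectation_norm_vec_sum_orthogonal[where J=J and c="\<lambda>j. c (fst j) (snd j)" and v="\<lambda>j. v (fst j) (snd j)", OF fin c_sq' c_orth']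
  show "square_integrable M (\<lambda>\<omega>. \<Sum>j\<in>J. c (fst j) (snd j) \<omega> *s v (fst j) (snd j))" by (rule sums(1))
  have "(\<integral>\<omega>. (norm (\<Sum>j\<in>J. c (fst j) (snd j) \<omega> *s v (fst j) (snd j)))\<^sup>2 \<partial>M) =
      (\<Sum>j\<in>J. (\<integral>\<omega>. (norm (c (fst j) (snd j) \<omega>))\<^sup>2 \<partial>M) * (norm (v (fst j) (snd j)))\<^sup>2)" by (rule sums(2))
  also have "\<dots> \<le> (\<Sum>j\<in>J. V * w (fst j) * (norm (v (fst j) (snd j)))\<^sup>2)"
    by (intro sum_mono mult_right_mono c_var J) auto
  also have "\<dots> = (\<Sum>l\<in>{Suc L..N}. V * w l * (\<Sum>m=-int l..int l. (norm (v l m))\<^sup>2))"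
    unfolding J_def by (simp add: sum.Sigma case_prod_beta sum_distrib_left)
  also have "\<dots> \<le> (\<Sum>l\<in>{Suc L..N}. V * w l * (1296 * (2 * real l + 1)))"
    by (intro sum_mono mult_left_mono v mult_nonneg_nonneg V nonneg) auto
  also have "\<dots> = 1296 * V * (\<Sum>l\<in>{Suc L..N}. (2 * real l + 1) * w l)"
    by (simp add: sum_distrib_left mult_ac)
  also have "\<dots> \<le> 1296 * V * tail L"
    using V by (intro mult_left_mono sum_le_tail LN) auto
  finally show "(\<integral>\<omega>. (norm (\<Sum>j\<in>J. c (fst j) (snd j) \<omega> *s v (fst j) (snd j)))\<^sup>2 \<partial>M) \<le> 1296 * V * tail L" .
qed

abbreviation "XL \<equiv> truncated_field Y Ih It"

text \<open>The constant is 5184 = (2 + 2) * 1296, one share for each family.\<close>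

lemma truncated_field_increment:
  assumes x: "x \<in> S2" and LN: "L \<le> N"
  shows "square_integrable M (\<lambda>\<omega>. XL N \<omega> x - XL L \<omega> x)"
    and "(\<integral>\<omega>. (norm (XL N \<omega> x - XL L \<omega> x))\<^sup>2 \<partial>M) \<le> 5184 * V * tail L"
proof -
  define J where "J = (SIGMA l:{Suc L..N}. {-int l..int l})"
  define a where "a \<omega> = (\<Sum>j\<in>J. Ih (fst j) (snd j) \<omega> *s vsh_y Y (fst j) (snd j) x)" for \<omega>
  define b where "b \<omega> = (\<Sum>j\<in>J. It (fst j) (snd j) \<omega> *s vsh_z Y (fst j) (snd j) x)" for \<omega>
  have eq: "(\<lambda>\<omega>. XL N \<omega> x - XL L \<omega> x) = (\<lambda>\<omega>. a \<omega> + b \<omega>)"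
    unfolding truncated_field_diff[OF LN] a_def b_def J_def by (rule refl)
  have a: "square_integrable M a" "(\<integral>\<omega>. (norm (a \<omega>))\<^sup>2 \<partial>M) \<le> 1296 * V * tail L"
    unfolding a_def[abs_def] J_def
    by (rule second_moment_block[OF sq(1) variance(1) orthogonal(1) sum_norm_vsh_le(1)[OF _ x] LN]; assumption)+
  have b: "square_integrable M b" "(\<integral>\<omega>. (norm (b \<omega>))\<^sup>2 \<partial>M) \<le> 1296 * V * tail L"
    unfolding b_def[abs_def] J_def
    by (rule second_moment_block[OF sq(2) variance(2) orthogonal(2) sum_norm_vsh_le(2)[OF _ x] LN]; assumption)+
  have ab: "square_integrable M (\<lambda>\<omega>. a \<omega> + b \<omega>)" by (rule square_integrable_add[OF a(1) b(1)])
  then show "square_integrable M (\<lambda>\<omega>. XL N \<omega> x - XL L \<omega> x)" unfolding eq .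
  have int: "integrable M (\<lambda>\<omega>. (norm (a \<omega>))\<^sup>2)" "integrable M (\<lambda>\<omega>. (norm (b \<omega>))\<^sup>2)"
    using a(1) b(1) by (auto simp: square_integrable_def)
  have "(\<integral>\<omega>. (norm (a \<omega> + b \<omega>))\<^sup>2 \<partial>M) \<le> (\<integral>\<omega>. 2 * (norm (a \<omega>))\<^sup>2 + 2 * (norm (b \<omega>))\<^sup>2 \<partial>M)"
  proof (rule integral_mono)
    show "integrable M (\<lambda>\<omega>. (norm (a \<omega> + b \<omega>))\<^sup>2)" using ab by (simp add: square_integrable_def)
    fix \<omega>
    have "(norm (a \<omega> + b \<omega>))\<^sup>2 \<le> (norm (a \<omega>) + norm (b \<omega>))\<^sup>2" by (intro power_mono norm_triangle_ineq) auto
    also have "\<dots> \<le> 2 * (norm (a \<omega>))\<^sup>2 + 2 * (norm (b \<omega>))\<^sup>2"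
      using power2_diff_le[of "norm (a \<omega>)" "- norm (b \<omega>)"] by simp
    finally show "(norm (a \<omega> + b \<omega>))\<^sup>2 \<le> 2 * (norm (a \<omega>))\<^sup>2 + 2 * (norm (b \<omega>))\<^sup>2" .
  qed (use int in auto)
  also have "\<dots> = 2 * (\<integral>\<omega>. (norm (a \<omega>))\<^sup>2 \<partial>M) + 2 * (\<integral>\<omega>. (norm (b \<omega>))\<^sup>2 \<partial>M)" using int by simp
  also have "\<dots> \<le> 5184 * V * tail L" using a(2) b(2) by simp
  finally show "(\<integral>\<omega>. (norm (XL N \<omega> x - XL L \<omega> x))\<^sup>2 \<partial>M) \<le> 5184 * V * tail L"
    unfolding fun_cong[OF eq] .
qed

lemma truncated_field_0: "XL 0 \<omega> x = 0"
  by (simp add: truncated_field_def)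

sublocale cauchy_fields M XL "\<lambda>L. 5184 * V * tail L"
proof
  show "(\<lambda>(\<omega>, x). XL L \<omega> x) \<in> borel_measurable (M \<Otimes>\<^sub>M sphere_measure)" for L
  proof -
    have "(\<lambda>z. Ih l m (fst z) *s vsh_y Y l m (snd z)) \<in> borel_measurable (M \<Otimes>\<^sub>M sphere_measure)"
      "(\<lambda>z. It l m (fst z) *s vsh_z Y l m (snd z)) \<in> borel_measurable (M \<Otimes>\<^sub>M sphere_measure)"
      if "1 \<le> l" "\<bar>m\<bar> \<le> int l" for l m
    proof -
      have c: "continuous_on UNIV (\<lambda>p::complex \<times> (complex^3). fst p *s snd p)"
        unfolding vector_scalar_mult_def by (intro continuous_intros)
      have [measurable]: "Ih l m \<in> borel_measurable M" "It l m \<in> borel_measurable M"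
        using sq that by (auto simp: square_integrable_def)
      note [measurable] = measurable_vsh[OF that(2)]
      have "(\<lambda>z. (Ih l m (fst z), vsh_y Y l m (snd z))) \<in> borel_measurable (M \<Otimes>\<^sub>M sphere_measure)"
        "(\<lambda>z. (It l m (fst z), vsh_z Y l m (snd z))) \<in> borel_measurable (M \<Otimes>\<^sub>M sphere_measure)"
        by (intro borel_measurable_Pair; measurable)+
      from this[THEN measurable_compose, OF borel_measurable_continuous_onI[OF c]] show
        "(\<lambda>z. Ih l m (fst z) *s vsh_y Y l m (snd z)) \<in> borel_measurable (M \<Otimes>\<^sub>M sphere_measure)"
        "(\<lambda>z. It l m (fst z) *s vsh_z Y l m (snd z)) \<in> borel_measurable (M \<Otimes>\<^sub>M sphere_measure)"
        by simp_all
    qed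
    then show ?thesis
      unfolding truncated_field_def case_prod_beta'
      by (intro borel_measurable_sum borel_measurable_add) auto
  qed
  show "square_integrable M (\<lambda>\<omega>. XL L \<omega> x)" if "x \<in> S2" for L x
    using truncated_field_increment(1)[OF that, of 0 L] by (simp add: truncated_field_0)
  show "dotc (XL L \<omega> x) (\<chi> i. complex_of_real (x $ i)) = 0" if x: "x \<in> S2" for x L \<omega>
    unfolding truncated_field_def using vsh_tangent[OF _ x]
    by (simp add: dotc_sum dotc_add dotc_smult abs_le_iff)
  show "XL 0 \<omega> x = 0" for \<omega> x by (rule truncated_field_0)
  show "(\<integral>\<omega>. (norm (XL N \<omega> x - XL L \<omega> x))\<^sup>2 \<partial>M) \<le> 5184 * V * tail L" if "x \<in> S2" "L \<le> N" for x L N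
    by (rule truncated_field_increment(2)[OF that])
  have "(\<lambda>L. 5184 * V * tail L) \<longlonglongrightarrow> 5184 * V * 0" by (intro tendsto_intros tail_tendsto_0)
  then show "(\<lambda>L. 5184 * V * tail L) \<longlonglongrightarrow> 0" by simp
  show "0 \<le> 5184 * V * tail L" for L using V tail_nonneg by simp
qed

lemma field_sum_estimates:
  assumes X: "is_field_sum M XL X"
  shows "\<exists>D>0. (\<forall>L. L2_field_norm M (\<lambda>\<omega> x. X \<omega> x - XL L \<omega> x) \<le> D * sqrt (tail L)) \<and>
    (\<forall>L. \<forall>x\<in>S2. sqrt (\<integral>\<omega>. (norm (X \<omega> x - XL L \<omega> x))\<^sup>2 \<partial>M) \<le> D * sqrt (tail L)) \<and>
    (\<forall>L. \<forall>x\<in>S2. \<forall>\<epsilon>>0.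
      measure M {\<omega> \<in> space M. norm (X \<omega> x - XL L \<omega> x) \<ge> \<epsilon>} \<le> D * tail L / \<epsilon>\<^sup>2)"
\<comment> \<open>One constant for all three estimates: the sum of theirs, plus 1 to be positive
  even for V = 0.\<close>
proof (intro exI[of _ "sqrt (4 * pi * (5184 * V)) + sqrt (5184 * V) + 5184 * V + 1"] conjI allI ballI impI)
  let ?D = "sqrt (4 * pi * (5184 * V)) + sqrt (5184 * V) + 5184 * V + 1"
  have nn: "0 \<le> sqrt (4 * pi * (5184 * V))" "0 \<le> sqrt (5184 * V)" "0 \<le> 5184 * V" using V by auto
  then show "0 < ?D" by linarith
  fix L
  have "L2_field_norm M (\<lambda>\<omega> x. X \<omega> x - XL L \<omega> x) \<le> sqrt (4 * pi * (5184 * V * tail L))"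
    by (rule field_sum_L2[OF X])
  also have "\<dots> = sqrt (4 * pi * (5184 * V)) * sqrt (tail L)" by (simp add: real_sqrt_mult)
  also have "\<dots> \<le> ?D * sqrt (tail L)" using nn tail_nonneg by (intro mult_right_mono) auto
  finally show "L2_field_norm M (\<lambda>\<omega> x. X \<omega> x - XL L \<omega> x) \<le> ?D * sqrt (tail L)" .
  fix x :: "real^3" assume x: "x \<in> S2"
  have "sqrt (\<integral>\<omega>. (norm (X \<omega> x - XL L \<omega> x))\<^sup>2 \<partial>M) \<le> sqrt (5184 * V * tail L)"
    by (intro real_sqrt_le_mono field_sum_pointwise(2)[OF X x])
  also have "\<dots> = sqrt (5184 * V) * sqrt (tail L)" by (simp add: real_sqrt_mult)
  also have "\<dots> \<le> ?D * sqrt (tail L)" using nn tail_nonneg by (intro mult_right_mono) auto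
  finally show "sqrt (\<integral>\<omega>. (norm (X \<omega> x - XL L \<omega> x))\<^sup>2 \<partial>M) \<le> ?D * sqrt (tail L)" .
  fix \<epsilon> :: real assume \<epsilon>: "0 < \<epsilon>"
  have "measure M {\<omega> \<in> space M. norm (X \<omega> x - XL L \<omega> x) \<ge> \<epsilon>} \<le> 5184 * V * tail L / \<epsilon>\<^sup>2"
    by (rule field_sum_probability[OF X x \<epsilon>])
  also have "\<dots> \<le> ?D * tail L / \<epsilon>\<^sup>2"
    using nn tail_nonneg by (intro divide_right_mono mult_right_mono) auto
  finally show "measure M {\<omega> \<in> space M. norm (X \<omega> x - XL L \<omega> x) \<ge> \<epsilon>} \<le> ?D * tail L / \<epsilon>\<^sup>2" .
qed

end

section \<open>Assembly of the estimates\<close>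

lemma psi_pos: "1 \<le> l \<Longrightarrow> 0 < psi \<alpha> \<gamma> (eigval l)"
  using eigval_pos[of l] by (simp add: psi_def)

theorem corollary4p4:
  fixes P :: "'w measure"
    and Y :: "nat \<Rightarrow> int \<Rightarrow> real^3 \<Rightarrow> complex"
    and Bh Bt :: "nat \<Rightarrow> int \<Rightarrow> real \<Rightarrow> 'w \<Rightarrow> complex"
    and Ih It :: "nat \<Rightarrow> int \<Rightarrow> 'w \<Rightarrow> complex"
    and A1 A2 :: "nat \<Rightarrow> real"
    and \<alpha> \<beta> \<gamma> H \<tau> t :: real
  assumes P: "prob_space P"
    and Y: "spherical_harmonic_basis Y"
    and \<alpha>: "0 < \<alpha>" "\<alpha> \<le> 2"
    and \<gamma>: "0 \<le> \<alpha> + \<gamma>" "\<alpha> + \<gamma> \<le> 2"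
    and \<beta>: "0 < \<beta>" "\<beta> \<le> 1"
    and H: "1/2 \<le> H" "H < 1"
    and \<tau>: "\<tau> = max (2 / \<beta> * (1 - \<beta> - H)) 0"
    and B: "fBm_families P H A1 A2 Bh Bt"
    and A1: "summable (\<lambda>l. (2 * real l + 1) * A1 l)"
    and A2: "summable (\<lambda>l. (2 * real l + 1) * A2 l)"
    and A1\<tau>: "summable (\<lambda>l. (2 * real l + 1) * psi \<alpha> \<gamma> (eigval l) powr \<tau> * A1 l)"
    and A2\<tau>: "summable (\<lambda>l. (2 * real l + 1) * psi \<alpha> \<gamma> (eigval l) powr \<tau> * A2 l)"
    and t: "0 < t"
    and Ih: "\<And>l m. 1 \<le> l \<Longrightarrow> \<bar>m\<bar> \<le> int l \<Longrightarrow>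
          has_stochastic_integral P (ml_kernel \<beta> (psi \<alpha> \<gamma> (eigval l)) t) (Bh l m) t (Ih l m)"
    and It: "\<And>l m. 1 \<le> l \<Longrightarrow> \<bar>m\<bar> \<le> int l \<Longrightarrow>
          has_stochastic_integral P (ml_kernel \<beta> (psi \<alpha> \<gamma> (eigval l)) t) (Bt l m) t (It l m)"
  shows
    "let XL = truncated_field Y Ih It;
         tail = (\<lambda>L. \<Sum>k. (2 * real (L + 1 + k) + 1) * (A1 (L + 1 + k) + A2 (L + 1 + k)) *
                            psi \<alpha> \<gamma> (eigval (L + 1 + k)) powr \<tau>);
         decay = (\<lambda>\<nu>. \<exists>C0>0. \<exists>l0\<ge>1. \<forall>l\<ge>l0.
                    (A1 l + A2 l) * psi \<alpha> \<gamma> (eigval l) powr \<tau> \<le> C0 * real l powr (-\<nu>))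
     in
     (\<exists>X. is_field_sum P XL X) \<and>
     (\<forall>X. is_field_sum P XL X \<longrightarrow>
        (\<exists>C>0. \<forall>L\<ge>1.
           L2_field_norm P (\<lambda>\<omega> x. X \<omega> x - XL L \<omega> x) \<le> C * sqrt (tail L)) \<and>
        (\<forall>\<nu>>2. decay \<nu> \<longrightarrow>
           (\<exists>C>0. \<forall>L\<ge>1.
              L2_field_norm P (\<lambda>\<omega> x. X \<omega> x - XL L \<omega> x) \<le> C * real L powr (- (\<nu> - 2) / 2))) \<and>
        (\<exists>C>0. \<forall>L\<ge>1. \<forall>x\<in>S2.
           sqrt (\<integral>\<omega>. (norm (X \<omega> x - XL L \<omega> x))\<^sup>2 \<partial>P) \<le> C * sqrt (tail L)) \<and>
        (\<forall>\<nu>>2. decay \<nu> \<longrightarrow>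
           (\<exists>C>0. \<forall>L\<ge>1. \<forall>x\<in>S2.
              sqrt (\<integral>\<omega>. (norm (X \<omega> x - XL L \<omega> x))\<^sup>2 \<partial>P) \<le> C * real L powr (- (\<nu> - 2) / 2))) \<and>
        (\<forall>\<nu>>2. decay \<nu> \<longrightarrow>
           (\<exists>C>0. \<forall>L\<ge>1. \<forall>x\<in>S2. \<forall>\<epsilon>>0.
              measure P {\<omega> \<in> space P. norm (X \<omega> x - XL L \<omega> x) \<ge> \<epsilon>}
                \<le> C / (real L powr (\<nu> - 2) * \<epsilon>\<^sup>2))))"
proof -
  interpret prob_space P by (rule P)
  have ex: "\<exists>p. \<bar>m\<bar> \<le> int l \<longrightarrow> solid_harmonic l p \<and> (\<forall>x\<in>S2. Y l m x = p x)" for l m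
    using Y unfolding spherical_harmonic_basis_def by (metis spherical_harmonicE)
  define q where "q l m = (SOME p. \<bar>m\<bar> \<le> int l \<longrightarrow> solid_harmonic l p \<and> (\<forall>x\<in>S2. Y l m x = p x))" for l m
  have q: "solid_harmonic l (q l m) \<and> (\<forall>x\<in>S2. Y l m x = q l m x)" if "\<bar>m\<bar> \<le> int l" for l m
    using someI_ex[OF ex[of m l]] that unfolding q_def by (rule mp)
  have fBm: "complex_fBm P H (A1 l) (Bh l m)" "complex_fBm P H (A2 l) (Bt l m)" if "1 \<le> l" "\<bar>m\<bar> \<le> int l" for l m
    using B that by (auto simp: fBm_families_def)
  define X where "X = case_sum (\<lambda>(l, m). sample_path (Bh l m)) (\<lambda>(l, m). sample_path (Bt l m))"
  define I where "I = {(l, m). 1 \<le> l \<and> \<bar>m\<bar> \<le> int l} <+> {(l, m). 1 \<le> l \<and> \<bar>m\<bar> \<le> int l}"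
  have ind: "indep_vars (\<lambda>_. path_space) X I"
    using B by (simp add: fBm_families_def X_def I_def)
  have psi0: "0 \<le> psi \<alpha> \<gamma> (eigval l)" for l by (simp add: psi_def)
  define w where "w l = (A1 l + A2 l) * psi \<alpha> \<gamma> (eigval l) powr \<tau>" for l
  define V where "V = 2 * ml_variance_const \<beta> H t"
  have V0: "0 \<le> V" by (simp add: V_def ml_variance_const_def)
  note var1 = complex_ml_integral_variance[OF fBm(1) H(1) \<beta> t psi0 Ih]
  note var2 = complex_ml_integral_variance[OF fBm(2) H(1) \<beta> t psi0 It]
  \<comment> \<open>The order m = 0 is admissible in every degree, and A is the variance of an
    actual process.\<close>
  have A_nonneg: "0 \<le> A1 l" "0 \<le> A2 l" if "1 \<le> l" for l
    using var1(4)[of l 0] var2(4)[of l 0] that by auto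
  \<comment> \<open>The place where \<tau> enters: either the integrals force both variances to
    vanish, or \<tau> = 0 and the weight is 1. The latter uses \<psi> > 0, since
    \<open>0 powr 0 = 0\<close>.\<close>
  have A_le: "A1 l \<le> w l" "A2 l \<le> w l" if l: "1 \<le> l" for l
  proof -
    have "A1 l \<le> w l \<and> A2 l \<le> w l"
    proof (cases "\<beta> + H \<le> 1")
      case True
      then have "A1 l = 0" "A2 l = 0" using var1(3)[of l 0] var2(3)[of l 0] l by auto
      then show ?thesis by (simp add: w_def)
    next
      case False
      then have "2 / \<beta> * (1 - \<beta> - H) \<le> 0" using \<beta> by (intro mult_nonneg_nonpos) auto
      then have "\<tau> = 0" unfolding \<tau> by simp
      then have "w l = A1 l + A2 l" using psi_pos[OF l, of \<alpha> \<gamma>] by (simp add: w_def)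
      then show ?thesis using A_nonneg[OF l] by simp
    qed
    then show "A1 l \<le> w l" "A2 l \<le> w l" by auto
  qed
  interpret vsh_series P Y q w Ih It V
  proof
    show "spherical_harmonic_basis Y" by (rule Y)
    show "solid_harmonic l (q l m)" if "\<bar>m\<bar> \<le> int l" for l m using q[OF that] by simp
    show "Y l m x = q l m x" if "\<bar>m\<bar> \<le> int l" "x \<in> S2" for l m x using q[OF that(1)] that(2) by blast
    show "0 \<le> w l" if "1 \<le> l" for l using A_nonneg[OF that] by (simp add: w_def)
    show "summable (\<lambda>l. (2 * real l + 1) * w l)"
      using summable_add[OF A1\<tau> A2\<tau>] by (simp add: w_def algebra_simps)
    show "0 \<le> V" by (rule V0)
    fix l m assume l: "1 \<le> l" and m: "\<bar>m\<bar> \<le> int l"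
    show sq: "square_integrable P (Ih l m)" "square_integrable P (It l m)"
      by (rule var1(1)[OF l m l m] var2(1)[OF l m l m])+
    show "(\<integral>\<omega>. (norm (Ih l m \<omega>))\<^sup>2 \<partial>P) \<le> V * w l"
      using var1(2)[OF l m l m] mult_left_mono[OF A_le(1)[OF l] V0] by (simp add: V_def)
    show "(\<integral>\<omega>. (norm (It l m \<omega>))\<^sup>2 \<partial>P) \<le> V * w l"
      using var2(2)[OF l m l m] mult_left_mono[OF A_le(2)[OF l] V0] by (simp add: V_def)
    fix l' m' assume l': "1 \<le> l'" and m': "\<bar>m'\<bar> \<le> int l'" and ne: "(l, m) \<noteq> (l', m')"
    show "(\<integral>\<omega>. Ih l m \<omega> * cnj (Ih l' m' \<omega>) \<partial>P) = 0"
      by (rule indep_stochastic_integrals_orthogonal[OF ind, of "Inl (l, m)" "Inl (l', m')", OF _ _ _ _ _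
            fBm(1)[OF l m] fBm(1)[OF l' m'] t Ih[OF l m] Ih[OF l' m'] var1(1)[OF l m l m] var1(1)[OF l' m' l' m']])
        (use l m l' m' ne in \<open>auto simp: I_def X_def\<close>)
    show "(\<integral>\<omega>. It l m \<omega> * cnj (It l' m' \<omega>) \<partial>P) = 0"
      by (rule indep_stochastic_integrals_orthogonal[OF ind, of "Inr (l, m)" "Inr (l', m')", OF _ _ _ _ _
            fBm(2)[OF l m] fBm(2)[OF l' m'] t It[OF l m] It[OF l' m'] var2(1)[OF l m l m] var2(1)[OF l' m' l' m']])
        (use l m l' m' ne in \<open>auto simp: I_def X_def\<close>)
  qed
  have tail_eq: "(\<Sum>k. (2 * real (L + 1 + k) + 1) * (A1 (L + 1 + k) + A2 (L + 1 + k)) *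
      psi \<alpha> \<gamma> (eigval (L + 1 + k)) powr \<tau>) = tail L" for L
    unfolding tail_def w_def by (simp only: mult.assoc)
  have decay_tail: "\<exists>C>0. \<forall>L\<ge>1. tail L \<le> C * real L powr (- (\<nu> - 2))"
    if "2 < \<nu>" and "\<exists>C0>0. \<exists>l0\<ge>1. \<forall>l\<ge>l0. (A1 l + A2 l) * psi \<alpha> \<gamma> (eigval l) powr \<tau> \<le> C0 * real l powr (-\<nu>)" for \<nu>
    using that tail_decay[of \<nu>] unfolding w_def by blast
  have sqrt_decay: "\<exists>C>0. \<forall>L\<ge>1. D * sqrt (tail L) \<le> C * real L powr (- (\<nu> - 2) / 2)"
    if D: "0 < D" and \<nu>: "2 < \<nu>" and dec: "\<exists>C0>0. \<exists>l0\<ge>1. \<forall>l\<ge>l0. (A1 l + A2 l) * psi \<alpha> \<gamma> (eigval l) powr \<tau> \<le> C0 * real l powr (-\<nu>)"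
    for D \<nu>
  proof -
    obtain C where C: "C > 0" "\<And>L. 1 \<le> L \<Longrightarrow> tail L \<le> C * real L powr (- (\<nu> - 2))"
      using decay_tail[OF \<nu> dec] by blast
    have "D * sqrt (tail L) \<le> (D * sqrt C) * real L powr (- (\<nu> - 2) / 2)" if "1 \<le> L" for L
    proof -
      have "sqrt (tail L) \<le> sqrt (C * real L powr (- (\<nu> - 2)))" using C(2)[OF that] by simp
      also have "\<dots> = sqrt C * real L powr (- (\<nu> - 2) / 2)"
        by (simp add: real_sqrt_mult powr_half_sqrt_powr)
      finally show ?thesis using D by (simp add: mult.assoc)
    qed
    then show ?thesis using C D by (intro exI[of _ "D * sqrt C"]) auto
  qed
  show ?thesis
    unfolding Let_def tail_eq
  proof (intro conjI allI impI)
    show "\<exists>X. is_field_sum P (truncated_field Y Ih It) X" by (rule field_sum_exists)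
  next
    fix X assume "is_field_sum P (truncated_field Y Ih It) X"
    from field_sum_estimates[OF this] obtain D where D: "D > 0"
      "L2_field_norm P (\<lambda>\<omega> x. X \<omega> x - XL L \<omega> x) \<le> D * sqrt (tail L)"
      "x \<in> S2 \<Longrightarrow> sqrt (\<integral>\<omega>. (norm (X \<omega> x - XL L \<omega> x))\<^sup>2 \<partial>P) \<le> D * sqrt (tail L)"
      "x \<in> S2 \<Longrightarrow> 0 < \<epsilon> \<Longrightarrow>
        measure P {\<omega> \<in> space P. norm (X \<omega> x - XL L \<omega> x) \<ge> \<epsilon>} \<le> D * tail L / \<epsilon>\<^sup>2" for L x \<epsilon>
      by blast
    show "\<exists>C>0. \<forall>L\<ge>1. L2_field_norm P (\<lambda>\<omega> x. X \<omega> x - XL L \<omega> x) \<le> C * sqrt (tail L)"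
      using D(1,2) by blast
    show "\<exists>C>0. \<forall>L\<ge>1. \<forall>x\<in>S2. sqrt (\<integral>\<omega>. (norm (X \<omega> x - XL L \<omega> x))\<^sup>2 \<partial>P) \<le> C * sqrt (tail L)"
      using D(1,3) by blast
    fix \<nu> :: real
    assume \<nu>: "2 < \<nu>" and dec: "\<exists>C0>0. \<exists>l0\<ge>1. \<forall>l\<ge>l0. (A1 l + A2 l) * psi \<alpha> \<gamma> (eigval l) powr \<tau> \<le> C0 * real l powr (-\<nu>)"
    obtain C where C: "C > 0" "\<And>L. 1 \<le> L \<Longrightarrow> D * sqrt (tail L) \<le> C * real L powr (- (\<nu> - 2) / 2)"
      using sqrt_decay[OF D(1) \<nu> dec] by blast
    show "\<exists>C>0. \<forall>L\<ge>1. L2_field_norm P (\<lambda>\<omega> x. X \<omega> x - XL L \<omega> x) \<le> C * real L powr (- (\<nu> - 2) / 2)"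
      using C order.trans[OF D(2)] by blast
    show "\<exists>C>0. \<forall>L\<ge>1. \<forall>x\<in>S2. sqrt (\<integral>\<omega>. (norm (X \<omega> x - XL L \<omega> x))\<^sup>2 \<partial>P) \<le> C * real L powr (- (\<nu> - 2) / 2)"
      using C order.trans[OF D(3)] by blast
    \<comment> \<open>The probability involves the tail and not its root, so the full exponent \<nu>
      - 2 appears here.\<close>
    obtain C' where C': "C' > 0" "\<And>L. 1 \<le> L \<Longrightarrow> tail L \<le> C' * real L powr (- (\<nu> - 2))"
      using decay_tail[OF \<nu> dec] by blast
    have "measure P {\<omega> \<in> space P. norm (X \<omega> x - XL L \<omega> x) \<ge> \<epsilon>} \<le> (D * C') / (real L powr (\<nu> - 2) * \<epsilon>\<^sup>2)"
      if "1 \<le> L" "x \<in> S2" "0 < \<epsilon>" for L x \<epsilon>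
    proof -
      have "D * tail L / \<epsilon>\<^sup>2 \<le> D * (C' * real L powr (- (\<nu> - 2))) / \<epsilon>\<^sup>2"
        using D(1) C'(2)[OF that(1)] by (intro divide_right_mono mult_left_mono) auto
      also have "\<dots> = (D * C') / (real L powr (\<nu> - 2) * \<epsilon>\<^sup>2)"
        unfolding powr_minus_divide by simp
      finally show ?thesis using D(4)[OF that(2,3), of L] by linarith
    qed
    then show "\<exists>C>0. \<forall>L\<ge>1. \<forall>x\<in>S2. \<forall>\<epsilon>>0. measure P {\<omega> \<in> space P. norm (X \<omega> x - XL L \<omega> x) \<ge> \<epsilon>}
        \<le> C / (real L powr (\<nu> - 2) * \<epsilon>\<^sup>2)"
      using D(1) C'(1) by (intro exI[of _ "D * C'"]) auto
  qed
qed

end
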